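(* Let $\iota_Y\colon A\to Y$ be a map of $\mathcal M$ and let $n\geq 0$ be an integer. (Simple version) The following conditions are equivalent: (1) $\mathrm{secat}(\iota_Y)\leq n$; (2) $\iota_Y$ is simply dominated by a map $\iota_X\colon A\to X$ such that $\mathrm{Pushcat}(\iota_X)\leq n$; (3) $\iota_Y$ is simply dominated by a map $\iota_{X'}\colon A\to X'$ such that $\mathrm{Relcat}(\iota_{X'})\leq n$. (Relative version) The following conditions are equivalent: (1) $\mathrm{relcat}(\iota_Y)\leq n$; (2) $\iota_Y$ is relatively dominated by a map $\iota_X\colon A\to X$ such that $\mathrm{Pushcat}(\iota_X)\leq n$; (3) $\iota_Y$ is relatively dominated by a map $\iota_{X'}\colon A\to X'$ such that $\mathrm{Relcat}(\iota_{X'})\leq n$.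
   Context: Setting. $\mathcal M$ is a closed model category satisfying the Cube axiom: in any homotopy commutative cube whose bottom face is a homotopy pushout and whose four vertical faces are homotopy pullbacks, the top face is a homotopy pushout. (Main example: the category of well-pointed topological spaces, i.e. pointed spaces whose base point inclusion is a closed cofibration.) Objects are taken cofibrant-fibrant (replacing them if necessary), and $\simeq$ denotes homotopy of maps. A homotopy commutative diagram includes a choice of mutually compatible homotopies. The whisker map is the map (unique up to homotopy once homotopies are fixed) induced out of a homotopy pushout, or into a homotopy pullback, by a homotopy commutative square. Ganea construction. For a map $\iota_X\colon A\to X$, put $G_0=A$, $g_0=\iota_X$, $\alpha_0=\mathrm{id}_A$. Given $g_i\colon G_i\to X$, let $F_i$ be the homotopy pullback of $\iota_X\colon A\to X$ and $g_i\colon G_i\to X$, with maps $\eta_i\colon F_i\to A$, $\beta_i\colon F_i\to G_i$; let $G_{i+1}$ be the homotopy pushout of $\eta_i$ and $\beta_i$, with maps $\alpha_{i+1}\colon A\to G_{i+1}$, $\gamma_i\colon G_i\to G_{i+1}$; and let $g_{i+1}\colon G_{i+1}\to X$ be the whisker map induced by $\iota_X$ and $g_i$. Write $G_i=G_i(\iota_X)$. $\mathrm{secat}(\iota_X)$ is the least integer $n\ge 0$ such that $g_n\colon G_n(\iota_X)\to X$ has a homotopy section $\sigma$, i.e. $g_n\circ\sigma\simeq\mathrm{id}_X$. $\mathrm{relcat}(\iota_X)$ is the least $n\ge0$ such that $g_n$ has a homotopy section $\sigma$ with $\sigma\circ\iota_X\simeq\alpha_n$. (All invariants are $\infty$ if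 no such $n$ exists.) $\mathrm{Pushcat}(\iota_X)$ (strong pushout category) is the least $n\ge0$ such that there are objects $X_0,\dots,X_n=X$ and maps $\iota_i\colon A\to X_i$ with: $\iota_0$ has a homotopy inverse; for each $0\le i<n$ there is an object $Z_i$ and a homotopy pushout of maps $Z_i\to A$ and $Z_i\to X_i$ with pushout object $X_{i+1}$ and structure maps $\iota_{i+1}\colon A\to X_{i+1}$ and $\chi_i\colon X_i\to X_{i+1}$, such that $\chi_i\circ\iota_i\simeq\iota_{i+1}$; and $\iota_n\simeq\iota_X$. $\mathrm{Relcat}(\iota_X)$ (strong relative category) is the least $n\ge0$ such that there are objects $X_0,\dots,X_n=X$ and maps $\iota_i\colon A\to X_i$ with: $\iota_0$ has a homotopy inverse; for each $0\le i<n$ there are maps $\rho_i\colon Z_i\to A$ and $\tau_i\colon Z_i\to X_i$ whose homotopy pushout is $X_{i+1}$ with structure maps $\iota_{i+1}\colon A\to X_{i+1}$ and $\chi_i\colon X_i\to X_{i+1}$, and a map $\sigma_i\colon A\to Z_i$ with $\rho_i\circ\sigma_i\simeq\mathrm{id}_A$ and $\tau_i\circ\sigma_i\simeq\iota_i$ (the whole diagram being homotopy commutative); and $\iota_n\simeq\iota_X$. Domination. Let $\iota_X\colon A\to X$ and $\iota_Y\colon A\to Y$ be maps. $\iota_Y$ is simply dominated by $\iota_X$ if there are maps $\varphi\colon X\to Y$ and $\sigma\colon Y\to X$ with $\varphi\circ\iota_X\simeq\iota_Y$ and $\varphi\circ\sigma\simeq\mathrm{id}_Y$. It is relatively dominated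 by $\iota_X$ if moreover $\sigma\circ\iota_Y\simeq\iota_X$. *)

theory Defs
  imports Main "HOL-Library.Extended_Nat"
begin

section \<open>Categories\<close>

record ('o, 'm) cat =
  Ob :: "'o set"
  Ar :: "'m set"
  Dom :: "'m \<Rightarrow> 'o"
  Cod :: "'m \<Rightarrow> 'o"
  Id :: "'o \<Rightarrow> 'm"
  Comp :: "'m \<Rightarrow> 'm \<Rightarrow> 'm"  (infixr "\<cdot>\<index>" 70)

definition hom :: "('o, 'm, 'x) cat_scheme \<Rightarrow> 'o \<Rightarrow> 'o \<Rightarrow> 'm set" where
  "hom C a b = {f \<in> Ar C. Dom C f = a \<and> Cod C f = b}"

locale category =
  fixes C :: "('o, 'm, 'x) cat_scheme" (structure)
  assumes dom_in_Ob: "f \<in> Ar C \<Longrightarrow> Dom C f \<in> Ob C"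
    and cod_in_Ob: "f \<in> Ar C \<Longrightarrow> Cod C f \<in> Ob C"
    and id_in_hom: "a \<in> Ob C \<Longrightarrow> Id C a \<in> hom C a a"
    and comp_in_hom: "f \<in> hom C a b \<Longrightarrow> g \<in> hom C b c \<Longrightarrow> g \<cdot> f \<in> hom C a c"
    and comp_id_left: "f \<in> hom C a b \<Longrightarrow> Id C b \<cdot> f = f"
    and comp_id_right: "f \<in> hom C a b \<Longrightarrow> f \<cdot> Id C a = f"
    and comp_assoc: "f \<in> hom C a b \<Longrightarrow> g \<in> hom C b c \<Longrightarrow> h \<in> hom C c d
                       \<Longrightarrow> (h \<cdot> g) \<cdot> f = h \<cdot> (g \<cdot> f)"

definition is_initial :: "('o, 'm, 'x) cat_scheme \<Rightarrow> 'o \<Rightarrow> bool" where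
  "is_initial C e \<longleftrightarrow> e \<in> Ob C \<and> (\<forall>x \<in> Ob C. \<exists>!f. f \<in> hom C e x)"

definition is_terminal :: "('o, 'm, 'x) cat_scheme \<Rightarrow> 'o \<Rightarrow> bool" where
  "is_terminal C e \<longleftrightarrow> e \<in> Ob C \<and> (\<forall>x \<in> Ob C. \<exists>!f. f \<in> hom C x e)"

definition is_coproduct :: "('o, 'm, 'x) cat_scheme \<Rightarrow> 'o \<Rightarrow> 'o \<Rightarrow> 'm \<Rightarrow> 'm \<Rightarrow> bool" where
  "is_coproduct C x y p q \<longleftrightarrow>
     (\<exists>c. p \<in> hom C x c \<and> q \<in> hom C y c \<and>
       (\<forall>t. \<forall>u \<in> hom C x t. \<forall>v \<in> hom C y t.
          \<exists>!m. m \<in> hom C c t \<and> m \<cdot>\<^bsub>C\<^esub> p = u \<and> m \<cdot>\<^bsub>C\<^esub> q = v))"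

text \<open>The arguments of the following predicates are the sides of a square
  \<open>f: z \<rightarrow> a\<close>, \<open>g: z \<rightarrow> b\<close>, \<open>h: a \<rightarrow> d\<close>, \<open>k: b \<rightarrow> d\<close>.\<close>

definition commutes :: "('o, 'm, 'x) cat_scheme \<Rightarrow> 'm \<Rightarrow> 'm \<Rightarrow> 'm \<Rightarrow> 'm \<Rightarrow> bool" where
  "commutes C f g h k \<longleftrightarrow>
     (\<exists>z a b d. f \<in> hom C z a \<and> g \<in> hom C z b \<and> h \<in> hom C a d \<and> k \<in> hom C b d)
     \<and> h \<cdot>\<^bsub>C\<^esub> f = k \<cdot>\<^bsub>C\<^esub> g"

definition is_pushout :: "('o, 'm, 'x) cat_scheme \<Rightarrow> 'm \<Rightarrow> 'm \<Rightarrow> 'm \<Rightarrow> 'm \<Rightarrow> bool" where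
  "is_pushout C f g h k \<longleftrightarrow> commutes C f g h k \<and>
     (\<forall>h' k'. commutes C f g h' k' \<longrightarrow>
        (\<exists>!u. u \<in> hom C (Cod C h) (Cod C h') \<and> u \<cdot>\<^bsub>C\<^esub> h = h' \<and> u \<cdot>\<^bsub>C\<^esub> k = k'))"

definition is_pullback :: "('o, 'm, 'x) cat_scheme \<Rightarrow> 'm \<Rightarrow> 'm \<Rightarrow> 'm \<Rightarrow> 'm \<Rightarrow> bool" where
  "is_pullback C f g h k \<longleftrightarrow> commutes C f g h k \<and>
     (\<forall>f' g'. commutes C f' g' h k \<longrightarrow>
        (\<exists>!u. u \<in> hom C (Dom C f') (Dom C f) \<and> f \<cdot>\<^bsub>C\<^esub> u = f' \<and> g \<cdot>\<^bsub>C\<^esub> u = g'))"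

definition is_retract :: "('o, 'm, 'x) cat_scheme \<Rightarrow> 'm \<Rightarrow> 'm \<Rightarrow> bool" where
  "is_retract C f g \<longleftrightarrow>
     f \<in> Ar C \<and> g \<in> Ar C \<and>
     (\<exists>i \<in> hom C (Dom C f) (Dom C g). \<exists>r \<in> hom C (Dom C g) (Dom C f).
      \<exists>j \<in> hom C (Cod C f) (Cod C g). \<exists>s \<in> hom C (Cod C g) (Cod C f).
        r \<cdot>\<^bsub>C\<^esub> i = Id C (Dom C f) \<and> s \<cdot>\<^bsub>C\<^esub> j = Id C (Cod C f) \<and>
        g \<cdot>\<^bsub>C\<^esub> i = j \<cdot>\<^bsub>C\<^esub> f \<and> f \<cdot>\<^bsub>C\<^esub> r = s \<cdot>\<^bsub>C\<^esub> g)"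


section \<open>Closed model categories\<close>

record ('o, 'm) model_cat = "('o, 'm) cat" +
  We :: "'m set"
  Cof :: "'m set"
  Fib :: "'m set"

text \<open>Quillen's axioms CM1--CM5. Finite (co)completeness is stated as existence of an
  initial (terminal) object and of pushouts (pullbacks); factorizations need not be functorial.\<close>

locale closed_model_category = category M
  for M :: "('o, 'm, 'x) model_cat_scheme" (structure) +
  assumes We_arr: "We M \<subseteq> Ar M" and Cof_arr: "Cof M \<subseteq> Ar M" and Fib_arr: "Fib M \<subseteq> Ar M"
    and ex_initial: "\<exists>e. is_initial M e"
    and ex_terminal: "\<exists>e. is_terminal M e"
    and ex_pushout: "f \<in> hom M z a \<Longrightarrow> g \<in> hom M z b \<Longrightarrow> \<exists>h k. is_pushout M f g h k"
    and ex_pullback: "h \<in> hom M a d \<Longrightarrow> k \<in> hom M b d \<Longrightarrow> \<exists>f g. is_pullback M f g h k"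
    and We_comp: "f \<in> hom M a b \<Longrightarrow> g \<in> hom M b c \<Longrightarrow> f \<in> We M \<Longrightarrow> g \<in> We M \<Longrightarrow> g \<cdot> f \<in> We M"
    and We_left: "f \<in> hom M a b \<Longrightarrow> g \<in> hom M b c \<Longrightarrow> f \<in> We M \<Longrightarrow> g \<cdot> f \<in> We M \<Longrightarrow> g \<in> We M"
    and We_right: "f \<in> hom M a b \<Longrightarrow> g \<in> hom M b c \<Longrightarrow> g \<in> We M \<Longrightarrow> g \<cdot> f \<in> We M \<Longrightarrow> f \<in> We M"
    and We_retract: "is_retract M f g \<Longrightarrow> g \<in> We M \<Longrightarrow> f \<in> We M"
    and Cof_retract: "is_retract M f g \<Longrightarrow> g \<in> Cof M \<Longrightarrow> f \<in> Cof M"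
    and Fib_retract: "is_retract M f g \<Longrightarrow> g \<in> Fib M \<Longrightarrow> f \<in> Fib M"
    and lifting: "commutes M u i p v \<Longrightarrow> i \<in> Cof M \<Longrightarrow> p \<in> Fib M \<Longrightarrow> i \<in> We M \<or> p \<in> We M \<Longrightarrow>
        \<exists>l \<in> hom M (Cod M i) (Dom M p). l \<cdot> i = u \<and> p \<cdot> l = v"
    and factor_Cof_tFib: "f \<in> hom M a b \<Longrightarrow>
        \<exists>c. \<exists>i \<in> hom M a c. \<exists>p \<in> hom M c b. f = p \<cdot> i \<and> i \<in> Cof M \<and> p \<in> Fib M \<inter> We M"
    and factor_tCof_Fib: "f \<in> hom M a b \<Longrightarrow>
        \<exists>c. \<exists>i \<in> hom M a c. \<exists>p \<in> hom M c b. f = p \<cdot> i \<and> i \<in> Cof M \<inter> We M \<and> p \<in> Fib M"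

definition cofibrant :: "('o, 'm, 'x) model_cat_scheme \<Rightarrow> 'o \<Rightarrow> bool" where
  "cofibrant M x \<longleftrightarrow> x \<in> Ob M \<and> (\<forall>e f. is_initial M e \<longrightarrow> f \<in> hom M e x \<longrightarrow> f \<in> Cof M)"

definition fibrant :: "('o, 'm, 'x) model_cat_scheme \<Rightarrow> 'o \<Rightarrow> bool" where
  "fibrant M x \<longleftrightarrow> x \<in> Ob M \<and> (\<forall>e f. is_terminal M e \<longrightarrow> f \<in> hom M x e \<longrightarrow> f \<in> Fib M)"

definition cofibrant_fibrant :: "('o, 'm, 'x) model_cat_scheme \<Rightarrow> 'o \<Rightarrow> bool" where
  "cofibrant_fibrant M x \<longleftrightarrow> cofibrant M x \<and> fibrant M x"


section \<open>Homotopy\<close>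

record 'm cylinder =
  inc0 :: 'm
  inc1 :: 'm
  prj :: 'm

text \<open>A factorization of the fold map of \<open>z\<close> into a cofibration \<open>[inc0, inc1]\<close> and
  a weak equivalence \<open>prj\<close>.\<close>

definition is_cylinder :: "('o, 'm, 'x) model_cat_scheme \<Rightarrow> 'o \<Rightarrow> 'm cylinder \<Rightarrow> bool" where
  "is_cylinder M z I \<longleftrightarrow>
     (\<exists>i. inc0 I \<in> hom M z i \<and> inc1 I \<in> hom M z i \<and> prj I \<in> hom M i z \<and>
        prj I \<cdot>\<^bsub>M\<^esub> inc0 I = Id M z \<and> prj I \<cdot>\<^bsub>M\<^esub> inc1 I = Id M z \<and> prj I \<in> We M \<and>
        (\<forall>p q m. is_coproduct M z z p q \<longrightarrow> m \<in> hom M (Cod M p) i \<longrightarrow>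
           m \<cdot>\<^bsub>M\<^esub> p = inc0 I \<longrightarrow> m \<cdot>\<^bsub>M\<^esub> q = inc1 I \<longrightarrow> m \<in> Cof M))"

text \<open>\<open>H\<close> is a left homotopy from \<open>f\<close> to \<open>g\<close> on the cylinder \<open>I\<close>. All maps considered below
  have cofibrant source and fibrant target, so that left homotopy is the usual
  homotopy relation.\<close>

definition is_homotopy ::
    "('o, 'm, 'x) model_cat_scheme \<Rightarrow> 'm cylinder \<Rightarrow> 'm \<Rightarrow> 'm \<Rightarrow> 'm \<Rightarrow> bool" where
  "is_homotopy M I f g H \<longleftrightarrow>
     (\<exists>z x. f \<in> hom M z x \<and> g \<in> hom M z x \<and> is_cylinder M z I \<and> H \<in> hom M (Cod M (inc0 I)) x)
     \<and> H \<cdot>\<^bsub>M\<^esub> inc0 I = f \<and> H \<cdot>\<^bsub>M\<^esub> inc1 I = g"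

definition homotopic :: "('o, 'm, 'x) model_cat_scheme \<Rightarrow> 'm \<Rightarrow> 'm \<Rightarrow> bool" where
  "homotopic M f g \<longleftrightarrow> (\<exists>I H. is_homotopy M I f g H)"

definition has_homotopy_inverse :: "('o, 'm, 'x) model_cat_scheme \<Rightarrow> 'm \<Rightarrow> bool" where
  "has_homotopy_inverse M f \<longleftrightarrow>
     (\<exists>r \<in> hom M (Cod M f) (Dom M f).
        homotopic M (r \<cdot>\<^bsub>M\<^esub> f) (Id M (Dom M f)) \<and> homotopic M (f \<cdot>\<^bsub>M\<^esub> r) (Id M (Cod M f)))"


section \<open>Homotopy commutative squares\<close>

text \<open>A square with sides \<open>out1: z \<rightarrow> a\<close>, \<open>out2: z \<rightarrow> b\<close>, \<open>in1: a \<rightarrow> d\<close>, \<open>in2: b \<rightarrow> d\<close>, together with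
  a homotopy \<open>htpy\<close> from \<open>in1 \<cdot> out1\<close> to \<open>in2 \<cdot> out2\<close> on the cylinder \<open>cyl\<close> of \<open>z\<close>.\<close>

record 'm hsquare =
  out1 :: 'm
  out2 :: 'm
  in1 :: 'm
  in2 :: 'm
  cyl :: "'m cylinder"
  htpy :: 'm

definition homotopy_commutative_square ::
    "('o, 'm, 'x) model_cat_scheme \<Rightarrow> 'm hsquare \<Rightarrow> bool" where
  "homotopy_commutative_square M S \<longleftrightarrow>
     (\<exists>z a b d. cofibrant_fibrant M z \<and> cofibrant_fibrant M a \<and>
        cofibrant_fibrant M b \<and> cofibrant_fibrant M d \<and>
        out1 S \<in> hom M z a \<and> out2 S \<in> hom M z b \<and> in1 S \<in> hom M a d \<and> in2 S \<in> hom M b d) \<and>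
     is_homotopy M (cyl S) (in1 S \<cdot>\<^bsub>M\<^esub> out1 S) (in2 S \<cdot>\<^bsub>M\<^esub> out2 S) (htpy S)"

text \<open>Cocones \<open>(a, c, b)\<close> under \<open>x \<leftarrow> z \<rightarrow> i \<leftarrow> z \<rightarrow> y\<close>, where the outer maps are \<open>f\<close>, \<open>g\<close> and the
  inner ones are the ends of the cylinder \<open>I\<close> of \<open>z\<close>. The universal one is the double mapping
  cylinder of \<open>f\<close> and \<open>g\<close>; a cocone with tip \<open>d\<close> is a square on \<open>f\<close>, \<open>g\<close> commuting up to \<open>c\<close>.\<close>

definition dmc_cocone ::
    "('o, 'm, 'x) model_cat_scheme \<Rightarrow> 'm \<Rightarrow> 'm \<Rightarrow> 'm cylinder \<Rightarrow> 'm \<Rightarrow> 'm \<Rightarrow> 'm \<Rightarrow> bool" where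
  "dmc_cocone M f g I a c b \<longleftrightarrow>
     (\<exists>z x y i t. f \<in> hom M z x \<and> g \<in> hom M z y \<and> inc0 I \<in> hom M z i \<and> inc1 I \<in> hom M z i \<and>
        a \<in> hom M x t \<and> c \<in> hom M i t \<and> b \<in> hom M y t) \<and>
     a \<cdot>\<^bsub>M\<^esub> f = c \<cdot>\<^bsub>M\<^esub> inc0 I \<and> b \<cdot>\<^bsub>M\<^esub> g = c \<cdot>\<^bsub>M\<^esub> inc1 I"

definition is_double_mapping_cylinder ::
    "('o, 'm, 'x) model_cat_scheme \<Rightarrow> 'm \<Rightarrow> 'm \<Rightarrow> 'm cylinder \<Rightarrow> 'm \<Rightarrow> 'm \<Rightarrow> 'm \<Rightarrow> bool" where
  "is_double_mapping_cylinder M f g I a c b \<longleftrightarrow> dmc_cocone M f g I a c b \<and>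
     (\<forall>a' c' b'. dmc_cocone M f g I a' c' b' \<longrightarrow>
        (\<exists>!u. u \<in> hom M (Cod M a) (Cod M a') \<and>
           u \<cdot>\<^bsub>M\<^esub> a = a' \<and> u \<cdot>\<^bsub>M\<^esub> c = c' \<and> u \<cdot>\<^bsub>M\<^esub> b = b'))"

text \<open>\<open>w\<close> is the map induced by \<open>S\<close> on the double mapping cylinder \<open>(a, c, b)\<close>.\<close>

definition induced_on_dmc ::
    "('o, 'm, 'x) model_cat_scheme \<Rightarrow> 'm \<Rightarrow> 'm \<Rightarrow> 'm \<Rightarrow> 'm hsquare \<Rightarrow> 'm \<Rightarrow> bool" where
  "induced_on_dmc M a c b S w \<longleftrightarrow>
     w \<in> hom M (Cod M a) (Cod M (in1 S)) \<and>
     w \<cdot>\<^bsub>M\<^esub> a = in1 S \<and> w \<cdot>\<^bsub>M\<^esub> c = htpy S \<and> w \<cdot>\<^bsub>M\<^esub> b = in2 S"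

definition is_homotopy_pushout ::
    "('o, 'm, 'x) model_cat_scheme \<Rightarrow> 'm hsquare \<Rightarrow> bool" where
  "is_homotopy_pushout M S \<longleftrightarrow> homotopy_commutative_square M S \<and>
     (\<exists>a c b w. is_double_mapping_cylinder M (out1 S) (out2 S) (cyl S) a c b \<and>
        induced_on_dmc M a c b S w \<and> w \<in> We M)"

text \<open>The standard homotopy pullback of \<open>in1\<close> and \<open>in2\<close> is the strict pullback of \<open>p\<close> and \<open>in2\<close>,
  where \<open>in1 = p \<cdot> i\<close> with \<open>i\<close> a weak equivalence and \<open>p\<close> a fibration. The square maps to it once
  it is made strictly commutative, by lifting the homotopy through \<open>p\<close> to a homotopy \<open>L\<close> that
  starts at \<open>i \<cdot> out1\<close> and replacing \<open>i \<cdot> out1\<close> by the other end of \<open>L\<close>.\<close>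

definition is_homotopy_pullback ::
    "('o, 'm, 'x) model_cat_scheme \<Rightarrow> 'm hsquare \<Rightarrow> bool" where
  "is_homotopy_pullback M S \<longleftrightarrow> homotopy_commutative_square M S \<and>
     (\<exists>e. \<exists>i \<in> hom M (Dom M (in1 S)) e. \<exists>p \<in> hom M e (Cod M (in1 S)).
      \<exists>L \<in> hom M (Cod M (inc0 (cyl S))) e. \<exists>x y w.
        in1 S = p \<cdot>\<^bsub>M\<^esub> i \<and> i \<in> We M \<and> p \<in> Fib M \<and>
        L \<cdot>\<^bsub>M\<^esub> inc0 (cyl S) = i \<cdot>\<^bsub>M\<^esub> out1 S \<and> p \<cdot>\<^bsub>M\<^esub> L = htpy S \<and>
        is_pullback M x y p (in2 S) \<and>
        w \<in> hom M (Dom M (out1 S)) (Dom M x) \<and>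
        x \<cdot>\<^bsub>M\<^esub> w = L \<cdot>\<^bsub>M\<^esub> inc1 (cyl S) \<and> y \<cdot>\<^bsub>M\<^esub> w = out2 S \<and> w \<in> We M)"

text \<open>The map \<open>e\<close> induced out of the homotopy pushout \<open>T\<close> by a homotopy commutative square \<open>S\<close> with
  the same source maps: up to homotopy it is the map induced by \<open>S\<close> on the double mapping
  cylinder composed with the inverse of the comparison \<open>w\<close> of \<open>T\<close>.\<close>

definition is_whisker_map ::
    "('o, 'm, 'x) model_cat_scheme \<Rightarrow> 'm hsquare \<Rightarrow> 'm hsquare \<Rightarrow> 'm \<Rightarrow> bool" where
  "is_whisker_map M T S e \<longleftrightarrow>
     out1 S = out1 T \<and> out2 S = out2 T \<and> cyl S = cyl T \<and>
     e \<in> hom M (Cod M (in1 T)) (Cod M (in1 S)) \<and>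
     (\<exists>a c b w x. is_double_mapping_cylinder M (out1 T) (out2 T) (cyl T) a c b \<and>
        induced_on_dmc M a c b T w \<and> induced_on_dmc M a c b S x \<and> homotopic M (e \<cdot>\<^bsub>M\<^esub> w) x)"

text \<open>\<open>h\<close>, \<open>k\<close> exhibit their common target as a homotopy pushout of \<open>f\<close> and \<open>g\<close>.\<close>

definition homotopy_pushout ::
    "('o, 'm, 'x) model_cat_scheme \<Rightarrow> 'm \<Rightarrow> 'm \<Rightarrow> 'm \<Rightarrow> 'm \<Rightarrow> bool" where
  "homotopy_pushout M f g h k \<longleftrightarrow>
     (\<exists>S. out1 S = f \<and> out2 S = g \<and> in1 S = h \<and> in2 S = k \<and> is_homotopy_pushout M S)"


section \<open>Homotopy commutative cubes and the Cube axiom\<close>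

text \<open>A map of cylinders over \<open>u\<close>; it serves to restrict homotopies along \<open>u\<close>.\<close>

definition is_cylinder_map ::
    "('o, 'm, 'x) model_cat_scheme \<Rightarrow> 'm cylinder \<Rightarrow> 'm cylinder \<Rightarrow> 'm \<Rightarrow> 'm \<Rightarrow> bool" where
  "is_cylinder_map M J I u c \<longleftrightarrow>
     is_cylinder M (Dom M u) J \<and> is_cylinder M (Cod M u) I \<and>
     c \<in> hom M (Cod M (inc0 J)) (Cod M (inc0 I)) \<and>
     c \<cdot>\<^bsub>M\<^esub> inc0 J = inc0 I \<cdot>\<^bsub>M\<^esub> u \<and> c \<cdot>\<^bsub>M\<^esub> inc1 J = inc1 I \<cdot>\<^bsub>M\<^esub> u \<and>
     prj I \<cdot>\<^bsub>M\<^esub> c = u \<cdot>\<^bsub>M\<^esub> prj J"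

definition over_disc ::
    "('o, 'm, 'x) model_cat_scheme \<Rightarrow> 'm \<Rightarrow> 'm cylinder \<Rightarrow> 'm \<Rightarrow> bool" where
  "over_disc M t I e \<longleftrightarrow> e \<in> hom M (Cod M (inc0 I)) (Dom M t) \<and> t \<cdot>\<^bsub>M\<^esub> e = prj I"

text \<open>Six faces, the vertical ones \<open>V1\<close>, \<open>V2\<close> starting at the initial vertex \<open>z'\<close> of \<open>upper\<close>, and
  \<open>V3\<close>, \<open>V4\<close> ending at the final vertex \<open>d\<close> of \<open>lower\<close>:

    \<^item> upper face: \<open>f': z' \<rightarrow> a'\<close>, \<open>g': z' \<rightarrow> b'\<close>, \<open>h': a' \<rightarrow> d'\<close>, \<open>k': b' \<rightarrow> d'\<close>
    \<^item> lower face: \<open>f: z \<rightarrow> a\<close>, \<open>g: z \<rightarrow> b\<close>, \<open>h: a \<rightarrow> d\<close>, \<open>k: b \<rightarrow> d\<close>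
    \<^item> vertical edges: \<open>vz: z' \<rightarrow> z\<close>, \<open>va: a' \<rightarrow> a\<close>, \<open>vb: b' \<rightarrow> b\<close>, \<open>vd: d' \<rightarrow> d\<close>

  The faces provide six homotopies between the six composites \<open>z' \<rightarrow> d\<close>, arranged in a hexagon
  (the homotopies of \<open>V3\<close>, \<open>V4\<close>, \<open>lower\<close> are first restricted along \<open>f'\<close>, \<open>g'\<close>, \<open>vz\<close>).
  They are mutually compatible if the hexagon can be filled: \<open>t\<close> is a weak equivalence onto \<open>z'\<close>,
  its source contains the six cylinders glued along a hexagon over \<open>z'\<close>, and \<open>F\<close> extends the six
  homotopies to that source.\<close>

definition homotopy_commutative_cube ::
    "('o, 'm, 'x) model_cat_scheme \<Rightarrow> 'm hsquare \<Rightarrow> 'm hsquare \<Rightarrow>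
     'm hsquare \<Rightarrow> 'm hsquare \<Rightarrow> 'm hsquare \<Rightarrow> 'm hsquare \<Rightarrow> bool" where
  "homotopy_commutative_cube M upper lower V1 V2 V3 V4 \<longleftrightarrow>
     (\<forall>S \<in> {upper, lower, V1, V2, V3, V4}. homotopy_commutative_square M S) \<and>
     (\<exists>vz va vb vd.
        out1 V1 = out1 upper \<and> out2 V1 = vz \<and> in1 V1 = va \<and> in2 V1 = out1 lower \<and>
        out1 V2 = out2 upper \<and> out2 V2 = vz \<and> in1 V2 = vb \<and> in2 V2 = out2 lower \<and>
        out1 V3 = in1 upper \<and> out2 V3 = va \<and> in1 V3 = vd \<and> in2 V3 = in1 lower \<and>
        out1 V4 = in2 upper \<and> out2 V4 = vb \<and> in1 V4 = vd \<and> in2 V4 = in2 lower \<and>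
        (\<exists>J3 J4 J0 c3 c4 c0 t e0 e1 e2 e3 e4 e' F.
           is_cylinder_map M J3 (cyl V3) (out1 upper) c3 \<and>
           is_cylinder_map M J4 (cyl V4) (out2 upper) c4 \<and>
           is_cylinder_map M J0 (cyl lower) vz c0 \<and>
           t \<in> We M \<and> Cod M t = Dom M vz \<and>
           over_disc M t (cyl upper) e' \<and> over_disc M t J0 e0 \<and>
           over_disc M t (cyl V1) e1 \<and> over_disc M t (cyl V2) e2 \<and>
           over_disc M t J3 e3 \<and> over_disc M t J4 e4 \<and>
           e' \<cdot>\<^bsub>M\<^esub> inc0 (cyl upper) = e3 \<cdot>\<^bsub>M\<^esub> inc0 J3 \<and>
           e3 \<cdot>\<^bsub>M\<^esub> inc1 J3 = e1 \<cdot>\<^bsub>M\<^esub> inc0 (cyl V1) \<and>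
           e1 \<cdot>\<^bsub>M\<^esub> inc1 (cyl V1) = e0 \<cdot>\<^bsub>M\<^esub> inc0 J0 \<and>
           e0 \<cdot>\<^bsub>M\<^esub> inc1 J0 = e2 \<cdot>\<^bsub>M\<^esub> inc1 (cyl V2) \<and>
           e2 \<cdot>\<^bsub>M\<^esub> inc0 (cyl V2) = e4 \<cdot>\<^bsub>M\<^esub> inc1 J4 \<and>
           e4 \<cdot>\<^bsub>M\<^esub> inc0 J4 = e' \<cdot>\<^bsub>M\<^esub> inc1 (cyl upper) \<and>
           F \<in> hom M (Dom M t) (Cod M vd) \<and>
           F \<cdot>\<^bsub>M\<^esub> e' = vd \<cdot>\<^bsub>M\<^esub> htpy upper \<and>
           F \<cdot>\<^bsub>M\<^esub> e3 = htpy V3 \<cdot>\<^bsub>M\<^esub> c3 \<and>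
           F \<cdot>\<^bsub>M\<^esub> e1 = in1 lower \<cdot>\<^bsub>M\<^esub> htpy V1 \<and>
           F \<cdot>\<^bsub>M\<^esub> e0 = htpy lower \<cdot>\<^bsub>M\<^esub> c0 \<and>
           F \<cdot>\<^bsub>M\<^esub> e2 = in2 lower \<cdot>\<^bsub>M\<^esub> htpy V2 \<and>
           F \<cdot>\<^bsub>M\<^esub> e4 = htpy V4 \<cdot>\<^bsub>M\<^esub> c4))"

definition cube_axiom :: "('o, 'm, 'x) model_cat_scheme \<Rightarrow> bool" where
  "cube_axiom M \<longleftrightarrow>
     (\<forall>upper lower V1 V2 V3 V4.
        homotopy_commutative_cube M upper lower V1 V2 V3 V4 \<longrightarrow>
        is_homotopy_pushout M lower \<longrightarrow>
        (\<forall>V \<in> {V1, V2, V3, V4}. is_homotopy_pullback M V) \<longrightarrow>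
        is_homotopy_pushout M upper)"


section \<open>Sectional and relative category\<close>

text \<open>\<open>ganea M \<iota> n g \<alpha>\<close> holds if \<open>g: G\<^sub>n \<rightarrow> X\<close> and \<open>\<alpha>: A \<rightarrow> G\<^sub>n\<close> are the maps of the \<open>n\<close>-th stage of a Ganea
  construction of \<open>\<iota>: A \<rightarrow> X\<close>. It is a relation because homotopy pullbacks and pushouts are only
  determined up to homotopy equivalence. The homotopy of the pullback square is the one used to
  form the whisker map.\<close>

inductive ganea :: "('o, 'm, 'x) model_cat_scheme \<Rightarrow> 'm \<Rightarrow> nat \<Rightarrow> 'm \<Rightarrow> 'm \<Rightarrow> bool"
  for M :: "('o, 'm, 'x) model_cat_scheme" and \<iota> :: 'm where
  ganea_0: "ganea M \<iota> 0 \<iota> (Id M (Dom M \<iota>))"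
| ganea_Suc: "ganea M \<iota> n g \<alpha> \<Longrightarrow>
    is_homotopy_pullback M S \<Longrightarrow> in1 S = \<iota> \<Longrightarrow> in2 S = g \<Longrightarrow>
    is_homotopy_pushout M T \<Longrightarrow> is_whisker_map M T S g' \<Longrightarrow>
    ganea M \<iota> (Suc n) g' (in1 T)"

definition secat :: "('o, 'm, 'x) model_cat_scheme \<Rightarrow> 'm \<Rightarrow> enat" where
  "secat M \<iota> = Inf {enat n | n. \<exists>g \<alpha>. ganea M \<iota> n g \<alpha> \<and>
     (\<exists>\<sigma> \<in> hom M (Cod M g) (Dom M g). homotopic M (g \<cdot>\<^bsub>M\<^esub> \<sigma>) (Id M (Cod M g)))}"

definition relcat :: "('o, 'm, 'x) model_cat_scheme \<Rightarrow> 'm \<Rightarrow> enat" where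
  "relcat M \<iota> = Inf {enat n | n. \<exists>g \<alpha>. ganea M \<iota> n g \<alpha> \<and>
     (\<exists>\<sigma> \<in> hom M (Cod M g) (Dom M g). homotopic M (g \<cdot>\<^bsub>M\<^esub> \<sigma>) (Id M (Cod M g)) \<and>
        homotopic M (\<sigma> \<cdot>\<^bsub>M\<^esub> \<iota>) \<alpha>)}"


section \<open>Strong pushout category and strong relative category\<close>

definition Pushcat :: "('o, 'm, 'x) model_cat_scheme \<Rightarrow> 'm \<Rightarrow> enat" where
  "Pushcat M \<iota> = Inf {enat n | n. \<exists>(X :: nat \<Rightarrow> 'o) (j :: nat \<Rightarrow> 'm).
     X n = Cod M \<iota> \<and>
     (\<forall>i \<le> n. cofibrant_fibrant M (X i) \<and> j i \<in> hom M (Dom M \<iota>) (X i)) \<and>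
     has_homotopy_inverse M (j 0) \<and>
     (\<forall>i < n. \<exists>z. \<exists>\<rho> \<in> hom M z (Dom M \<iota>). \<exists>\<tau> \<in> hom M z (X i). \<exists>\<chi> \<in> hom M (X i) (X (Suc i)).
        homotopy_pushout M \<rho> \<tau> (j (Suc i)) \<chi> \<and>
        homotopic M (\<chi> \<cdot>\<^bsub>M\<^esub> j i) (j (Suc i))) \<and>
     homotopic M (j n) \<iota>}"

definition Relcat :: "('o, 'm, 'x) model_cat_scheme \<Rightarrow> 'm \<Rightarrow> enat" where
  "Relcat M \<iota> = Inf {enat n | n. \<exists>(X :: nat \<Rightarrow> 'o) (j :: nat \<Rightarrow> 'm).
     X n = Cod M \<iota> \<and>
     (\<forall>i \<le> n. cofibrant_fibrant M (X i) \<and> j i \<in> hom M (Dom M \<iota>) (X i)) \<and>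
     has_homotopy_inverse M (j 0) \<and>
     (\<forall>i < n. \<exists>z. \<exists>\<rho> \<in> hom M z (Dom M \<iota>). \<exists>\<tau> \<in> hom M z (X i). \<exists>\<chi> \<in> hom M (X i) (X (Suc i)).
        homotopy_pushout M \<rho> \<tau> (j (Suc i)) \<chi> \<and>
        homotopic M (\<chi> \<cdot>\<^bsub>M\<^esub> j i) (j (Suc i)) \<and>
        (\<exists>\<sigma> \<in> hom M (Dom M \<iota>) z.
           homotopic M (\<rho> \<cdot>\<^bsub>M\<^esub> \<sigma>) (Id M (Dom M \<iota>)) \<and> homotopic M (\<tau> \<cdot>\<^bsub>M\<^esub> \<sigma>) (j i))) \<and>
     homotopic M (j n) \<iota>}"


section \<open>Domination\<close>

definition simply_dominated :: "('o, 'm, 'x) model_cat_scheme \<Rightarrow> 'm \<Rightarrow> 'm \<Rightarrow> bool" where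
  "simply_dominated M \<iota>Y \<iota>X \<longleftrightarrow>
     (\<exists>\<phi> \<in> hom M (Cod M \<iota>X) (Cod M \<iota>Y). \<exists>\<sigma> \<in> hom M (Cod M \<iota>Y) (Cod M \<iota>X).
        homotopic M (\<phi> \<cdot>\<^bsub>M\<^esub> \<iota>X) \<iota>Y \<and> homotopic M (\<phi> \<cdot>\<^bsub>M\<^esub> \<sigma>) (Id M (Cod M \<iota>Y)))"

definition relatively_dominated :: "('o, 'm, 'x) model_cat_scheme \<Rightarrow> 'm \<Rightarrow> 'm \<Rightarrow> bool" where
  "relatively_dominated M \<iota>Y \<iota>X \<longleftrightarrow>
     (\<exists>\<phi> \<in> hom M (Cod M \<iota>X) (Cod M \<iota>Y). \<exists>\<sigma> \<in> hom M (Cod M \<iota>Y) (Cod M \<iota>X).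
        homotopic M (\<phi> \<cdot>\<^bsub>M\<^esub> \<iota>X) \<iota>Y \<and> homotopic M (\<phi> \<cdot>\<^bsub>M\<^esub> \<sigma>) (Id M (Cod M \<iota>Y)) \<and>
        homotopic M (\<sigma> \<cdot>\<^bsub>M\<^esub> \<iota>Y) \<iota>X)"

end

theory Submission
  imports Defs
begin

text \<open>
  A homotopy section of the \<open>n\<close>-th Ganea map \<open>g: G \<rightarrow> Y\<close> exhibits \<open>\<iota>: A \<rightarrow> Y\<close> as dominated by the map
  \<open>\<alpha>: A \<rightarrow> G\<close>, and the stages of the Ganea construction themselves form a chain of homotopy
  pushouts for \<open>\<alpha>\<close>. This chain is even one for \<open>Relcat\<close>: by induction \<open>g \<cdot> \<alpha>\<close> is homotopic to \<open>\<iota>\<close>, so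
  the identity of \<open>A\<close> and \<open>\<alpha>\<close> induce a map \<open>A \<rightarrow> F\<close> into the next homotopy pullback, which is the
  section that \<open>Relcat\<close> asks for (\<open>ganea_strong_chain\<close>). Since \<open>Pushcat \<le> Relcat\<close>, what remains is
  to go from \<open>Pushcat\<close> back to the Ganea construction.

  Let \<open>A \<rightarrow> X\<^sub>0, \<dots>, A \<rightarrow> X\<^sub>n = X\<close> be a chain for \<open>Pushcat\<close> and \<open>\<phi>: X \<rightarrow> Y\<close> a map under \<open>A\<close> up to
  homotopy. By induction along the chain one finds a Ganea construction of \<open>\<iota>\<close> and maps
  \<open>\<theta>\<^sub>i: X\<^sub>i \<rightarrow> G\<^sub>i\<close> under \<open>A\<close> and over \<open>Y\<close>, up to homotopy (\<open>pushcat_chain_maps_to_ganea\<close>). If \<open>\<sigma>\<close> is a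
  homotopy section of \<open>\<phi>\<close>, then \<open>\<theta>\<^sub>n \<cdot> \<sigma>\<close> is one of \<open>g\<^sub>n\<close>; if \<open>\<sigma>\<close> is moreover a map under \<open>A\<close>, so is \<open>\<theta>\<^sub>n \<cdot> \<sigma>\<close>.

  The inductive step needs a map on a homotopy pushout \<open>X\<^sub>i\<^sub>+\<^sub>1\<close> of \<open>A \<leftarrow> Z \<rightarrow> X\<^sub>i\<close>, and homotopies would
  have to be matched coherently over \<open>Y\<close>. This is avoided by choosing the next stage well: \<open>g\<^sub>i\<^sub>+\<^sub>1\<close>
  can be taken to be a fibration such that every homotopy in \<open>Y\<close> between \<open>Z \<rightarrow> A \<rightarrow> Y\<close> and
  \<open>Z \<rightarrow> G\<^sub>i \<rightarrow> Y\<close> lifts strictly to \<open>G\<^sub>i\<^sub>+\<^sub>1\<close> (\<open>ex_fibrant_ganea_stage\<close>). Then \<open>\<phi>\<close> is deformed on the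
  double mapping cylinder of \<open>A \<leftarrow> Z \<rightarrow> X\<^sub>i\<close> until it agrees with \<open>\<iota>\<close> on \<open>A\<close> and with \<open>g\<^sub>i \<cdot> \<theta>\<^sub>i\<close> on \<open>X\<^sub>i\<close>,
  the remaining homotopy on the cylinder of \<open>Z\<close> is lifted, and the resulting map is carried over
  to \<open>X\<^sub>i\<^sub>+\<^sub>1\<close> along the weak equivalence from the double mapping cylinder
  (\<open>extend_over_homotopy_pushout\<close>).

  All manipulations of homotopies rest on one device. A map \<open>F: w \<rightarrow> G\<close> on an object \<open>w\<close> that is weakly
  equivalent to \<open>b\<close>, lying over a map \<open>b \<rightarrow> Y\<close> along a fibration \<open>G \<rightarrow> Y\<close>, can be pulled back to any
  cylinder that maps to \<open>b\<close>, with prescribed ends in \<open>w\<close> (\<open>fill_over\<close>). Gluing cylinders along their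
  ends produces such objects \<open>w\<close> (\<open>glue\<close>), so that concatenation, inversion and comparison of
  homotopies, and their versions over \<open>Y\<close>, are all instances of filling.
\<close>

lemma Inf_enat_le_iff: "Inf {enat k | k. P k} \<le> enat n \<longleftrightarrow> (\<exists>m\<le>n. P m)"
proof
  assume le: "Inf {enat k | k. P k} \<le> enat n"
  then have "{enat k | k. P k} \<noteq> {}" by (metis Inf_enat_def enat_ord_simps(5) infinity_ileE)
  then have "Inf {enat k | k. P k} \<in> {enat k | k. P k}"
    unfolding Inf_enat_def by (metis (mono_tags, lifting) LeastI_ex ex_in_conv)
  then show "\<exists>m\<le>n. P m" using le by auto
next
  assume "\<exists>m\<le>n. P m"
  then show "Inf {enat k | k. P k} \<le> enat n" by (auto intro!: Inf_lower2)
qed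

section \<open>Composition and universal properties\<close>

context category
begin

lemma Ar_comp [simp]: "f \<in> Ar C \<Longrightarrow> g \<in> Ar C \<Longrightarrow> Cod C f = Dom C g \<Longrightarrow> g \<cdot> f \<in> Ar C"
  and Dom_comp [simp]: "f \<in> Ar C \<Longrightarrow> g \<in> Ar C \<Longrightarrow> Cod C f = Dom C g \<Longrightarrow> Dom C (g \<cdot> f) = Dom C f"
  and Cod_comp [simp]: "f \<in> Ar C \<Longrightarrow> g \<in> Ar C \<Longrightarrow> Cod C f = Dom C g \<Longrightarrow> Cod C (g \<cdot> f) = Cod C g"
  using comp_in_hom[of f "Dom C f" "Cod C f" g "Cod C g"] by (auto simp: hom_def)

lemma comp_assoc_Ar [simp]:
  "f \<in> Ar C \<Longrightarrow> g \<in> Ar C \<Longrightarrow> h \<in> Ar C \<Longrightarrow> Cod C f = Dom C g \<Longrightarrow> Cod C g = Dom C h \<Longrightarrow>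
    (h \<cdot> g) \<cdot> f = h \<cdot> (g \<cdot> f)"
  using comp_assoc[of f "Dom C f" "Cod C f" g "Cod C g" h "Cod C h"] by (auto simp: hom_def)

lemma Id_simps [simp]:
  "a \<in> Ob C \<Longrightarrow> Id C a \<in> Ar C" "a \<in> Ob C \<Longrightarrow> Dom C (Id C a) = a" "a \<in> Ob C \<Longrightarrow> Cod C (Id C a) = a"
  using id_in_hom[of a] by (auto simp: hom_def)

lemma comp_Id_Ar [simp]:
  "f \<in> Ar C \<Longrightarrow> Cod C f = a \<Longrightarrow> Id C a \<cdot> f = f" "f \<in> Ar C \<Longrightarrow> Dom C f = a \<Longrightarrow> f \<cdot> Id C a = f"
  using comp_id_left[of f "Dom C f" "Cod C f"] comp_id_right[of f "Dom C f" "Cod C f"]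
  by (auto simp: hom_def)

lemma Dom_Cod_Ob [simp]: "f \<in> Ar C \<Longrightarrow> Dom C f \<in> Ob C" "f \<in> Ar C \<Longrightarrow> Cod C f \<in> Ob C"
  using dom_in_Ob cod_in_Ob by auto

lemma hom_Ob: assumes "f \<in> hom C a b" shows "a \<in> Ob C" "b \<in> Ob C"
  using assms dom_in_Ob cod_in_Ob by (auto simp: hom_def)

lemma hom_simps:
  assumes "f \<in> hom C a b" shows "f \<in> Ar C" "Dom C f = a" "Cod C f = b"
  using assms by (auto simp: hom_def)

text \<open>Together with right-nested normal forms, this lets an equation between composites act as a
  rewrite rule inside longer composites.\<close>

lemma comp_cong_left:
  assumes "g \<cdot> f = k \<cdot> h" "f \<in> hom C a b" "g \<in> hom C b c" "h \<in> hom C a b'" "k \<in> hom C b' c"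
    "t \<in> hom C s a"
  shows "g \<cdot> (f \<cdot> t) = k \<cdot> (h \<cdot> t)"
proof -
  have "(g \<cdot> f) \<cdot> t = (k \<cdot> h) \<cdot> t" using assms(1) by simp
  then show ?thesis using assms(2-) by (simp add: hom_def)
qed

lemma comp_reduce:
  assumes "g \<cdot> f = h" "f \<in> hom C a b" "g \<in> hom C b c" "t \<in> hom C s a"
  shows "g \<cdot> (f \<cdot> t) = h \<cdot> t"
  using assms by (auto simp: hom_def)

lemma commutesI:
  "f \<in> hom C z a \<Longrightarrow> g \<in> hom C z b \<Longrightarrow> h \<in> hom C a d \<Longrightarrow> k \<in> hom C b d \<Longrightarrow> h \<cdot> f = k \<cdot> g \<Longrightarrow>
    commutes C f g h k"
  by (auto simp: commutes_def)

lemma pushout_hom: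
  assumes "is_pushout C f g h k"
  obtains z a b d where "f \<in> hom C z a" "g \<in> hom C z b" "h \<in> hom C a d" "k \<in> hom C b d" "h \<cdot> f = k \<cdot> g"
  using assms by (auto simp: is_pushout_def commutes_def)

lemma pushout_universal:
  assumes po: "is_pushout C f g h k" and "f \<in> hom C z a" "g \<in> hom C z b" "h \<in> hom C a d"
    and "u \<in> hom C a t" "v \<in> hom C b t" "u \<cdot> f = v \<cdot> g"
  obtains m where "m \<in> hom C d t" "m \<cdot> h = u" "m \<cdot> k = v"
proof -
  have "commutes C f g u v" using assms by (auto simp: commutes_def)
  then have "\<exists>m. m \<in> hom C (Cod C h) (Cod C u) \<and> m \<cdot> h = u \<and> m \<cdot> k = v"
    using po unfolding is_pushout_def by blast
  then show thesis using that assms(4,5) by (auto simp: hom_def)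
qed

lemma pushout_joint_epi:
  assumes po: "is_pushout C f g h k" and h: "h \<in> hom C a d"
    and m: "m \<in> hom C d t" "m' \<in> hom C d t" and eq: "m \<cdot> h = m' \<cdot> h" "m \<cdot> k = m' \<cdot> k"
  shows "m = m'"
proof -
  obtain z b where H: "f \<in> hom C z a" "g \<in> hom C z b" "k \<in> hom C b d" "h \<cdot> f = k \<cdot> g"
    using po h by (auto simp: is_pushout_def commutes_def hom_def)
  have "commutes C f g (m \<cdot> h) (m \<cdot> k)"
    by (rule commutesI[OF H(1,2) comp_in_hom[OF h m(1)] comp_in_hom[OF H(3) m(1)]])
      (use H h m in \<open>simp add: hom_def\<close>)
  then have "\<exists>!u. u \<in> hom C (Cod C h) (Cod C (m \<cdot> h)) \<and> u \<cdot> h = m \<cdot> h \<and> u \<cdot> k = m \<cdot> k"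
    using po unfolding is_pushout_def by blast
  moreover have "Cod C h = d" "Cod C (m \<cdot> h) = t" using h m by (auto simp: hom_def)
  ultimately show ?thesis using m eq by metis
qed

lemma pullback_universal:
  assumes pb: "is_pullback C x y p g" and "x \<in> hom C P e" "p \<in> hom C e d" "g \<in> hom C b d"
    and "u \<in> hom C t e" "v \<in> hom C t b" "p \<cdot> u = g \<cdot> v"
  obtains m where "m \<in> hom C t P" "x \<cdot> m = u" "y \<cdot> m = v"
proof -
  have "commutes C u v p g" using assms by (auto simp: commutes_def)
  then have "\<exists>m. m \<in> hom C (Dom C u) (Dom C x) \<and> x \<cdot> m = u \<and> y \<cdot> m = v"
    using pb unfolding is_pullback_def by blast
  then show thesis using that assms(2,5) by (auto simp: hom_def)
qed

lemma pullback_hom: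
  assumes "is_pullback C x y p g" "p \<in> hom C e d" "g \<in> hom C b d"
  obtains P where "x \<in> hom C P e" "y \<in> hom C P b" "p \<cdot> x = g \<cdot> y"
  using assms by (auto simp: is_pullback_def commutes_def hom_def)

lemma coproduct_hom:
  assumes "is_coproduct C x y p q"
  obtains c where "p \<in> hom C x c" "q \<in> hom C y c"
  using assms by (auto simp: is_coproduct_def)

lemma coproduct_universal:
  assumes "is_coproduct C x y p q" "p \<in> hom C x c" "u \<in> hom C x t" "v \<in> hom C y t"
  obtains m where "m \<in> hom C c t" "m \<cdot> p = u" "m \<cdot> q = v"
proof -
  obtain c' where "p \<in> hom C x c'" and
    "\<And>t u v. u \<in> hom C x t \<Longrightarrow> v \<in> hom C y t \<Longrightarrow> \<exists>!m. m \<in> hom C c' t \<and> m \<cdot> p = u \<and> m \<cdot> q = v"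
    using assms(1) unfolding is_coproduct_def by blast
  then show thesis using assms(2-4) that by (metis hom_simps(3))
qed

lemma coproduct_joint_epi:
  assumes "is_coproduct C x y p q" "p \<in> hom C x c" "m \<in> hom C c t" "m' \<in> hom C c t"
    "m \<cdot> p = m' \<cdot> p" "m \<cdot> q = m' \<cdot> q"
  shows "m = m'"
proof -
  obtain c' where c: "p \<in> hom C x c'" "q \<in> hom C y c'" and
    U: "\<And>t u v. u \<in> hom C x t \<Longrightarrow> v \<in> hom C y t \<Longrightarrow> \<exists>!m. m \<in> hom C c' t \<and> m \<cdot> p = u \<and> m \<cdot> q = v"
    using assms(1) unfolding is_coproduct_def by blast
  have [simp]: "c' = c" using c assms(2) by (simp add: hom_def)
  have "\<exists>!u. u \<in> hom C c t \<and> u \<cdot> p = m \<cdot> p \<and> u \<cdot> q = m \<cdot> q"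
    using U[of "m \<cdot> p" t "m \<cdot> q"] assms c by (auto intro: comp_in_hom)
  then show ?thesis using assms by metis
qed

end

section \<open>Lifting properties and factorizations\<close>

context closed_model_category
begin

lemma retractI:
  assumes "f \<in> hom M a b" "g \<in> hom M c d" "i \<in> hom M a c" "r \<in> hom M c a" "j \<in> hom M b d" "s \<in> hom M d b"
    "r \<cdot> i = Id M a" "s \<cdot> j = Id M b" "g \<cdot> i = j \<cdot> f" "f \<cdot> r = s \<cdot> g"
  shows "is_retract M f g"
proof -
  have "Dom M f = a" "Cod M f = b" "Dom M g = c" "Cod M g = d" "f \<in> Ar M" "g \<in> Ar M"
    using assms(1,2) by (auto simp: hom_def)
  then show ?thesis unfolding is_retract_def using assms(3-) by auto
qed

lemma Id_We: assumes "a \<in> Ob M" shows "Id M a \<in> We M"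
proof -
  obtain c i p where ip: "i \<in> hom M a c" "p \<in> hom M c a" "Id M a = p \<cdot> i" "p \<in> Fib M \<inter> We M"
    using factor_Cof_tFib[OF id_in_hom[OF assms]] by blast
  have "is_retract M (Id M a) p"
    by (rule retractI[OF id_in_hom[OF assms] ip(2,1,2) id_in_hom[OF assms] id_in_hom[OF assms]])
      (use ip(1,2) ip(3)[symmetric] assms in \<open>auto simp: hom_def\<close>)
  then show ?thesis using We_retract ip by blast
qed

lemma section_We:
  assumes "s \<in> hom M a b" "p \<in> hom M b a" "p \<in> We M" "p \<cdot> s = Id M a"
  shows "s \<in> We M"
  using We_right[OF assms(1,2,3)] assms(4) Id_We hom_Ob[OF assms(1)] by simp

lemma lift:
  assumes "i \<in> hom M a b" "p \<in> hom M e d" "u \<in> hom M a e" "v \<in> hom M b d" "p \<cdot> u = v \<cdot> i"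
    "i \<in> Cof M" "p \<in> Fib M" "i \<in> We M \<or> p \<in> We M"
  obtains l where "l \<in> hom M b e" "l \<cdot> i = u" "p \<cdot> l = v"
proof -
  have "commutes M u i p v" using assms by (auto simp: commutes_def)
  from lifting[OF this assms(6-8)] show thesis using that assms(1,2) by (auto simp: hom_def)
qed

text \<open>The retract argument: a map that lifts against the right factor of one of its
  factorizations is a retract of the left factor.\<close>

lemma retract_of_left_factor:
  assumes "f \<in> hom M a b" "i \<in> hom M a c" "p \<in> hom M c b" "l \<in> hom M b c"
    "p \<cdot> i = f" "l \<cdot> f = i" "p \<cdot> l = Id M b"
  shows "is_retract M f i"
  by (rule retractI[OF assms(1,2) id_in_hom id_in_hom assms(4,3)])
    (use assms hom_Ob[OF assms(1)] in \<open>auto simp: hom_def\<close>)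

lemma Cof_if_lifting:
  assumes f: "f \<in> hom M a b"
    and L: "\<And>p e d u v. p \<in> hom M e d \<Longrightarrow> p \<in> Fib M \<Longrightarrow> p \<in> We M \<Longrightarrow> u \<in> hom M a e \<Longrightarrow> v \<in> hom M b d \<Longrightarrow>
      p \<cdot> u = v \<cdot> f \<Longrightarrow> \<exists>l \<in> hom M b e. l \<cdot> f = u \<and> p \<cdot> l = v"
  shows "f \<in> Cof M"
proof -
  obtain c i p where ip: "i \<in> hom M a c" "p \<in> hom M c b" "f = p \<cdot> i" "i \<in> Cof M" "p \<in> Fib M \<inter> We M"
    using factor_Cof_tFib[OF f] by blast
  obtain l where "l \<in> hom M b c" "l \<cdot> f = i" "p \<cdot> l = Id M b"
    using L[of p c b i "Id M b"] ip f id_in_hom[OF hom_Ob(2)[OF f]] comp_id_left[OF f] by auto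
  then have "is_retract M f i" using retract_of_left_factor[OF f ip(1,2)] ip(3) by auto
  then show ?thesis using Cof_retract ip by blast
qed

text \<open>The retract argument for the other factorization: \<open>f\<close> is a retract of a trivial cofibration.\<close>

lemma We_if_lifting:
  assumes f: "f \<in> hom M a b"
    and L: "\<And>p e d u v. p \<in> hom M e d \<Longrightarrow> p \<in> Fib M \<Longrightarrow> u \<in> hom M a e \<Longrightarrow> v \<in> hom M b d \<Longrightarrow>
      p \<cdot> u = v \<cdot> f \<Longrightarrow> \<exists>l \<in> hom M b e. l \<cdot> f = u \<and> p \<cdot> l = v"
  shows "f \<in> We M"
proof -
  obtain c i p where ip: "i \<in> hom M a c" "p \<in> hom M c b" "f = p \<cdot> i" "i \<in> Cof M \<inter> We M" "p \<in> Fib M"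
    using factor_tCof_Fib[OF f] by blast
  obtain l where "l \<in> hom M b c" "l \<cdot> f = i" "p \<cdot> l = Id M b"
    using L[of p c b i "Id M b"] ip f id_in_hom[OF hom_Ob(2)[OF f]] comp_id_left[OF f] by auto
  then have "is_retract M f i" using retract_of_left_factor[OF f ip(1,2)] ip(3) by auto
  then show ?thesis using We_retract ip by blast
qed

lemma We_pushout_of_tCof:
  assumes po: "is_pushout M f g h k" and f: "f \<in> Cof M" "f \<in> We M"
  shows "k \<in> We M"
proof -
  obtain z a b d where H: "f \<in> hom M z a" "g \<in> hom M z b" "h \<in> hom M a d" "k \<in> hom M b d" "h \<cdot> f = k \<cdot> g"
    using pushout_hom[OF po] by blast
  have "\<exists>l \<in> hom M d e. l \<cdot> k = u \<and> p \<cdot> l = v"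
    if A: "p \<in> hom M e d'" "p \<in> Fib M" "u \<in> hom M b e" "v \<in> hom M d d'" "p \<cdot> u = v \<cdot> k" for p e d' u v
  proof -
    have "p \<cdot> (u \<cdot> g) = (v \<cdot> h) \<cdot> f"
      using H A comp_cong_left[of p u v k b e d' d g z] by (simp add: hom_def)
    then obtain l1 where l1: "l1 \<in> hom M a e" "l1 \<cdot> f = u \<cdot> g" "p \<cdot> l1 = v \<cdot> h"
      using lift[OF H(1) A(1) comp_in_hom[OF H(2) A(3)] comp_in_hom[OF H(3) A(4)]] A(2) f by metis
    obtain l where l: "l \<in> hom M d e" "l \<cdot> h = l1" "l \<cdot> k = u"
      using pushout_universal[OF po H(1-3) l1(1) A(3) l1(2)] by blast
    have "p \<cdot> l = v"
      by (rule pushout_joint_epi[OF po H(3), of _ d'])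
        (use A l l1 H in \<open>auto simp: hom_def\<close>)
    then show ?thesis using l by blast
  qed
  then show ?thesis using We_if_lifting[OF H(4)] by blast
qed

lemma cofibrant_Ob: "cofibrant M x \<Longrightarrow> x \<in> Ob M" and fibrant_Ob: "fibrant M x \<Longrightarrow> x \<in> Ob M"
  by (auto simp: cofibrant_def fibrant_def)

lemma initial_unique: "is_initial M e \<Longrightarrow> f \<in> hom M e x \<Longrightarrow> g \<in> hom M e x \<Longrightarrow> f = g"
  unfolding is_initial_def using hom_Ob(2)[of f e x] by blast

lemma terminal_unique: "is_terminal M e \<Longrightarrow> f \<in> hom M x e \<Longrightarrow> g \<in> hom M x e \<Longrightarrow> f = g"
  unfolding is_terminal_def using hom_Ob(1)[of f x e] by blast

lemma cofibrant_fibrantD: "cofibrant_fibrant M x \<Longrightarrow> cofibrant M x" "cofibrant_fibrant M x \<Longrightarrow> fibrant M x"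
  by (auto simp: cofibrant_fibrant_def)

lemma cofibrant_lift:
  assumes x: "cofibrant M x" and p: "p \<in> hom M e d" "p \<in> Fib M" "p \<in> We M" and f: "f \<in> hom M x d"
  obtains l where "l \<in> hom M x e" "p \<cdot> l = f"
proof -
  obtain o1 where o: "is_initial M o1" using ex_initial by blast
  obtain i where i: "i \<in> hom M o1 x" using o cofibrant_Ob[OF x] by (auto simp: is_initial_def)
  obtain u where u: "u \<in> hom M o1 e" using o hom_Ob[OF p(1)] by (auto simp: is_initial_def)
  have "i \<in> Cof M" using x o i by (auto simp: cofibrant_def)
  moreover have "p \<cdot> u = f \<cdot> i"
    by (rule initial_unique[OF o comp_in_hom[OF u p(1)] comp_in_hom[OF i f]])
  ultimately show thesis using lift[OF i p(1) u f] p that by blast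
qed

lemma cofibrantI:
  assumes x: "x \<in> Ob M" and L: "\<And>p e d f. p \<in> hom M e d \<Longrightarrow> p \<in> Fib M \<Longrightarrow> p \<in> We M \<Longrightarrow> f \<in> hom M x d \<Longrightarrow>
      \<exists>l \<in> hom M x e. p \<cdot> l = f"
  shows "cofibrant M x"
  unfolding cofibrant_def
proof (intro conjI x allI impI)
  fix e f assume e: "is_initial M e" "f \<in> hom M e x"
  show "f \<in> Cof M"
  proof (rule Cof_if_lifting[OF e(2)])
    fix p e' d u v assume p: "p \<in> hom M e' d" "p \<in> Fib M" "p \<in> We M" "u \<in> hom M e e'" "v \<in> hom M x d"
    then obtain l where "l \<in> hom M x e'" "p \<cdot> l = v" using L by blast
    then show "\<exists>l\<in>hom M x e'. l \<cdot> f = u \<and> p \<cdot> l = v"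
      using initial_unique[OF e(1) comp_in_hom[OF e(2)]] p by blast
  qed
qed

lemma fibrant_extend:
  assumes x: "fibrant M x" and i: "i \<in> hom M a b" "i \<in> Cof M" "i \<in> We M" and f: "f \<in> hom M a x"
  obtains l where "l \<in> hom M b x" "l \<cdot> i = f"
proof -
  obtain t where t: "is_terminal M t" using ex_terminal by blast
  obtain p where p: "p \<in> hom M x t" using t fibrant_Ob[OF x] by (auto simp: is_terminal_def)
  obtain u where u: "u \<in> hom M b t" using t hom_Ob[OF i(1)] by (auto simp: is_terminal_def)
  have "p \<in> Fib M" using x t p by (auto simp: fibrant_def)
  moreover have "p \<cdot> f = u \<cdot> i"
    by (rule terminal_unique[OF t comp_in_hom[OF f p] comp_in_hom[OF i(1) u]])
  ultimately show thesis using lift[OF i(1) p f u] i that by blast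
qed

lemma fibrantI:
  assumes x: "x \<in> Ob M" and L: "\<And>i a b f. i \<in> hom M a b \<Longrightarrow> i \<in> Cof M \<Longrightarrow> i \<in> We M \<Longrightarrow> f \<in> hom M a x \<Longrightarrow>
      \<exists>l \<in> hom M b x. l \<cdot> i = f"
  shows "fibrant M x"
  unfolding fibrant_def
proof (intro conjI x allI impI)
  fix t f assume t: "is_terminal M t" "f \<in> hom M x t"
  obtain c i p where ip: "i \<in> hom M x c" "p \<in> hom M c t" "f = p \<cdot> i" "i \<in> Cof M \<inter> We M" "p \<in> Fib M"
    using factor_tCof_Fib[OF t(2)] by blast
  obtain r where r: "r \<in> hom M c x" "r \<cdot> i = Id M x"
    using L[OF ip(1) _ _ id_in_hom[OF x]] ip by blast
  have fr: "f \<cdot> r = p" by (rule terminal_unique[OF t(1) comp_in_hom[OF r(1) t(2)] ip(2)])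
  have "is_retract M f p"
    by (rule retractI[OF t(2) ip(2,1) r(1) id_in_hom id_in_hom])
      (use ip r t fr x hom_Ob[OF t(2)] in \<open>auto simp: hom_def\<close>)
  then show "f \<in> Fib M" using Fib_retract ip by blast
qed

lemma fibrant_total:
  assumes "p \<in> hom M e d" "p \<in> Fib M" "fibrant M d" shows "fibrant M e"
proof (rule fibrantI)
  show "e \<in> Ob M" using assms hom_Ob by blast
  fix i a b f assume i: "i \<in> hom M a b" "i \<in> Cof M" "i \<in> We M" "f \<in> hom M a e"
  obtain v where v: "v \<in> hom M b d" "v \<cdot> i = p \<cdot> f"
    using fibrant_extend[OF assms(3) i(1-3) comp_in_hom[OF i(4) assms(1)]] by blast
  show "\<exists>l \<in> hom M b e. l \<cdot> i = f" using lift[OF i(1) assms(1) i(4) v(1)] v i assms by metis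
qed

lemma cofibrant_target:
  assumes "i \<in> hom M a b" "i \<in> Cof M" "cofibrant M a" shows "cofibrant M b"
proof (rule cofibrantI)
  show "b \<in> Ob M" using assms hom_Ob by blast
  fix p e d f assume p: "p \<in> hom M e d" "p \<in> Fib M" "p \<in> We M" "f \<in> hom M b d"
  obtain u where u: "u \<in> hom M a e" "p \<cdot> u = f \<cdot> i"
    using cofibrant_lift[OF assms(3) p(1-3) comp_in_hom[OF assms(1) p(4)]] by blast
  show "\<exists>l \<in> hom M b e. p \<cdot> l = f" using lift[OF assms(1) p(1) u(1) p(4) u(2)] p assms by metis
qed

text \<open>The standard homotopy pullback is fibrant, since a map into it is a pair of maps, the
  second of which can be extended first and the first one then by lifting along \<open>p\<close>.\<close>

lemma pullback_fibrant:
  assumes pb: "is_pullback M x y p g" and p: "p \<in> hom M e d" "p \<in> Fib M" and g: "g \<in> hom M b d"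
    and b: "fibrant M b" and x: "x \<in> hom M P e"
  shows "fibrant M P"
proof (rule fibrantI)
  have xy: "y \<in> hom M P b" "p \<cdot> x = g \<cdot> y" using pullback_hom[OF pb p(1) g] x by (auto simp: hom_def)
  show "P \<in> Ob M" using x hom_Ob by blast
  fix i a c f assume i: "i \<in> hom M a c" "i \<in> Cof M" "i \<in> We M" "f \<in> hom M a P"
  obtain v where v: "v \<in> hom M c b" "v \<cdot> i = y \<cdot> f"
    using fibrant_extend[OF b i(1-3) comp_in_hom[OF i(4) xy(1)]] by blast
  have "p \<cdot> (x \<cdot> f) = (g \<cdot> v) \<cdot> i"
    using comp_cong_left[OF xy(2) x p(1) xy(1) g i(4)] v xy i g by (simp add: hom_def)
  then obtain u where u: "u \<in> hom M c e" "u \<cdot> i = x \<cdot> f" "p \<cdot> u = g \<cdot> v"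
    using lift[OF i(1) p(1) comp_in_hom[OF i(4) x] comp_in_hom[OF v(1) g]] i p by metis
  obtain m where m: "m \<in> hom M c P" "x \<cdot> m = u" "y \<cdot> m = v"
    using pullback_universal[OF pb x p(1) g u(1) v(1) u(3)] by blast
  have "commutes M (x \<cdot> f) (y \<cdot> f) p g"
    unfolding commutes_def using p g comp_in_hom[OF i(4) x] comp_in_hom[OF i(4) xy(1)]
      comp_cong_left[OF xy(2) x p(1) xy(1) g i(4)] by blast
  then have "\<exists>!n. n \<in> hom M (Dom M (x \<cdot> f)) (Dom M x) \<and> x \<cdot> n = x \<cdot> f \<and> y \<cdot> n = y \<cdot> f"
    using pb unfolding is_pullback_def by blast
  moreover have "m \<cdot> i \<in> hom M (Dom M (x \<cdot> f)) (Dom M x)" "f \<in> hom M (Dom M (x \<cdot> f)) (Dom M x)"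
    using i m x by (auto simp: hom_def)
  moreover have "x \<cdot> (m \<cdot> i) = x \<cdot> f" "y \<cdot> (m \<cdot> i) = y \<cdot> f"
    using comp_reduce[OF m(2) m(1) x i(1)] comp_reduce[OF m(3) m(1) xy(1) i(1)] u v by auto
  ultimately have "m \<cdot> i = f" by metis
  then show "\<exists>l \<in> hom M c P. l \<cdot> i = f" using m by blast
qed

lemma ex_coproduct:
  assumes "x \<in> Ob M" "y \<in> Ob M" obtains p q where "is_coproduct M x y p q"
proof -
  obtain o1 where o: "is_initial M o1" using ex_initial by blast
  obtain f where f: "f \<in> hom M o1 x" using o assms by (auto simp: is_initial_def)
  obtain g where g: "g \<in> hom M o1 y" using o assms by (auto simp: is_initial_def)
  obtain h k where po: "is_pushout M f g h k" using ex_pushout[OF f g] by blast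
  obtain d where hk: "h \<in> hom M x d" "k \<in> hom M y d"
    using pushout_hom[OF po] f g by (metis hom_simps(2,3))
  have "\<exists>!m. m \<in> hom M d t \<and> m \<cdot> h = u \<and> m \<cdot> k = v" if uv: "u \<in> hom M x t" "v \<in> hom M y t" for t u v
  proof -
    have "u \<cdot> f = v \<cdot> g"
      by (rule initial_unique[OF o comp_in_hom[OF f uv(1)] comp_in_hom[OF g uv(2)]])
    then obtain m where "m \<in> hom M d t" "m \<cdot> h = u" "m \<cdot> k = v"
      using pushout_universal[OF po f g hk(1) uv] by blast
    then show ?thesis using pushout_joint_epi[OF po hk(1)] by metis
  qed
  then have "is_coproduct M x y h k" unfolding is_coproduct_def using hk by blast
  then show thesis by (rule that)
qed

lemma Cof_comp:
  assumes f: "f \<in> hom M a b" "f \<in> Cof M" and g: "g \<in> hom M b c" "g \<in> Cof M"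
  shows "g \<cdot> f \<in> Cof M"
proof (rule Cof_if_lifting[OF comp_in_hom[OF f(1) g(1)]])
  fix p e d u v
  assume p: "p \<in> hom M e d" "p \<in> Fib M" "p \<in> We M" and uv: "u \<in> hom M a e" "v \<in> hom M c d"
    and eq: "p \<cdot> u = v \<cdot> (g \<cdot> f)"
  have "p \<cdot> u = (v \<cdot> g) \<cdot> f" using eq f g uv by (simp add: hom_def)
  then obtain l where l: "l \<in> hom M b e" "l \<cdot> f = u" "p \<cdot> l = v \<cdot> g"
    using lift[OF f(1) p(1) uv(1) comp_in_hom[OF g(1) uv(2)]] f p by metis
  then obtain m where m: "m \<in> hom M c e" "m \<cdot> g = l" "p \<cdot> m = v"
    using lift[OF g(1) p(1) l(1) uv(2)] g p by metis
  have "m \<cdot> (g \<cdot> f) = u" using comp_reduce[OF m(2) g(1) m(1) f(1)] l by simp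
  then show "\<exists>l\<in>hom M c e. l \<cdot> (g \<cdot> f) = u \<and> p \<cdot> l = v" using m by blast
qed

text \<open>The inclusion of \<open>x\<close> is the cobase change of \<open>\<emptyset> \<rightarrow> y\<close>.\<close>

lemma coproduct_inclusion_Cof:
  assumes co: "is_coproduct M x y p q" and y: "cofibrant M y" and c: "p \<in> hom M x c"
  shows "p \<in> Cof M"
proof (rule Cof_if_lifting[OF c])
  fix r e d u v
  assume r: "r \<in> hom M e d" "r \<in> Fib M" "r \<in> We M" and uv: "u \<in> hom M x e" "v \<in> hom M c d"
    and eq: "r \<cdot> u = v \<cdot> p"
  have q: "q \<in> hom M y c" using coproduct_hom[OF co] c by (metis hom_simps(3))
  obtain u' where u': "u' \<in> hom M y e" "r \<cdot> u' = v \<cdot> q"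
    using cofibrant_lift[OF y r comp_in_hom[OF q uv(2)]] by blast
  obtain m where m: "m \<in> hom M c e" "m \<cdot> p = u" "m \<cdot> q = u'"
    using coproduct_universal[OF co c uv(1) u'(1)] by blast
  have "r \<cdot> m = v"
    by (rule coproduct_joint_epi[OF co c, of _ d]) (use r uv m u' eq c q in \<open>auto simp: hom_def\<close>)
  then show "\<exists>l\<in>hom M c e. l \<cdot> p = u \<and> r \<cdot> l = v" using m by blast
qed

lemma cofibrant_replacement:
  assumes "P \<in> Ob M" obtains F q where "q \<in> hom M F P" "q \<in> Fib M" "q \<in> We M" "cofibrant M F"
proof -
  obtain e where e: "is_initial M e" using ex_initial by blast
  then obtain f where f: "f \<in> hom M e P" using assms by (auto simp: is_initial_def)
  obtain F i q where q: "i \<in> hom M e F" "q \<in> hom M F P" "i \<in> Cof M" "q \<in> Fib M \<inter> We M"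
    using factor_Cof_tFib[OF f] by blast
  have "cofibrant M F"
  proof (rule cofibrantI)
    show "F \<in> Ob M" using q hom_Ob by blast
    fix p E d v assume p: "p \<in> hom M E d" "p \<in> Fib M" "p \<in> We M" "v \<in> hom M F d"
    obtain u where u: "u \<in> hom M e E" using e hom_Ob[OF p(1)] unfolding is_initial_def by blast
    have "p \<cdot> u = v \<cdot> i" by (rule initial_unique[OF e comp_in_hom[OF u p(1)] comp_in_hom[OF q(1) p(4)]])
    then show "\<exists>l\<in>hom M F E. p \<cdot> l = v" using lift[OF q(1) p(1) u p(4)] p q by metis
  qed
  then show thesis using that q by blast
qed

section \<open>Cylinders\<close>

lemma cylinder_hom:
  assumes "is_cylinder M z I"
  obtains i where "inc0 I \<in> hom M z i" "inc1 I \<in> hom M z i" "prj I \<in> hom M i z"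
    "prj I \<cdot> inc0 I = Id M z" "prj I \<cdot> inc1 I = Id M z" "prj I \<in> We M"
  using assms unfolding is_cylinder_def by blast

text \<open>The condition that the ends of a cylinder are jointly a cofibration is used in this form: both
  ends of the lift can be prescribed.\<close>

lemma cylinder_lift:
  assumes cyl: "is_cylinder M z I" "inc0 I \<in> hom M z i"
    and p: "p \<in> hom M e d" "p \<in> Fib M" "p \<in> We M"
    and u: "u0 \<in> hom M z e" "u1 \<in> hom M z e" and v: "v \<in> hom M i d"
    and eq: "p \<cdot> u0 = v \<cdot> inc0 I" "p \<cdot> u1 = v \<cdot> inc1 I"
  obtains l where "l \<in> hom M i e" "l \<cdot> inc0 I = u0" "l \<cdot> inc1 I = u1" "p \<cdot> l = v"
proof -
  have z: "z \<in> Ob M" using u hom_Ob by blast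
  obtain r s where co: "is_coproduct M z z r s" using ex_coproduct[OF z z] by blast
  obtain c where c: "r \<in> hom M z c" "s \<in> hom M z c" using coproduct_hom[OF co] by blast
  have inc1: "inc1 I \<in> hom M z i" using cylinder_hom[OF cyl(1)] cyl(2) by (metis hom_simps(3))
  obtain m where m: "m \<in> hom M c i" "m \<cdot> r = inc0 I" "m \<cdot> s = inc1 I"
    using coproduct_universal[OF co c(1) cyl(2) inc1] by blast
  have "m \<in> Cof M"
  proof -
    obtain i' where i': "inc0 I \<in> hom M z i'" and
      "\<And>p q m. is_coproduct M z z p q \<Longrightarrow> m \<in> hom M (Cod M p) i' \<Longrightarrow>
           m \<cdot> p = inc0 I \<Longrightarrow> m \<cdot> q = inc1 I \<Longrightarrow> m \<in> Cof M"
      using cyl(1) unfolding is_cylinder_def by blast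
    moreover have "i' = i" using i' cyl(2) by (simp add: hom_def)
    ultimately show ?thesis using co m c by (simp add: hom_simps)
  qed
  obtain u where u': "u \<in> hom M c e" "u \<cdot> r = u0" "u \<cdot> s = u1"
    using coproduct_universal[OF co c(1) u] by blast
  have "p \<cdot> u = v \<cdot> m"
    by (rule coproduct_joint_epi[OF co c(1), of _ d]) (use p u v m u' eq c in \<open>auto simp: hom_def\<close>)
  then obtain l where l: "l \<in> hom M i e" "l \<cdot> m = u" "p \<cdot> l = v"
    using lift[OF m(1) p(1) u'(1) v] \<open>m \<in> Cof M\<close> p by metis
  have "l \<cdot> inc0 I = u0" "l \<cdot> inc1 I = u1"
    using comp_reduce[OF l(2) m(1) l(1) c(1)] comp_reduce[OF l(2) m(1) l(1) c(2)] m u' by auto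
  then show thesis using that l by blast
qed

lemma ex_cylinder:
  assumes z: "z \<in> Ob M" obtains I i where "is_cylinder M z I" "inc0 I \<in> hom M z i"
proof -
  obtain r s where co: "is_coproduct M z z r s" using ex_coproduct[OF z z] by blast
  obtain c where c: "r \<in> hom M z c" "s \<in> hom M z c" using coproduct_hom[OF co] by blast
  obtain n where n: "n \<in> hom M c z" "n \<cdot> r = Id M z" "n \<cdot> s = Id M z"
    using coproduct_universal[OF co c(1) id_in_hom[OF z] id_in_hom[OF z]] by blast
  obtain i m p where mp: "m \<in> hom M c i" "p \<in> hom M i z" "n = p \<cdot> m" "m \<in> Cof M" "p \<in> Fib M \<inter> We M"
    using factor_Cof_tFib[OF n(1)] by blast
  define I where "I = \<lparr>inc0 = m \<cdot> r, inc1 = m \<cdot> s, prj = p\<rparr>"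
  have h: "m \<cdot> r \<in> hom M z i" "m \<cdot> s \<in> hom M z i" using c mp by (auto intro: comp_in_hom)
  have id: "p \<cdot> (m \<cdot> r) = Id M z" "p \<cdot> (m \<cdot> s) = Id M z"
    using comp_reduce[OF mp(3)[symmetric] mp(1,2) c(1)] comp_reduce[OF mp(3)[symmetric] mp(1,2) c(2)] n
    by auto
  have "m' \<in> Cof M"
    if co': "is_coproduct M z z p' q'" and m': "m' \<in> hom M (Cod M p') i" "m' \<cdot> p' = m \<cdot> r" "m' \<cdot> q' = m \<cdot> s"
    for p' q' m'
  proof (rule Cof_if_lifting[OF m'(1)])
    fix f e d u v
    assume f: "f \<in> hom M e d" "f \<in> Fib M" "f \<in> We M" and uv: "u \<in> hom M (Cod M p') e" "v \<in> hom M i d"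
      and eq: "f \<cdot> u = v \<cdot> m'"
    obtain c' where c': "p' \<in> hom M z c'" "q' \<in> hom M z c'" using coproduct_hom[OF co'] by blast
    have [simp]: "Cod M p' = c'" using c' by (simp add: hom_simps)
    obtain k where k: "k \<in> hom M c c'" "k \<cdot> r = p'" "k \<cdot> s = q'"
      using coproduct_universal[OF co c(1) c'] by blast
    have m'k: "m' \<cdot> k = m"
      by (rule coproduct_joint_epi[OF co c(1), of _ i]) (use m' mp k c in \<open>auto simp: hom_def\<close>)
    have "f \<cdot> (u \<cdot> k) = v \<cdot> m"
      using comp_cong_left[OF eq, of _ _ d _ k c] uv f m' k m'k by simp
    then obtain l where l: "l \<in> hom M i e" "l \<cdot> m = u \<cdot> k" "f \<cdot> l = v"
      using lift[OF mp(1) f(1) comp_in_hom[OF k(1)] uv(2)] uv mp f by auto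
    have "l \<cdot> m' = u"
    proof (rule coproduct_joint_epi[OF co' c'(1)])
      show "l \<cdot> m' \<in> hom M c' e" "u \<in> hom M c' e" using l m' uv by (auto intro: comp_in_hom)
      have "l \<cdot> (m \<cdot> r) = u \<cdot> (k \<cdot> r)" "l \<cdot> (m \<cdot> s) = u \<cdot> (k \<cdot> s)"
        using comp_cong_left[OF l(2) mp(1) l(1) k(1) _ c(1)] comp_cong_left[OF l(2) mp(1) l(1) k(1) _ c(2)] uv
        by auto
      then show "(l \<cdot> m') \<cdot> p' = u \<cdot> p'" "(l \<cdot> m') \<cdot> q' = u \<cdot> q'"
        using m' l c' k by (simp_all add: hom_simps)
    qed
    then show "\<exists>l\<in>hom M i e. l \<cdot> m' = u \<and> f \<cdot> l = v" using l by blast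
  qed
  then have "is_cylinder M z I"
    unfolding is_cylinder_def I_def using h mp id by auto
  then show thesis using that h by (simp add: I_def)
qed

lemma cylinder_inclusion_We:
  assumes "is_cylinder M z I" shows "inc0 I \<in> We M"
proof -
  obtain i where "inc0 I \<in> hom M z i" "prj I \<in> hom M i z" "prj I \<cdot> inc0 I = Id M z" "prj I \<in> We M"
    using cylinder_hom[OF assms] by metis
  then show ?thesis using section_We by blast
qed

text \<open>Cofibrancy of \<open>z\<close> provides the lift at the other end. Being also a weak equivalence, the
  inclusion of an end is a map along which cylinders can be glued without changing the homotopy
  type.\<close>

lemma cylinder_inclusion_Cof:
  assumes I: "is_cylinder M z I" and z: "cofibrant M z"
  shows "inc0 I \<in> Cof M"
proof -
  obtain i where i: "inc0 I \<in> hom M z i" "inc1 I \<in> hom M z i"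
    using cylinder_hom[OF I] by blast
  show ?thesis
  proof (rule Cof_if_lifting[OF i(1)])
    fix p e d u v
    assume p: "p \<in> hom M e d" "p \<in> Fib M" "p \<in> We M" and uv: "u \<in> hom M z e" "v \<in> hom M i d"
      and eq: "p \<cdot> u = v \<cdot> inc0 I"
    obtain u1 where u1: "u1 \<in> hom M z e" "p \<cdot> u1 = v \<cdot> inc1 I"
      using cofibrant_lift[OF z p comp_in_hom[OF i(2) uv(2)]] by blast
    show "\<exists>l\<in>hom M i e. l \<cdot> inc0 I = u \<and> p \<cdot> l = v"
      using cylinder_lift[OF I i(1) p uv(1) u1(1) uv(2) eq u1(2)] by blast
  qed
qed

section \<open>Maps on objects glued along trivial cofibrations\<close>

text \<open>Any weak equivalence \<open>t\<close> can be replaced by a trivial fibration without losing a given map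
  \<open>F\<close>, because the map from \<open>w\<close> to the replacement is a trivial cofibration and \<open>F\<close> extends along it,
  over \<open>Y\<close>.\<close>

lemma We_extension_over:
  assumes t: "t \<in> hom M w b" "t \<in> We M" and F: "F \<in> hom M w G" and g: "g \<in> hom M G Y" "g \<in> Fib M"
    and k: "k \<in> hom M b Y" and eq: "g \<cdot> F = k \<cdot> t"
  obtains w' j p F' where "j \<in> hom M w w'" "p \<in> hom M w' b" "p \<in> Fib M" "p \<in> We M" "p \<cdot> j = t"
    "F' \<in> hom M w' G" "F' \<cdot> j = F" "g \<cdot> F' = k \<cdot> p"
proof -
  obtain w' j p where jp: "j \<in> hom M w w'" "p \<in> hom M w' b" "t = p \<cdot> j" "j \<in> Cof M \<inter> We M" "p \<in> Fib M"
    using factor_tCof_Fib[OF t(1)] by blast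
  have "p \<in> We M" using We_left[OF jp(1,2)] jp t by auto
  have "g \<cdot> F = (k \<cdot> p) \<cdot> j" using eq jp k by (simp add: hom_def)
  then obtain F' where "F' \<in> hom M w' G" "F' \<cdot> j = F" "g \<cdot> F' = k \<cdot> p"
    using lift[OF jp(1) g(1) F comp_in_hom[OF jp(2) k]] g jp by blast
  then show thesis using that jp \<open>p \<in> We M\<close> by blast
qed

text \<open>This is how coherence is obtained. Up to the replacement of \<open>t\<close> by a trivial fibration, \<open>w\<close> has
  the same homotopy as \<open>b\<close>, so that \<open>u0\<close> and \<open>u1\<close> are connected by a homotopy in \<open>w\<close> that lies over the
  prescribed one in \<open>b\<close>; its image under \<open>F\<close> then lies over the prescribed homotopy in \<open>Y\<close> strictly.\<close>

lemma fill_over: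
  assumes t: "t \<in> hom M w b" "t \<in> We M" and F: "F \<in> hom M w G" and g: "g \<in> hom M G Y" "g \<in> Fib M"
    and k: "k \<in> hom M b Y" and eq: "g \<cdot> F = k \<cdot> t"
    and I: "is_cylinder M z I" "inc0 I \<in> hom M z i"
    and u: "u0 \<in> hom M z w" "u1 \<in> hom M z w" and v: "v \<in> hom M i b"
    and tu: "t \<cdot> u0 = v \<cdot> inc0 I" "t \<cdot> u1 = v \<cdot> inc1 I"
  obtains H where "H \<in> hom M i G" "H \<cdot> inc0 I = F \<cdot> u0" "H \<cdot> inc1 I = F \<cdot> u1" "g \<cdot> H = k \<cdot> v"
proof -
  obtain w' j p F' where E: "j \<in> hom M w w'" "p \<in> hom M w' b" "p \<in> Fib M" "p \<in> We M" "p \<cdot> j = t"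
    "F' \<in> hom M w' G" "F' \<cdot> j = F" "g \<cdot> F' = k \<cdot> p"
    by (rule We_extension_over[OF t F g k eq])
  have i1: "inc1 I \<in> hom M z i" using cylinder_hom[OF I(1)] I(2) by (metis hom_simps(3))
  have "p \<cdot> (j \<cdot> u0) = v \<cdot> inc0 I" "p \<cdot> (j \<cdot> u1) = v \<cdot> inc1 I"
    using comp_reduce[OF E(5) E(1,2)] u tu by auto
  then obtain l where l: "l \<in> hom M i w'" "l \<cdot> inc0 I = j \<cdot> u0" "l \<cdot> inc1 I = j \<cdot> u1" "p \<cdot> l = v"
    using cylinder_lift[OF I E(2-4) comp_in_hom[OF u(1) E(1)] comp_in_hom[OF u(2) E(1)] v] by blast
  show thesis
  proof (rule that[of "F' \<cdot> l"])
    show "F' \<cdot> l \<in> hom M i G" using E l by (auto intro: comp_in_hom)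
    show "(F' \<cdot> l) \<cdot> inc0 I = F \<cdot> u0" "(F' \<cdot> l) \<cdot> inc1 I = F \<cdot> u1"
      using comp_reduce[OF E(7) E(1,6) u(1)] comp_reduce[OF E(7) E(1,6) u(2)] l E I i1
      by (auto simp: hom_simps)
    show "g \<cdot> (F' \<cdot> l) = k \<cdot> v"
      using comp_cong_left[OF E(8,6) g(1) E(2) k l(1)] l by simp
  qed
qed

lemma We_extension:
  assumes Y: "fibrant M Y" and t: "t \<in> hom M w b" "t \<in> We M" and F: "F \<in> hom M w Y"
  obtains w' j p F' where "j \<in> hom M w w'" "p \<in> hom M w' b" "p \<in> Fib M" "p \<in> We M" "p \<cdot> j = t"
    "F' \<in> hom M w' Y" "F' \<cdot> j = F"
proof -
  obtain T where T: "is_terminal M T" using ex_terminal by blast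
  obtain g where g: "g \<in> hom M Y T" using T fibrant_Ob[OF Y] by (auto simp: is_terminal_def)
  obtain k where k: "k \<in> hom M b T" using T hom_Ob[OF t(1)] by (auto simp: is_terminal_def)
  have "g \<in> Fib M" using Y T g by (auto simp: fibrant_def)
  show thesis
    by (rule We_extension_over[OF t F g \<open>g \<in> Fib M\<close> k
          terminal_unique[OF T comp_in_hom[OF F g] comp_in_hom[OF t(1) k]]]) (rule that)
qed

text \<open>The object \<open>w\<close> obtained from \<open>w0\<close> by gluing on \<open>c\<close> along a trivial cofibration stays weakly
  equivalent to \<open>b\<close>, hence is a legitimate source for filling.\<close>

lemma glue:
  assumes t0: "t0 \<in> hom M w0 b" "t0 \<in> We M" and d: "d \<in> hom M s c" "d \<in> Cof M" "d \<in> We M"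
    and e: "e \<in> hom M s w0" and t1: "t1 \<in> hom M c b" and eq: "t0 \<cdot> e = t1 \<cdot> d"
    and F: "F0 \<in> hom M w0 Y" "F1 \<in> hom M c Y" "F0 \<cdot> e = F1 \<cdot> d"
  obtains w i0 i1 t F where "i0 \<in> hom M w0 w" "i1 \<in> hom M c w" "i0 \<cdot> e = i1 \<cdot> d"
    "t \<in> hom M w b" "t \<in> We M" "t \<cdot> i0 = t0" "t \<cdot> i1 = t1"
    "F \<in> hom M w Y" "F \<cdot> i0 = F0" "F \<cdot> i1 = F1" "is_pushout M d e i1 i0"
proof -
  obtain i1 i0 where po: "is_pushout M d e i1 i0" using ex_pushout[OF d(1) e] by blast
  obtain w where w: "i1 \<in> hom M c w" "i0 \<in> hom M w0 w" "i0 \<cdot> e = i1 \<cdot> d"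
    using pushout_hom[OF po] d(1) e by (metis hom_simps(3))
  obtain t where t: "t \<in> hom M w b" "t \<cdot> i1 = t1" "t \<cdot> i0 = t0"
    using pushout_universal[OF po d(1) e w(1) t1 t0(1) eq[symmetric]] by blast
  obtain F where F: "F \<in> hom M w Y" "F \<cdot> i1 = F1" "F \<cdot> i0 = F0"
    using pushout_universal[OF po d(1) e w(1) F(2,1) F(3)[symmetric]] by blast
  have "i0 \<in> We M" using We_pushout_of_tCof[OF po d(2,3)] .
  then have "t \<in> We M" using We_left[OF w(2) t(1)] t t0 by auto
  then show thesis using that w t F po by blast
qed

lemma glue_over:
  assumes t0: "t0 \<in> hom M w0 b" "t0 \<in> We M" and d: "d \<in> hom M s c" "d \<in> Cof M" "d \<in> We M"
    and e: "e \<in> hom M s w0" and t1: "t1 \<in> hom M c b" and eq: "t0 \<cdot> e = t1 \<cdot> d"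
    and F: "F0 \<in> hom M w0 G" "F1 \<in> hom M c G" "F0 \<cdot> e = F1 \<cdot> d"
    and g: "g \<in> hom M G Y" and k: "k \<in> hom M b Y" and over: "g \<cdot> F0 = k \<cdot> t0" "g \<cdot> F1 = k \<cdot> t1"
  obtains w i0 i1 t F where "i0 \<in> hom M w0 w" "i1 \<in> hom M c w"
    "t \<in> hom M w b" "t \<in> We M" "t \<cdot> i0 = t0" "t \<cdot> i1 = t1"
    "F \<in> hom M w G" "F \<cdot> i0 = F0" "F \<cdot> i1 = F1" "g \<cdot> F = k \<cdot> t"
proof -
  obtain w i0 i1 t F' where G: "i0 \<in> hom M w0 w" "i1 \<in> hom M c w" "i0 \<cdot> e = i1 \<cdot> d"
    "t \<in> hom M w b" "t \<in> We M" "t \<cdot> i0 = t0" "t \<cdot> i1 = t1"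
    "F' \<in> hom M w G" "F' \<cdot> i0 = F0" "F' \<cdot> i1 = F1" "is_pushout M d e i1 i0"
    by (rule glue[OF t0 d e t1 eq F])
  have "g \<cdot> F' = k \<cdot> t"
    by (rule pushout_joint_epi[OF G(11,2) comp_in_hom[OF G(8) g] comp_in_hom[OF G(4) k]])
      (use G(1,2,4,6-10) g k over in \<open>auto simp: hom_def\<close>)
  then show thesis using that G(1,2,4-10) by blast
qed

section \<open>The homotopy relation\<close>

lemma homotopicI:
  assumes I: "is_cylinder M z I" "inc0 I \<in> hom M z i" and H: "H \<in> hom M i x" "H \<cdot> inc0 I = f" "H \<cdot> inc1 I = g"
  shows "homotopic M f g"
proof -
  have i1: "inc1 I \<in> hom M z i" using cylinder_hom[OF I(1)] I(2) by (metis hom_simps(3))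
  have "f \<in> hom M z x" "g \<in> hom M z x" "Cod M (inc0 I) = i"
    using H I i1 comp_in_hom by (auto simp: hom_simps)
  then show ?thesis unfolding homotopic_def is_homotopy_def using I(1) H by blast
qed

lemma homotopicE:
  assumes "homotopic M f g" "f \<in> hom M z x"
  obtains I H i where "is_cylinder M z I" "inc0 I \<in> hom M z i" "inc1 I \<in> hom M z i"
    "prj I \<in> hom M i z" "prj I \<in> We M" "prj I \<cdot> inc0 I = Id M z" "prj I \<cdot> inc1 I = Id M z"
    "H \<in> hom M i x" "H \<cdot> inc0 I = f" "H \<cdot> inc1 I = g" "g \<in> hom M z x"
proof -
  obtain I H z' x' where A: "f \<in> hom M z' x'" "g \<in> hom M z' x'" "is_cylinder M z' I"
    "H \<in> hom M (Cod M (inc0 I)) x'" "H \<cdot> inc0 I = f" "H \<cdot> inc1 I = g"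
    using assms(1) unfolding homotopic_def is_homotopy_def by blast
  have [simp]: "z' = z" "x' = x" using A assms(2) by (auto simp: hom_def)
  obtain i where i: "inc0 I \<in> hom M z i" "inc1 I \<in> hom M z i" "prj I \<in> hom M i z"
    "prj I \<cdot> inc0 I = Id M z" "prj I \<cdot> inc1 I = Id M z" "prj I \<in> We M"
    using cylinder_hom[OF A(3)] by auto
  have "Cod M (inc0 I) = i" using i by (simp add: hom_simps)
  then show thesis using that[of I i H] A i by simp
qed

text \<open>Filling over a terminal object. Symmetry, transitivity and compatibility with precomposition
  all follow by exhibiting the two maps as values of a single \<open>F\<close> at points \<open>u0\<close>, \<open>u1\<close> that a weak
  equivalence identifies.\<close>

lemma homotopic_via:
  assumes Y: "fibrant M Y" and t: "t \<in> hom M w b" "t \<in> We M" and F: "F \<in> hom M w Y"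
    and u: "u0 \<in> hom M z w" "u1 \<in> hom M z w" and tu: "t \<cdot> u0 = t \<cdot> u1"
  shows "homotopic M (F \<cdot> u0) (F \<cdot> u1)"
proof -
  \<comment> \<open>A fibrant object is fibred over the terminal one.\<close>
  obtain T where T: "is_terminal M T" using ex_terminal by blast
  obtain g where g: "g \<in> hom M Y T" using T fibrant_Ob[OF Y] by (auto simp: is_terminal_def)
  obtain k where k: "k \<in> hom M b T" using T hom_Ob[OF t(1)] by (auto simp: is_terminal_def)
  have fib: "g \<in> Fib M" using Y T g by (auto simp: fibrant_def)
  obtain I i where I: "is_cylinder M z I" "inc0 I \<in> hom M z i" using ex_cylinder hom_Ob u by metis
  have J: "inc1 I \<in> hom M z i" "prj I \<in> hom M i z" "prj I \<cdot> inc0 I = Id M z" "prj I \<cdot> inc1 I = Id M z"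
    using cylinder_hom[OF I(1)] I(2) by (metis hom_simps(3))+
  have tz: "t \<cdot> u0 \<in> hom M z b" using t u by (auto intro: comp_in_hom)
  have "t \<cdot> u0 = (t \<cdot> u0) \<cdot> prj I \<cdot> inc0 I" "t \<cdot> u1 = (t \<cdot> u0) \<cdot> prj I \<cdot> inc1 I"
    unfolding J using tz tu by (simp_all add: comp_id_right)
  then have "t \<cdot> u0 = ((t \<cdot> u0) \<cdot> prj I) \<cdot> inc0 I" "t \<cdot> u1 = ((t \<cdot> u0) \<cdot> prj I) \<cdot> inc1 I"
    using tz J I by (simp_all add: hom_simps)
  from fill_over[OF t F g fib k terminal_unique[OF T comp_in_hom[OF F g] comp_in_hom[OF t(1) k]] I u
      comp_in_hom[OF J(2) tz] this]
  obtain H where "H \<in> hom M i Y" "H \<cdot> inc0 I = F \<cdot> u0" "H \<cdot> inc1 I = F \<cdot> u1" by blast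
  then show ?thesis using homotopicI[OF I] by blast
qed

lemma homotopic_refl:
  assumes f: "f \<in> hom M z x" shows "homotopic M f f"
proof -
  obtain I i where I: "is_cylinder M z I" "inc0 I \<in> hom M z i" using ex_cylinder hom_Ob f by metis
  have J: "inc1 I \<in> hom M z i" "prj I \<in> hom M i z" "prj I \<cdot> inc0 I = Id M z" "prj I \<cdot> inc1 I = Id M z"
    using cylinder_hom[OF I(1)] I(2) by (metis hom_simps(3))+
  show ?thesis
    by (rule homotopicI[OF I comp_in_hom[OF J(2) f]]) (use f I J in \<open>simp_all add: hom_simps\<close>)
qed

lemma homotopic_sym:
  assumes h: "homotopic M f g" and f: "f \<in> hom M z x" and x: "fibrant M x"
  shows "homotopic M g f"
proof -
  obtain I H i where A: "is_cylinder M z I" "inc0 I \<in> hom M z i" "inc1 I \<in> hom M z i"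
    "prj I \<in> hom M i z" "prj I \<in> We M" "prj I \<cdot> inc0 I = Id M z" "prj I \<cdot> inc1 I = Id M z"
    "H \<in> hom M i x" "H \<cdot> inc0 I = f" "H \<cdot> inc1 I = g" "g \<in> hom M z x"
    by (rule homotopicE[OF h f])
  show ?thesis using homotopic_via[OF x A(4,5,8,3,2)] A by simp
qed

lemma homotopic_precomp:
  assumes h: "homotopic M f g" and f: "f \<in> hom M z x" and x: "fibrant M x" and k: "k \<in> hom M y z"
  shows "homotopic M (f \<cdot> k) (g \<cdot> k)"
proof -
  obtain I H i where A: "is_cylinder M z I" "inc0 I \<in> hom M z i" "inc1 I \<in> hom M z i"
    "prj I \<in> hom M i z" "prj I \<in> We M" "prj I \<cdot> inc0 I = Id M z" "prj I \<cdot> inc1 I = Id M z"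
    "H \<in> hom M i x" "H \<cdot> inc0 I = f" "H \<cdot> inc1 I = g" "g \<in> hom M z x"
    by (rule homotopicE[OF h f])
  have "prj I \<cdot> (inc0 I \<cdot> k) = prj I \<cdot> (inc1 I \<cdot> k)"
    using comp_reduce[OF A(6) A(2,4) k] comp_reduce[OF A(7) A(3,4) k] by simp
  from homotopic_via[OF x A(4,5,8) comp_in_hom[OF k A(2)] comp_in_hom[OF k A(3)] this]
  show ?thesis using comp_reduce[OF A(9) A(2,8) k] comp_reduce[OF A(10) A(3,8) k] by simp
qed

lemma homotopic_postcomp:
  assumes h: "homotopic M f g" and f: "f \<in> hom M z x" and k: "k \<in> hom M x y"
  shows "homotopic M (k \<cdot> f) (k \<cdot> g)"
proof -
  obtain I H i where A: "is_cylinder M z I" "inc0 I \<in> hom M z i" "inc1 I \<in> hom M z i"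
    "prj I \<in> hom M i z" "prj I \<in> We M" "prj I \<cdot> inc0 I = Id M z" "prj I \<cdot> inc1 I = Id M z"
    "H \<in> hom M i x" "H \<cdot> inc0 I = f" "H \<cdot> inc1 I = g" "g \<in> hom M z x"
    by (rule homotopicE[OF h f])
  show ?thesis
    by (rule homotopicI[OF A(1,2) comp_in_hom[OF A(8) k]]) (use A(1-3,8-10) k in \<open>auto simp: hom_def\<close>)
qed

text \<open>The two homotopies agree on a common end, and filling is applied to the union of their
  cylinders.\<close>

lemma homotopic_trans:
  assumes fg: "homotopic M f g" and gh: "homotopic M g h" and f: "f \<in> hom M z x"
    and z: "cofibrant M z" and x: "fibrant M x"
  shows "homotopic M f h"
proof -
  obtain I H i where A: "is_cylinder M z I" "inc0 I \<in> hom M z i" "inc1 I \<in> hom M z i"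
    "prj I \<in> hom M i z" "prj I \<in> We M" "prj I \<cdot> inc0 I = Id M z" "prj I \<cdot> inc1 I = Id M z"
    "H \<in> hom M i x" "H \<cdot> inc0 I = f" "H \<cdot> inc1 I = g" "g \<in> hom M z x"
    by (rule homotopicE[OF fg f])
  obtain J K k where B: "is_cylinder M z J" "inc0 J \<in> hom M z k" "inc1 J \<in> hom M z k"
    "prj J \<in> hom M k z" "prj J \<in> We M" "prj J \<cdot> inc0 J = Id M z" "prj J \<cdot> inc1 J = Id M z"
    "K \<in> hom M k x" "K \<cdot> inc0 J = g" "K \<cdot> inc1 J = h" "h \<in> hom M z x"
    by (rule homotopicE[OF gh A(11)])
  have e: "prj I \<cdot> inc1 I = prj J \<cdot> inc0 J" "H \<cdot> inc1 I = K \<cdot> inc0 J" using A B by simp_all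
  obtain w i0 i1 t F where G: "i0 \<in> hom M i w" "i1 \<in> hom M k w" "i0 \<cdot> inc1 I = i1 \<cdot> inc0 J"
    "t \<in> hom M w z" "t \<in> We M" "t \<cdot> i0 = prj I" "t \<cdot> i1 = prj J"
    "F \<in> hom M w x" "F \<cdot> i0 = H" "F \<cdot> i1 = K" "is_pushout M (inc0 J) (inc1 I) i1 i0"
    by (rule glue[OF A(4,5) B(2) cylinder_inclusion_Cof[OF B(1) z] cylinder_inclusion_We[OF B(1)]
        A(3) B(4) e(1) A(8) B(8) e(2)])
  have "t \<cdot> (i0 \<cdot> inc0 I) = t \<cdot> (i1 \<cdot> inc1 J)"
    using comp_reduce[OF G(6) G(1,4) A(2)] comp_reduce[OF G(7) G(2,4) B(3)] A B by simp
  from homotopic_via[OF x G(4,5,8) comp_in_hom[OF A(2) G(1)] comp_in_hom[OF B(3) G(2)] this]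
  show ?thesis
    using comp_reduce[OF G(9) G(1,8) A(2)] comp_reduce[OF G(10) G(2,8) B(3)] A B by simp
qed

text \<open>Filling is applied to two copies of \<open>C\<close> glued along \<open>D\<close>; the fold map is a weak equivalence.\<close>

lemma homotopic_if_agree_on_tCof:
  assumes d: "d \<in> hom M D C" "d \<in> Cof M" "d \<in> We M" and h: "h \<in> hom M C Y" "h' \<in> hom M C Y" "h \<cdot> d = h' \<cdot> d"
    and Y: "fibrant M Y"
  shows "homotopic M h h'"
proof -
  have C: "C \<in> Ob M" using h hom_Ob by blast
  obtain w i0 i1 t F where G: "i0 \<in> hom M C w" "i1 \<in> hom M C w" "i0 \<cdot> d = i1 \<cdot> d"
    "t \<in> hom M w C" "t \<in> We M" "t \<cdot> i0 = Id M C" "t \<cdot> i1 = Id M C"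
    "F \<in> hom M w Y" "F \<cdot> i0 = h" "F \<cdot> i1 = h'" "is_pushout M d d i1 i0"
    by (rule glue[OF id_in_hom[OF C] Id_We[OF C] d d(1) id_in_hom[OF C] refl h])
  show ?thesis using homotopic_via[OF Y G(4,5,8,1,2)] G by simp
qed

section \<open>Weak equivalences and homotopy classes of maps\<close>

text \<open>Ken Brown's factorization: \<open>w\<close> is the composite of a trivial cofibration with a retraction,
  which reduces statements about weak equivalences to statements about trivial cofibrations.\<close>

lemma mapping_cylinder:
  assumes w: "w \<in> hom M D X" "w \<in> We M" and X: "cofibrant M X"
  obtains C d s p where "d \<in> hom M D C" "d \<in> Cof M" "d \<in> We M" "s \<in> hom M X C"
    "p \<in> hom M C X" "p \<in> We M" "p \<cdot> d = w" "p \<cdot> s = Id M X"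
proof -
  have Ob: "D \<in> Ob M" "X \<in> Ob M" using w hom_Ob by blast+
  obtain a b where co: "is_coproduct M D X a b" using ex_coproduct[OF Ob] by blast
  obtain c where c: "a \<in> hom M D c" "b \<in> hom M X c" using coproduct_hom[OF co] by blast
  obtain n where n: "n \<in> hom M c X" "n \<cdot> a = w" "n \<cdot> b = Id M X"
    using coproduct_universal[OF co c(1) w(1) id_in_hom[OF Ob(2)]] by blast
  obtain C m p where mp: "m \<in> hom M c C" "p \<in> hom M C X" "n = p \<cdot> m" "m \<in> Cof M" "p \<in> Fib M \<inter> We M"
    using factor_Cof_tFib[OF n(1)] by blast
  have h: "m \<cdot> a \<in> hom M D C" "m \<cdot> b \<in> hom M X C" using c mp by (auto intro: comp_in_hom)
  have e: "p \<cdot> (m \<cdot> a) = w" "p \<cdot> (m \<cdot> b) = Id M X"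
    using comp_reduce[OF mp(3)[symmetric] mp(1,2)] c n by auto
  have "m \<cdot> a \<in> Cof M" using Cof_comp coproduct_inclusion_Cof[OF co X c(1)] c mp by blast
  moreover have "m \<cdot> a \<in> We M" using We_right[OF h(1) mp(2)] mp e w by auto
  ultimately show thesis using that h mp e by blast
qed

text \<open>Extend \<open>f\<close> to the mapping cylinder and restrict the extension to \<open>X\<close>; filling along \<open>p\<close> compares
  the two maps \<open>s \<cdot> w\<close> and \<open>d\<close> from \<open>D\<close> to the mapping cylinder.\<close>

lemma extend_along_We:
  assumes w: "w \<in> hom M D X" "w \<in> We M" and X: "cofibrant M X"
    and Y: "fibrant M Y" and f: "f \<in> hom M D Y"
  obtains f' where "f' \<in> hom M X Y" "homotopic M (f' \<cdot> w) f"
proof -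
  obtain C d s p where C: "d \<in> hom M D C" "d \<in> Cof M" "d \<in> We M" "s \<in> hom M X C"
    "p \<in> hom M C X" "p \<in> We M" "p \<cdot> d = w" "p \<cdot> s = Id M X"
    by (rule mapping_cylinder[OF w X])
  obtain h where h: "h \<in> hom M C Y" "h \<cdot> d = f" using fibrant_extend[OF Y C(1-3) f] by blast
  have "p \<cdot> (s \<cdot> w) = p \<cdot> d" using comp_reduce[OF C(8) C(4,5) w(1)] C w by (simp add: hom_simps)
  from homotopic_via[OF Y C(5,6) h(1) comp_in_hom[OF w(1) C(4)] C(1) this]
  show thesis using that[of "h \<cdot> s"] h C w by (simp add: hom_def)
qed

text \<open>Filling is applied to two copies of the mapping cylinder \<open>C\<close> joined by a cylinder of \<open>D\<close>, on
  which \<open>f\<close>, the given homotopy and \<open>f'\<close> form a single map.\<close>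

lemma homotopic_cancel_We_right:
  assumes w: "w \<in> hom M D X" "w \<in> We M" and D: "cofibrant M D" and X: "cofibrant M X"
    and Y: "fibrant M Y" and f: "f \<in> hom M X Y" "f' \<in> hom M X Y" and h: "homotopic M (f \<cdot> w) (f' \<cdot> w)"
  shows "homotopic M f f'"
proof -
  obtain C d s p where C: "d \<in> hom M D C" "d \<in> Cof M" "d \<in> We M" "s \<in> hom M X C"
    "p \<in> hom M C X" "p \<in> We M" "p \<cdot> d = w" "p \<cdot> s = Id M X"
    by (rule mapping_cylinder[OF w X])
  obtain I H i where A: "is_cylinder M D I" "inc0 I \<in> hom M D i" "inc1 I \<in> hom M D i"
    "prj I \<in> hom M i D" "prj I \<in> We M" "prj I \<cdot> inc0 I = Id M D" "prj I \<cdot> inc1 I = Id M D"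
    "H \<in> hom M i Y" "H \<cdot> inc0 I = f \<cdot> w" "H \<cdot> inc1 I = f' \<cdot> w"
    "f' \<cdot> w \<in> hom M D Y"
    by (rule homotopicE[OF h comp_in_hom[OF w(1) f(1)]])
  have wp: "w \<cdot> prj I \<in> hom M i X" using A w by (auto intro: comp_in_hom)
  have wi: "(w \<cdot> prj I) \<cdot> inc0 I = w" "(w \<cdot> prj I) \<cdot> inc1 I = w"
    using A(2-4,6,7) w by (auto simp: hom_def)
  have fp: "f \<cdot> p \<in> hom M C Y" "f' \<cdot> p \<in> hom M C Y" using f C by (auto intro: comp_in_hom)
  have fpd: "(f \<cdot> p) \<cdot> d = f \<cdot> w" "(f' \<cdot> p) \<cdot> d = f' \<cdot> w" using f C by (auto simp: hom_def)
  have e0: "p \<cdot> d = (w \<cdot> prj I) \<cdot> inc0 I" "(f \<cdot> p) \<cdot> d = H \<cdot> inc0 I" using wi C(7) fpd A(9) by simp_all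
  obtain v i0 i1 t F where G: "i0 \<in> hom M C v" "i1 \<in> hom M i v" "i0 \<cdot> d = i1 \<cdot> inc0 I"
    "t \<in> hom M v X" "t \<in> We M" "t \<cdot> i0 = p" "t \<cdot> i1 = w \<cdot> prj I"
    "F \<in> hom M v Y" "F \<cdot> i0 = f \<cdot> p" "F \<cdot> i1 = H" "is_pushout M (inc0 I) d i1 i0"
    by (rule glue[OF C(5,6) A(2) cylinder_inclusion_Cof[OF A(1) D] cylinder_inclusion_We[OF A(1)]
        C(1) wp e0(1) fp(1) A(8) e0(2)])
  have e1: "i1 \<cdot> inc1 I \<in> hom M D v" using G A by (auto intro: comp_in_hom)
  have e2: "t \<cdot> (i1 \<cdot> inc1 I) = p \<cdot> d"
    using comp_reduce[OF G(7) G(2,4) A(3)] wi C(7) by simp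
  have e3: "F \<cdot> (i1 \<cdot> inc1 I) = (f' \<cdot> p) \<cdot> d"
    using comp_reduce[OF G(10) G(2,8) A(3)] fpd A(10) by simp
  obtain v' j0 j1 t' F' where G': "j0 \<in> hom M v v'" "j1 \<in> hom M C v'" "j0 \<cdot> (i1 \<cdot> inc1 I) = j1 \<cdot> d"
    "t' \<in> hom M v' X" "t' \<in> We M" "t' \<cdot> j0 = t" "t' \<cdot> j1 = p"
    "F' \<in> hom M v' Y" "F' \<cdot> j0 = F" "F' \<cdot> j1 = f' \<cdot> p"
    "is_pushout M d (i1 \<cdot> inc1 I) j1 j0"
    by (rule glue[OF G(4,5) C(1-3) e1 C(5) e2 G(8) fp(2) e3])
  have "t' \<cdot> (j0 \<cdot> (i0 \<cdot> s)) = t' \<cdot> (j1 \<cdot> s)"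
    using comp_reduce[OF G'(6) G'(1,4) comp_in_hom[OF C(4) G(1)]] comp_reduce[OF G'(7) G'(2,4) C(4)]
      comp_reduce[OF G(6) G(1,4) C(4)] by simp
  from homotopic_via[OF Y G'(4,5,8) comp_in_hom[OF comp_in_hom[OF C(4) G(1)] G'(1)] comp_in_hom[OF C(4) G'(2)] this]
  have "homotopic M ((f \<cdot> p) \<cdot> s) ((f' \<cdot> p) \<cdot> s)"
    using comp_reduce[OF G'(9) G'(1,8) comp_in_hom[OF C(4) G(1)]] comp_reduce[OF G'(10) G'(2,8) C(4)]
      comp_reduce[OF G(9) G(1,8) C(4)] by simp
  then show ?thesis using f C(4,5,8) by (simp add: hom_def)
qed

text \<open>Lift \<open>f\<close> along the trivial fibration \<open>p\<close> of a factorization \<open>w = p \<cdot> j\<close>, then apply a retraction of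
  the trivial cofibration \<open>j\<close>, which is also a homotopy inverse of \<open>j\<close>.\<close>

lemma lift_along_We:
  assumes w: "w \<in> hom M F P" "w \<in> We M" and F: "fibrant M F" and P: "fibrant M P"
    and A: "cofibrant M A" and f: "f \<in> hom M A P"
  obtains f' where "f' \<in> hom M A F" "homotopic M (w \<cdot> f') f"
proof -
  obtain C j p where jp: "j \<in> hom M F C" "p \<in> hom M C P" "w = p \<cdot> j" "j \<in> Cof M \<inter> We M" "p \<in> Fib M"
    using factor_tCof_Fib[OF w(1)] by blast
  have pW: "p \<in> We M" using We_left[OF jp(1,2)] jp w by auto
  have C: "fibrant M C" using fibrant_total[OF jp(2,5) P] .
  have FO: "F \<in> Ob M" using w hom_Ob by blast
  obtain r where r: "r \<in> hom M C F" "r \<cdot> j = Id M F"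
    using fibrant_extend[OF F jp(1) _ _ id_in_hom[OF FO]] jp by blast
  obtain f1 where f1: "f1 \<in> hom M A C" "p \<cdot> f1 = f" using cofibrant_lift[OF A jp(2,5) pW f] by blast
  have CO: "C \<in> Ob M" using jp hom_Ob by blast
  have "homotopic M (j \<cdot> r) (Id M C)"
    by (rule homotopic_if_agree_on_tCof[OF jp(1) _ _ comp_in_hom[OF r(1) jp(1)] id_in_hom[OF CO] _ C])
      (use jp(1,4) r CO in \<open>auto simp: hom_def\<close>)
  then have "homotopic M ((j \<cdot> r) \<cdot> f1) (Id M C \<cdot> f1)"
    using homotopic_precomp[OF _ comp_in_hom[OF r(1) jp(1)] C f1(1)] by blast
  then have "homotopic M (p \<cdot> ((j \<cdot> r) \<cdot> f1)) (p \<cdot> (Id M C \<cdot> f1))"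
    using homotopic_postcomp[OF _ comp_in_hom[OF f1(1) comp_in_hom[OF r(1) jp(1)]] jp(2)] by blast
  then show thesis using that[of "r \<cdot> f1"] jp(1-3) r f1 by (simp add: hom_def)
qed

text \<open>With \<open>w = p \<cdot> j\<close> as before, the homotopy lifts along the trivial fibration \<open>p\<close> with ends \<open>j \<cdot> f\<close> and
  \<open>j \<cdot> f'\<close>, and a retraction of \<open>j\<close> carries it back.\<close>

lemma homotopic_cancel_We_left:
  assumes w: "w \<in> hom M F P" "w \<in> We M" and F: "fibrant M F"
    and f: "f \<in> hom M A F" "f' \<in> hom M A F" and h: "homotopic M (w \<cdot> f) (w \<cdot> f')"
  shows "homotopic M f f'"
proof -
  obtain C j p where jp: "j \<in> hom M F C" "p \<in> hom M C P" "w = p \<cdot> j" "j \<in> Cof M \<inter> We M" "p \<in> Fib M"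
    using factor_tCof_Fib[OF w(1)] by blast
  have pW: "p \<in> We M" using We_left[OF jp(1,2)] jp w by auto
  have FO: "F \<in> Ob M" using w hom_Ob by blast
  obtain r where r: "r \<in> hom M C F" "r \<cdot> j = Id M F"
    using fibrant_extend[OF F jp(1) _ _ id_in_hom[OF FO]] jp by blast
  obtain I H i where A: "is_cylinder M A I" "inc0 I \<in> hom M A i" "inc1 I \<in> hom M A i"
    "prj I \<in> hom M i A" "prj I \<in> We M" "prj I \<cdot> inc0 I = Id M A" "prj I \<cdot> inc1 I = Id M A"
    "H \<in> hom M i P" "H \<cdot> inc0 I = w \<cdot> f" "H \<cdot> inc1 I = w \<cdot> f'" "w \<cdot> f' \<in> hom M A P"
    by (rule homotopicE[OF h comp_in_hom[OF f(1) w(1)]])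
  have "p \<cdot> (j \<cdot> f) = H \<cdot> inc0 I" "p \<cdot> (j \<cdot> f') = H \<cdot> inc1 I"
    using A(9,10) jp(1-3) f by (auto simp: hom_def)
  then obtain l where l: "l \<in> hom M i C" "l \<cdot> inc0 I = j \<cdot> f" "l \<cdot> inc1 I = j \<cdot> f'"
    using cylinder_lift[OF A(1,2) jp(2,5) pW comp_in_hom[OF f(1) jp(1)] comp_in_hom[OF f(2) jp(1)] A(8)]
    by blast
  show ?thesis
    by (rule homotopicI[OF A(1,2) comp_in_hom[OF l(1) r(1)]])
      (use l A(2,3) r comp_reduce[OF r(2) jp(1) r(1)] f in \<open>auto simp: hom_simps comp_id_left\<close>)
qed

section \<open>Double mapping cylinders\<close>

lemma dmc_hom:
  assumes "is_double_mapping_cylinder M f g I a c b"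
    and "f \<in> hom M z x" "g \<in> hom M z y" "inc0 I \<in> hom M z i"
  obtains D where "a \<in> hom M x D" "c \<in> hom M i D" "b \<in> hom M y D" "a \<cdot> f = c \<cdot> inc0 I" "b \<cdot> g = c \<cdot> inc1 I"
  using assms unfolding is_double_mapping_cylinder_def dmc_cocone_def hom_def by auto

lemma dmc_coconeI:
  "f \<in> hom M z x \<Longrightarrow> g \<in> hom M z y \<Longrightarrow> inc0 I \<in> hom M z i \<Longrightarrow> inc1 I \<in> hom M z i \<Longrightarrow>
    a \<in> hom M x t \<Longrightarrow> c \<in> hom M i t \<Longrightarrow> b \<in> hom M y t \<Longrightarrow>
    a \<cdot> f = c \<cdot> inc0 I \<Longrightarrow> b \<cdot> g = c \<cdot> inc1 I \<Longrightarrow> dmc_cocone M f g I a c b"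
  unfolding dmc_cocone_def by blast

lemma dmc_unique_map:
  assumes dmc: "is_double_mapping_cylinder M f g I a c b"
    and D: "a \<in> hom M x D"
    and K: "dmc_cocone M f g I a' c' b'" and a': "a' \<in> hom M x' t"
  shows "\<exists>!u. u \<in> hom M D t \<and> u \<cdot> a = a' \<and> u \<cdot> c = c' \<and> u \<cdot> b = b'"
proof -
  have "Cod M a = D" "Cod M a' = t" using D a' by (auto simp: hom_simps)
  then show ?thesis using dmc K unfolding is_double_mapping_cylinder_def by blast
qed

lemma dmc_universal:
  assumes dmc: "is_double_mapping_cylinder M f g I a c b"
    and H: "f \<in> hom M z x" "g \<in> hom M z y" "inc0 I \<in> hom M z i" "inc1 I \<in> hom M z i"
    and D: "a \<in> hom M x D"
    and u: "a' \<in> hom M x t" "c' \<in> hom M i t" "b' \<in> hom M y t" "a' \<cdot> f = c' \<cdot> inc0 I" "b' \<cdot> g = c' \<cdot> inc1 I"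
  obtains m where "m \<in> hom M D t" "m \<cdot> a = a'" "m \<cdot> c = c'" "m \<cdot> b = b'"
  using dmc_unique_map[OF dmc D dmc_coconeI[OF H u] u(1)] that by blast

lemma dmc_joint_epi:
  assumes dmc: "is_double_mapping_cylinder M f g I a c b"
    and H: "f \<in> hom M z x" "g \<in> hom M z y" "inc0 I \<in> hom M z i" "inc1 I \<in> hom M z i"
    and D: "a \<in> hom M x D"
    and m: "m \<in> hom M D t" "m' \<in> hom M D t" "m \<cdot> a = m' \<cdot> a" "m \<cdot> c = m' \<cdot> c" "m \<cdot> b = m' \<cdot> b"
  shows "m = m'"
proof -
  obtain D' where "a \<in> hom M x D'" "c \<in> hom M i D'" "b \<in> hom M y D'"
    and E: "a \<cdot> f = c \<cdot> inc0 I" "b \<cdot> g = c \<cdot> inc1 I"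
    by (rule dmc_hom[OF dmc H(1-3)])
  then have h: "c \<in> hom M i D" "b \<in> hom M y D" using D by (auto simp: hom_def)
  have "(m \<cdot> a) \<cdot> f = (m \<cdot> c) \<cdot> inc0 I" "(m \<cdot> b) \<cdot> g = (m \<cdot> c) \<cdot> inc1 I"
    using E h D m(1) H by (simp_all add: hom_simps)
  from dmc_unique_map[OF dmc D dmc_coconeI[OF H comp_in_hom[OF D m(1)] comp_in_hom[OF h(1) m(1)]
      comp_in_hom[OF h(2) m(1)] this] comp_in_hom[OF D m(1)]]
  show ?thesis using m by metis
qed

text \<open>The double mapping cylinder is built by two pushouts, attaching first one end of the
  cylinder to \<open>x\<close> and then the other end to \<open>y\<close>.\<close>

lemma ex_dmc:
  assumes H: "f \<in> hom M z x" "g \<in> hom M z y" "inc0 I \<in> hom M z i" "inc1 I \<in> hom M z i"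
  obtains a c b where "is_double_mapping_cylinder M f g I a c b"
proof -
  obtain h k where po1: "is_pushout M f (inc0 I) h k" using ex_pushout H by blast
  obtain D1 where h: "h \<in> hom M x D1" "k \<in> hom M i D1" "h \<cdot> f = k \<cdot> inc0 I"
    using pushout_hom[OF po1] H by (metis hom_simps(2,3))
  have k1: "k \<cdot> inc1 I \<in> hom M z D1" using h H by (auto intro: comp_in_hom)
  obtain b l where po2: "is_pushout M g (k \<cdot> inc1 I) b l" using ex_pushout[OF H(2) k1] by blast
  obtain D where l: "b \<in> hom M y D" "l \<in> hom M D1 D" "b \<cdot> g = l \<cdot> (k \<cdot> inc1 I)"
    using pushout_hom[OF po2] H k1 by (metis hom_simps(2,3))
  have lh: "l \<cdot> h \<in> hom M x D" "l \<cdot> k \<in> hom M i D" using l h by (auto intro: comp_in_hom)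
  have cone: "dmc_cocone M f g I (l \<cdot> h) (l \<cdot> k) b"
    by (rule dmc_coconeI[OF H lh l(1)]) (use l h H in \<open>auto simp: hom_def\<close>)
  have "\<exists>!u. u \<in> hom M (Cod M (l \<cdot> h)) (Cod M a') \<and> u \<cdot> (l \<cdot> h) = a' \<and> u \<cdot> (l \<cdot> k) = c' \<and> u \<cdot> b = b'"
    if K: "dmc_cocone M f g I a' c' b'" for a' c' b'
  proof -
    obtain t where t: "a' \<in> hom M x t" "c' \<in> hom M i t" "b' \<in> hom M y t"
      "a' \<cdot> f = c' \<cdot> inc0 I" "b' \<cdot> g = c' \<cdot> inc1 I"
      using K H unfolding dmc_cocone_def by (auto simp: hom_def)
    have c: "Cod M (l \<cdot> h) = D" "Cod M a' = t" using lh t by (auto simp: hom_def)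
    obtain m1 where m1: "m1 \<in> hom M D1 t" "m1 \<cdot> h = a'" "m1 \<cdot> k = c'"
      using pushout_universal[OF po1 H(1,3) h(1) t(1,2,4)] by blast
    have "b' \<cdot> g = m1 \<cdot> (k \<cdot> inc1 I)" using comp_reduce[OF m1(3) h(2) m1(1) H(4)] t(5) by simp
    then obtain m where m: "m \<in> hom M D t" "m \<cdot> b = b'" "m \<cdot> l = m1"
      using pushout_universal[OF po2 H(2) k1 l(1) t(3) m1(1)] by blast
    have ex: "m \<cdot> (l \<cdot> h) = a'" "m \<cdot> (l \<cdot> k) = c'"
      using comp_reduce[OF m(3) l(2) m(1)] h m1 by auto
    have "m' = m" if m': "m' \<in> hom M D t" "m' \<cdot> (l \<cdot> h) = a'" "m' \<cdot> (l \<cdot> k) = c'" "m' \<cdot> b = b'" for m'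
    proof -
      have "m' \<cdot> l = m1"
        by (rule pushout_joint_epi[OF po1 h(1) comp_in_hom[OF l(2) m'(1)] m1(1)])
          (use m' l h m1 in \<open>auto simp: hom_simps\<close>)
      then show ?thesis using pushout_joint_epi[OF po2 l(1) m'(1) m(1)] m m' by simp
    qed
    then show ?thesis unfolding c using m ex by blast
  qed
  then show thesis using that cone unfolding is_double_mapping_cylinder_def by blast
qed

text \<open>The pair \<open>x \<rightarrow> D \<leftarrow> y\<close> is jointly a cofibration, being a cobase change of the two ends of the
  cylinder.\<close>

lemma dmc_lift:
  assumes dmc: "is_double_mapping_cylinder M f g I a c b"
    and I: "is_cylinder M z I"
    and H: "f \<in> hom M z x" "g \<in> hom M z y"
    and D: "a \<in> hom M x D" "b \<in> hom M y D"
    and p: "p \<in> hom M e d" "p \<in> Fib M" "p \<in> We M"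
    and u: "ua \<in> hom M x e" "ub \<in> hom M y e" and v: "v \<in> hom M D d"
    and eq: "p \<cdot> ua = v \<cdot> a" "p \<cdot> ub = v \<cdot> b"
  obtains l where "l \<in> hom M D e" "l \<cdot> a = ua" "l \<cdot> b = ub" "p \<cdot> l = v"
proof -
  obtain i where i: "inc0 I \<in> hom M z i" "inc1 I \<in> hom M z i" using cylinder_hom[OF I] by metis
  obtain D' where "a \<in> hom M x D'" "c \<in> hom M i D'" "b \<in> hom M y D'"
    and E: "a \<cdot> f = c \<cdot> inc0 I" "b \<cdot> g = c \<cdot> inc1 I"
    by (rule dmc_hom[OF dmc H i(1)])
  then have c: "c \<in> hom M i D" using D by (auto simp: hom_def)
  have "p \<cdot> (ua \<cdot> f) = (v \<cdot> c) \<cdot> inc0 I" "p \<cdot> (ub \<cdot> g) = (v \<cdot> c) \<cdot> inc1 I"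
    using comp_cong_left[OF eq(1) u(1) p(1) D(1) v H(1)] comp_cong_left[OF eq(2) u(2) p(1) D(2) v H(2)] E c v i
    by (simp_all add: hom_simps)
  then obtain n where n: "n \<in> hom M i e" "n \<cdot> inc0 I = ua \<cdot> f" "n \<cdot> inc1 I = ub \<cdot> g" "p \<cdot> n = v \<cdot> c"
    using cylinder_lift[OF I i(1) p comp_in_hom[OF H(1) u(1)] comp_in_hom[OF H(2) u(2)] comp_in_hom[OF c v]]
    by metis
  obtain l where l: "l \<in> hom M D e" "l \<cdot> a = ua" "l \<cdot> c = n" "l \<cdot> b = ub"
    by (rule dmc_universal[OF dmc H i D(1) u(1) n(1) u(2) n(2,3)[symmetric]])
  have "p \<cdot> l = v"
    by (rule dmc_joint_epi[OF dmc H i D(1) comp_in_hom[OF l(1) p(1)] v])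
      (use l p D c n eq in \<open>auto simp: hom_def\<close>)
  then show thesis using that l by blast
qed

lemma dmc_cofibrant:
  assumes dmc: "is_double_mapping_cylinder M f g I a c b"
    and I: "is_cylinder M z I"
    and H: "f \<in> hom M z x" "g \<in> hom M z y"
    and D: "a \<in> hom M x D" "b \<in> hom M y D"
    and x: "cofibrant M x" and y: "cofibrant M y"
  shows "cofibrant M D"
proof (rule cofibrantI)
  show "D \<in> Ob M" using D hom_Ob by blast
  fix p e d v assume p: "p \<in> hom M e d" "p \<in> Fib M" "p \<in> We M" and v: "v \<in> hom M D d"
  obtain ua where ua: "ua \<in> hom M x e" "p \<cdot> ua = v \<cdot> a"
    using cofibrant_lift[OF x p comp_in_hom[OF D(1) v]] by blast
  obtain ub where ub: "ub \<in> hom M y e" "p \<cdot> ub = v \<cdot> b"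
    using cofibrant_lift[OF y p comp_in_hom[OF D(2) v]] by blast
  show "\<exists>l\<in>hom M D e. p \<cdot> l = v"
    using dmc_lift[OF dmc I H D p ua(1) ub(1) v ua(2) ub(2)] by blast
qed

text \<open>The homotopy extension property of \<open>x \<rightarrow> D \<leftarrow> y\<close>. The union of \<open>D\<close> with cylinders on \<open>x\<close> and \<open>y\<close> is
  weakly equivalent to \<open>D\<close>; after replacing it by a trivial fibration over \<open>D\<close>, a section is chosen
  that sends \<open>x\<close> and \<open>y\<close> to the far ends of the cylinders.\<close>

lemma dmc_homotopy_extension:
  assumes dmc: "is_double_mapping_cylinder M f g I a c b"
    and I: "is_cylinder M z I"
    and H: "f \<in> hom M z x" "g \<in> hom M z y"
    and D: "a \<in> hom M x D" "b \<in> hom M y D"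
    and x: "cofibrant M x" and y: "cofibrant M y" and Y: "fibrant M Y"
    and phi: "\<phi> \<in> hom M D Y" and ha: "homotopic M (\<phi> \<cdot> a) u" and hb: "homotopic M (\<phi> \<cdot> b) v"
  obtains \<psi> where "\<psi> \<in> hom M D Y" "homotopic M \<psi> \<phi>" "\<psi> \<cdot> a = u" "\<psi> \<cdot> b = v"
proof -
  have DO: "D \<in> Ob M" using D hom_Ob by blast
  obtain J K i where A: "is_cylinder M x J" "inc0 J \<in> hom M x i" "inc1 J \<in> hom M x i"
    "prj J \<in> hom M i x" "prj J \<in> We M" "prj J \<cdot> inc0 J = Id M x" "prj J \<cdot> inc1 J = Id M x"
    "K \<in> hom M i Y" "K \<cdot> inc0 J = \<phi> \<cdot> a" "K \<cdot> inc1 J = u" "u \<in> hom M x Y"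
    by (rule homotopicE[OF ha comp_in_hom[OF D(1) phi]])
  obtain J' K' i' where B: "is_cylinder M y J'" "inc0 J' \<in> hom M y i'" "inc1 J' \<in> hom M y i'"
    "prj J' \<in> hom M i' y" "prj J' \<in> We M" "prj J' \<cdot> inc0 J' = Id M y" "prj J' \<cdot> inc1 J' = Id M y"
    "K' \<in> hom M i' Y" "K' \<cdot> inc0 J' = \<phi> \<cdot> b" "K' \<cdot> inc1 J' = v" "v \<in> hom M y Y"
    by (rule homotopicE[OF hb comp_in_hom[OF D(2) phi]])
  have e1: "Id M D \<cdot> a = (a \<cdot> prj J) \<cdot> inc0 J" using A(2-6) D by (simp add: hom_def)
  obtain w i0 i1 t F where G: "i0 \<in> hom M D w" "i1 \<in> hom M i w" "i0 \<cdot> a = i1 \<cdot> inc0 J"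
    "t \<in> hom M w D" "t \<in> We M" "t \<cdot> i0 = Id M D" "t \<cdot> i1 = a \<cdot> prj J"
    "F \<in> hom M w Y" "F \<cdot> i0 = \<phi>" "F \<cdot> i1 = K" "is_pushout M (inc0 J) a i1 i0"
    by (rule glue[OF id_in_hom[OF DO] Id_We[OF DO] A(2) cylinder_inclusion_Cof[OF A(1) x]
          cylinder_inclusion_We[OF A(1)] D(1) comp_in_hom[OF A(4) D(1)] e1 phi A(8) A(9)[symmetric]])
  have e2: "t \<cdot> (i0 \<cdot> b) = (b \<cdot> prj J') \<cdot> inc0 J'"
    using comp_reduce[OF G(6) G(1,4) D(2)] B(2,4,6) D by (simp add: hom_def)
  have e3: "F \<cdot> (i0 \<cdot> b) = K' \<cdot> inc0 J'" using comp_reduce[OF G(9) G(1,8) D(2)] B(9) by simp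
  obtain w' j0 j1 t' F' where G': "j0 \<in> hom M w w'" "j1 \<in> hom M i' w'" "j0 \<cdot> (i0 \<cdot> b) = j1 \<cdot> inc0 J'"
    "t' \<in> hom M w' D" "t' \<in> We M" "t' \<cdot> j0 = t" "t' \<cdot> j1 = b \<cdot> prj J'"
    "F' \<in> hom M w' Y" "F' \<cdot> j0 = F" "F' \<cdot> j1 = K'" "is_pushout M (inc0 J') (i0 \<cdot> b) j1 j0"
    by (rule glue[OF G(4,5) B(2) cylinder_inclusion_Cof[OF B(1) y]
          cylinder_inclusion_We[OF B(1)] comp_in_hom[OF D(2) G(1)] comp_in_hom[OF B(4) D(2)] e2 G(8) B(8) e3])
  obtain w2 n p F2 where E: "n \<in> hom M w' w2" "p \<in> hom M w2 D" "p \<in> Fib M" "p \<in> We M" "p \<cdot> n = t'"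
    "F2 \<in> hom M w2 Y" "F2 \<cdot> n = F'"
    by (rule We_extension[OF Y G'(4,5,8)])
  define ua ub s where "ua = n \<cdot> (j0 \<cdot> (i1 \<cdot> inc1 J))" and "ub = n \<cdot> (j1 \<cdot> inc1 J')" and "s = n \<cdot> (j0 \<cdot> i0)"
  have h: "j0 \<cdot> (i1 \<cdot> inc1 J) \<in> hom M x w'" "j1 \<cdot> inc1 J' \<in> hom M y w'" "j0 \<cdot> i0 \<in> hom M D w'"
    "i1 \<cdot> inc1 J \<in> hom M x w"
    using A(3) B(3) G(1,2) G'(1,2) by (auto intro!: comp_in_hom)
  have hu: "ua \<in> hom M x w2" "ub \<in> hom M y w2" "s \<in> hom M D w2"
    unfolding ua_def ub_def s_def using h(1-3)[THEN comp_in_hom, OF E(1)] by auto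
  have "p \<cdot> ua = Id M D \<cdot> a"
    unfolding ua_def
    using comp_reduce[OF E(5,1,2) h(1)] comp_reduce[OF G'(6,1,4) h(4)] comp_reduce[OF G(7,2,4) A(3)] A(3,4,7) D(1)
    by (simp add: hom_simps)
  moreover have "p \<cdot> ub = Id M D \<cdot> b"
    unfolding ub_def
    using comp_reduce[OF E(5,1,2) h(2)] comp_reduce[OF G'(7,2,4) B(3)] B(3,4,7) D(2)
    by (simp add: hom_simps)
  ultimately obtain l where l: "l \<in> hom M D w2" "l \<cdot> a = ua" "l \<cdot> b = ub" "p \<cdot> l = Id M D"
    using dmc_lift[OF dmc I H D E(2-4) hu(1,2) id_in_hom[OF DO]] by metis
  have "p \<cdot> s = Id M D"
    unfolding s_def using comp_reduce[OF E(5,1,2) h(3)] comp_reduce[OF G'(6,1,4) G(1)] G(6) by simp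
  then have "homotopic M (F2 \<cdot> l) (F2 \<cdot> s)"
    using homotopic_via[OF Y E(2,4,6) l(1) hu(3)] l by simp
  moreover have "F2 \<cdot> s = \<phi>"
    unfolding s_def using comp_reduce[OF E(7,1,6) h(3)] comp_reduce[OF G'(9,1,8) G(1)] G(9) by simp
  moreover have "(F2 \<cdot> l) \<cdot> a = u"
    using comp_reduce[OF E(7,1,6) h(1)] comp_reduce[OF G'(9,1,8) h(4)] comp_reduce[OF G(10,2,8) A(3)]
      A(10) l D(1) E(6) ua_def by (simp add: hom_simps)
  moreover have "(F2 \<cdot> l) \<cdot> b = v"
    using comp_reduce[OF E(7,1,6) h(2)] comp_reduce[OF G'(10,2,8) B(3)] B(10) l D(2) E(6) ub_def
    by (simp add: hom_simps)
  ultimately show thesis using that comp_in_hom[OF l(1) E(6)] by simp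
qed

section \<open>A Ganea stage with lifting of homotopies\<close>

text \<open>The data are those of a Ganea stage: \<open>P\<close> is the strict pullback of the fibration \<open>p\<close>, which
  replaces \<open>\<iota> = p \<cdot> i0\<close>, and \<open>g\<close>; \<open>F\<close> is a cofibrant replacement of \<open>P\<close>; and \<open>c\<close> is the homotopy in the
  next stage \<open>G'\<close> between the two composites from \<open>F\<close>, lying over \<open>p \<cdot> L\<close>.

  The homotopy \<open>K\<close> lifts to a homotopy \<open>L1\<close> in \<open>E\<close> by the covering property of \<open>p\<close>. Its end and \<open>\<mu>\<close>
  together form a map to \<open>P\<close>, hence a map \<open>\<zeta>: Z \<rightarrow> F\<close>. Since \<open>i0\<close> is a trivial cofibration, \<open>\<alpha>\<close> extends
  over \<open>Y\<close> to \<open>\<epsilon>: E \<rightarrow> G'\<close>, so \<open>\<epsilon> \<cdot> L1\<close> lies over \<open>K\<close> and starts at \<open>\<alpha> \<cdot> \<rho>\<close>; but it ends at \<open>\<epsilon> \<cdot> x \<cdot> q \<cdot> \<zeta>\<close>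
  instead of \<open>\<gamma> \<cdot> \<mu> = \<gamma> \<cdot> y \<cdot> q \<cdot> \<zeta>\<close>. Both \<open>\<epsilon> \<cdot> L\<close> and \<open>c\<close> start at \<open>\<alpha> \<cdot> o1\<close> and lie over \<open>p \<cdot> L\<close>, so their ends
  are connected by a homotopy over a constant one, and appending its restriction along \<open>\<zeta>\<close> repairs
  the end without changing the image in \<open>Y\<close>.\<close>

lemma lift_homotopy_to_stage:
  assumes F: "cofibrant M F" and Z: "cofibrant M Z"
    and i0: "i0 \<in> hom M A E" "i0 \<in> Cof M" "i0 \<in> We M" and p: "p \<in> hom M E Y" "p \<in> Fib M"
    and g: "g \<in> hom M G Y" and pb: "is_pullback M x y p g" and x: "x \<in> hom M P E"
    and q: "q \<in> hom M F P" "q \<in> Fib M" "q \<in> We M"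
    and I: "is_cylinder M F I" "inc0 I \<in> hom M F i" and o1: "o1 \<in> hom M F A"
    and L: "L \<in> hom M i E" "L \<cdot> inc0 I = i0 \<cdot> o1" "L \<cdot> inc1 I = x \<cdot> q"
    and g': "g' \<in> hom M G' Y" "g' \<in> Fib M"
    and al: "\<alpha> \<in> hom M A G'" "g' \<cdot> \<alpha> = p \<cdot> i0" and ga: "\<gamma> \<in> hom M G G'"
    and c: "c \<in> hom M i G'" "c \<cdot> inc0 I = \<alpha> \<cdot> o1" "c \<cdot> inc1 I = \<gamma> \<cdot> (y \<cdot> q)" "g' \<cdot> c = p \<cdot> L"
    and J: "is_cylinder M Z J" "inc0 J \<in> hom M Z k"
    and rh: "\<rho> \<in> hom M Z A" and mu: "\<mu> \<in> hom M Z G"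
    and K: "K \<in> hom M k Y" "K \<cdot> inc0 J = (p \<cdot> i0) \<cdot> \<rho>" "K \<cdot> inc1 J = g \<cdot> \<mu>"
  shows "\<exists>l \<in> hom M k G'. l \<cdot> inc0 J = \<alpha> \<cdot> \<rho> \<and> l \<cdot> inc1 J = \<gamma> \<cdot> \<mu> \<and> g' \<cdot> l = K"
proof -
  have y: "y \<in> hom M P G" "p \<cdot> x = g \<cdot> y" using pullback_hom[OF pb p(1) g] x by (auto simp: hom_def)
  have I': "inc1 I \<in> hom M F i" "prj I \<in> hom M i F" "prj I \<cdot> inc0 I = Id M F" "prj I \<cdot> inc1 I = Id M F"
    using cylinder_hom[OF I(1)] I(2) by (metis hom_simps(3))+
  have J': "inc1 J \<in> hom M Z k" "prj J \<in> hom M k Z" "prj J \<cdot> inc0 J = Id M Z" "prj J \<cdot> inc1 J = Id M Z"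
    using cylinder_hom[OF J(1)] J(2) by (metis hom_simps(3))+
  have kO: "k \<in> Ob M" "i \<in> Ob M" using J I hom_Ob by blast+
  obtain \<epsilon> where ep: "\<epsilon> \<in> hom M E G'" "\<epsilon> \<cdot> i0 = \<alpha>" "g' \<cdot> \<epsilon> = p"
    using lift[OF i0(1) g'(1) al(1) p(1) al(2) i0(2) g'(2)] i0(3) by blast
  have pi: "p \<cdot> (i0 \<cdot> \<rho>) = K \<cdot> inc0 J" using K rh p i0 by (simp add: hom_simps)
  obtain L1 where L1: "L1 \<in> hom M k E" "L1 \<cdot> inc0 J = i0 \<cdot> \<rho>" "p \<cdot> L1 = K"
    using lift[OF J(2) p(1) comp_in_hom[OF rh i0(1)] K(1) pi] cylinder_inclusion_Cof[OF J(1) Z] p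
      cylinder_inclusion_We[OF J(1)] by blast
  have e1: "L1 \<cdot> inc1 J \<in> hom M Z E" using L1 J' by (auto intro: comp_in_hom)
  have pe1: "p \<cdot> (L1 \<cdot> inc1 J) = g \<cdot> \<mu>" using comp_reduce[OF L1(3,1) p(1) J'(1)] K by simp
  obtain m where m: "m \<in> hom M Z P" "x \<cdot> m = L1 \<cdot> inc1 J" "y \<cdot> m = \<mu>"
    by (rule pullback_universal[OF pb x p(1) g e1 mu pe1])
  obtain \<zeta> where ze: "\<zeta> \<in> hom M Z F" "q \<cdot> \<zeta> = m" by (rule cofibrant_lift[OF Z q m(1)])
  \<comment> \<open>The homotopy from \<open>\<epsilon> \<cdot> x \<cdot> q \<cdot> \<zeta>\<close> to \<open>\<gamma> \<cdot> \<mu>\<close> over a constant one.\<close>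
  obtain H1 where H1: "H1 \<in> hom M k G'" "H1 \<cdot> inc0 J = \<epsilon> \<cdot> (L1 \<cdot> inc1 J)" "H1 \<cdot> inc1 J = \<gamma> \<cdot> \<mu>"
    "g' \<cdot> H1 = K \<cdot> (inc1 J \<cdot> prj J)"
  proof -
    have eL: "\<epsilon> \<cdot> L \<in> hom M i G'" using ep L by (auto intro: comp_in_hom)
    have pL: "p \<cdot> L \<in> hom M i Y" using p L by (auto intro: comp_in_hom)
    have a1: "(\<epsilon> \<cdot> L) \<cdot> inc0 I = c \<cdot> inc0 I"
      using ep L c I(2) comp_reduce[OF ep(2) i0(1) ep(1) o1] by (simp add: hom_simps)
    have a2: "g' \<cdot> (\<epsilon> \<cdot> L) = (p \<cdot> L) \<cdot> Id M i" "g' \<cdot> c = (p \<cdot> L) \<cdot> Id M i"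
      using comp_reduce[OF ep(3,1) g'(1) L(1)] comp_id_right[OF pL] c by auto
    \<comment> \<open>The two homotopies \<open>\<epsilon> \<cdot> L\<close> and \<open>c\<close>, glued at their common start.\<close>
    obtain w j0 j1 t W where G: "j0 \<in> hom M i w" "j1 \<in> hom M i w"
      "t \<in> hom M w i" "t \<in> We M" "t \<cdot> j0 = Id M i" "t \<cdot> j1 = Id M i"
      "W \<in> hom M w G'" "W \<cdot> j0 = \<epsilon> \<cdot> L" "W \<cdot> j1 = c" "g' \<cdot> W = (p \<cdot> L) \<cdot> t"
      by (rule glue_over[OF id_in_hom[OF kO(2)] Id_We[OF kO(2)] I(2) cylinder_inclusion_Cof[OF I(1) F]
            cylinder_inclusion_We[OF I(1)] I(2) id_in_hom[OF kO(2)] refl eL c(1) a1 g'(1) pL a2])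
    have iz: "inc1 I \<cdot> \<zeta> \<in> hom M Z i" using I' ze by (auto intro: comp_in_hom)
    have v: "(inc1 I \<cdot> \<zeta>) \<cdot> prj J \<in> hom M k i" by (rule comp_in_hom[OF J'(2) iz])
    have b: "t \<cdot> (j0 \<cdot> (inc1 I \<cdot> \<zeta>)) = ((inc1 I \<cdot> \<zeta>) \<cdot> prj J) \<cdot> inc0 J"
      "t \<cdot> (j1 \<cdot> (inc1 I \<cdot> \<zeta>)) = ((inc1 I \<cdot> \<zeta>) \<cdot> prj J) \<cdot> inc1 J"
      using comp_reduce[OF G(5,1,3) iz] comp_reduce[OF G(6,2,3) iz] I'(1) J(2) J' ze(1)
      by (simp_all add: hom_simps)
    obtain H where H: "H \<in> hom M k G'" "H \<cdot> inc0 J = W \<cdot> (j0 \<cdot> (inc1 I \<cdot> \<zeta>))"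
      "H \<cdot> inc1 J = W \<cdot> (j1 \<cdot> (inc1 I \<cdot> \<zeta>))" "g' \<cdot> H = (p \<cdot> L) \<cdot> ((inc1 I \<cdot> \<zeta>) \<cdot> prj J)"
      by (rule fill_over[OF G(3,4,7) g' pL G(10) J comp_in_hom[OF iz G(1)] comp_in_hom[OF iz G(2)] v b])
    have Lz: "L \<cdot> (inc1 I \<cdot> \<zeta>) = L1 \<cdot> inc1 J"
      using comp_reduce[OF L(3) I'(1) L(1) ze(1)] ze m x q by (simp add: hom_simps)
    show thesis
    proof (rule that[OF H(1)])
      show "H \<cdot> inc0 J = \<epsilon> \<cdot> (L1 \<cdot> inc1 J)"
        using H comp_reduce[OF G(8,1,7) iz] Lz ep(1) L(1) iz by (simp add: hom_simps)
      have "c \<cdot> (inc1 I \<cdot> \<zeta>) = \<gamma> \<cdot> \<mu>"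
        using comp_reduce[OF c(3) I'(1) c(1) ze(1)] ze m(1,3) ga y(1) q(1) by (simp add: hom_simps)
      then show "H \<cdot> inc1 J = \<gamma> \<cdot> \<mu>"
        using H comp_reduce[OF G(9,2,7) iz] by simp
      have "(p \<cdot> L) \<cdot> ((inc1 I \<cdot> \<zeta>) \<cdot> prj J) = p \<cdot> ((L \<cdot> (inc1 I \<cdot> \<zeta>)) \<cdot> prj J)"
        using p(1) L(1) I'(1) ze(1) J'(2) by (simp add: hom_simps)
      also have "\<dots> = (p \<cdot> L1) \<cdot> (inc1 J \<cdot> prj J)"
        unfolding Lz using p(1) L1(1) J'(1,2) by (simp add: hom_simps)
      finally show "g' \<cdot> H = K \<cdot> (inc1 J \<cdot> prj J)" using H(4) L1(3) by simp
    qed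
  qed
  have eL: "\<epsilon> \<cdot> L1 \<in> hom M k G'" using ep L1 by (auto intro: comp_in_hom)
  have jj: "inc1 J \<cdot> prj J \<in> hom M k k" using J' by (auto intro: comp_in_hom)
  have a1: "Id M k \<cdot> inc1 J = (inc1 J \<cdot> prj J) \<cdot> inc0 J" using J' J(2) by (simp add: hom_simps)
  have a2: "(\<epsilon> \<cdot> L1) \<cdot> inc1 J = H1 \<cdot> inc0 J" using H1(2) ep L1 J' by (simp add: hom_simps)
  have a3: "g' \<cdot> (\<epsilon> \<cdot> L1) = K \<cdot> Id M k"
    using comp_reduce[OF ep(3,1) g'(1) L1(1)] L1(3) comp_id_right[OF K(1)] by simp
  \<comment> \<open>Append \<open>H1\<close> to \<open>\<epsilon> \<cdot> L1\<close>; the second cylinder is collapsed onto the end of the first.\<close>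
  obtain w j0 j1 t W where G: "j0 \<in> hom M k w" "j1 \<in> hom M k w"
    "t \<in> hom M w k" "t \<in> We M" "t \<cdot> j0 = Id M k" "t \<cdot> j1 = inc1 J \<cdot> prj J"
    "W \<in> hom M w G'" "W \<cdot> j0 = \<epsilon> \<cdot> L1" "W \<cdot> j1 = H1" "g' \<cdot> W = K \<cdot> t"
    by (rule glue_over[OF id_in_hom[OF kO(1)] Id_We[OF kO(1)] J(2) cylinder_inclusion_Cof[OF J(1) Z]
          cylinder_inclusion_We[OF J(1)] J'(1) jj a1 eL H1(1) a2 g'(1) K(1) a3 H1(4)])
  have b: "t \<cdot> (j0 \<cdot> inc0 J) = Id M k \<cdot> inc0 J" "t \<cdot> (j1 \<cdot> inc1 J) = Id M k \<cdot> inc1 J"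
    using comp_reduce[OF G(5,1,3) J(2)] comp_reduce[OF G(6,2,3) J'(1)] J' by (simp_all add: hom_simps)
  obtain H where H: "H \<in> hom M k G'" "H \<cdot> inc0 J = W \<cdot> (j0 \<cdot> inc0 J)"
      "H \<cdot> inc1 J = W \<cdot> (j1 \<cdot> inc1 J)" "g' \<cdot> H = K \<cdot> Id M k"
    by (rule fill_over[OF G(3,4,7) g' K(1) G(10) J comp_in_hom[OF J(2) G(1)] comp_in_hom[OF J'(1) G(2)]
          id_in_hom[OF kO(1)] b])
  have "H \<cdot> inc0 J = \<alpha> \<cdot> \<rho>"
    using H comp_reduce[OF G(8,1,7) J(2)] L1 ep(1) J(2) comp_reduce[OF ep(2) i0(1) ep(1) rh]
    by (simp add: hom_simps)
  moreover have "H \<cdot> inc1 J = \<gamma> \<cdot> \<mu>" using H comp_reduce[OF G(9,2,7) J'(1)] H1 by simp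
  ultimately show ?thesis using H comp_id_right[OF K(1)] by auto
qed

lemma homotopy_commutative_squareI:
  assumes "cofibrant_fibrant M z" "cofibrant_fibrant M a" "cofibrant_fibrant M b" "cofibrant_fibrant M d"
    and "out1 S \<in> hom M z a" "out2 S \<in> hom M z b" "in1 S \<in> hom M a d" "in2 S \<in> hom M b d"
    and "is_cylinder M z (cyl S)" "inc0 (cyl S) \<in> hom M z i" "htpy S \<in> hom M i d"
    and "htpy S \<cdot> inc0 (cyl S) = in1 S \<cdot> out1 S" "htpy S \<cdot> inc1 (cyl S) = in2 S \<cdot> out2 S"
  shows "homotopy_commutative_square M S"
proof -
  have "in1 S \<cdot> out1 S \<in> hom M z d" "in2 S \<cdot> out2 S \<in> hom M z d" "Cod M (inc0 (cyl S)) = i"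
    using assms by (auto intro: comp_in_hom simp: hom_simps)
  then have "is_homotopy M (cyl S) (in1 S \<cdot> out1 S) (in2 S \<cdot> out2 S) (htpy S)"
    unfolding is_homotopy_def using assms(9,11-13) by auto
  then show ?thesis unfolding homotopy_commutative_square_def using assms(1-8) by blast
qed

lemma homotopy_commutative_squareE:
  assumes "homotopy_commutative_square M S"
  obtains z a b d i where "cofibrant_fibrant M z" "cofibrant_fibrant M a" "cofibrant_fibrant M b"
    "cofibrant_fibrant M d" "out1 S \<in> hom M z a" "out2 S \<in> hom M z b" "in1 S \<in> hom M a d" "in2 S \<in> hom M b d"
    "is_cylinder M z (cyl S)" "inc0 (cyl S) \<in> hom M z i" "inc1 (cyl S) \<in> hom M z i" "htpy S \<in> hom M i d"
    "htpy S \<cdot> inc0 (cyl S) = in1 S \<cdot> out1 S" "htpy S \<cdot> inc1 (cyl S) = in2 S \<cdot> out2 S"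
proof -
  obtain z a b d where A: "cofibrant_fibrant M z" "cofibrant_fibrant M a" "cofibrant_fibrant M b"
    "cofibrant_fibrant M d" "out1 S \<in> hom M z a" "out2 S \<in> hom M z b" "in1 S \<in> hom M a d" "in2 S \<in> hom M b d"
    and H: "is_homotopy M (cyl S) (in1 S \<cdot> out1 S) (in2 S \<cdot> out2 S) (htpy S)"
    using assms unfolding homotopy_commutative_square_def by blast
  obtain z' x where B: "in1 S \<cdot> out1 S \<in> hom M z' x" "is_cylinder M z' (cyl S)"
    "htpy S \<in> hom M (Cod M (inc0 (cyl S))) x"
    "htpy S \<cdot> inc0 (cyl S) = in1 S \<cdot> out1 S" "htpy S \<cdot> inc1 (cyl S) = in2 S \<cdot> out2 S"
    using H unfolding is_homotopy_def by blast
  have [simp]: "z' = z" "x = d" using B(1) comp_in_hom[OF A(5,7)] by (auto simp: hom_def)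
  obtain i where i: "inc0 (cyl S) \<in> hom M z i" "inc1 (cyl S) \<in> hom M z i"
    using cylinder_hom[OF B(2)] by auto
  have "Cod M (inc0 (cyl S)) = i" using i by (simp add: hom_simps)
  then show thesis using that[OF A _ i] B by simp
qed

lemma homotopy_commutative_square_homotopic:
  assumes "homotopy_commutative_square M S"
  shows "homotopic M (in1 S \<cdot> out1 S) (in2 S \<cdot> out2 S)"
  using assms unfolding homotopy_commutative_square_def homotopic_def by blast

text \<open>The next stage is a factorization of the map from the double mapping cylinder to \<open>Y\<close> into a
  trivial cofibration followed by a fibration, which makes \<open>g'\<close> a whisker map that is strictly
  compatible with \<open>\<iota>\<close> and \<open>g\<close>. The last conclusion is a strict form of the universal property of
  the homotopy pullback, transported to \<open>G'\<close>; it holds because \<open>g'\<close> is a fibration.\<close>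

lemma ex_fibrant_ganea_stage:
  assumes A: "cofibrant_fibrant M A" and Y: "cofibrant_fibrant M Y" and G: "cofibrant_fibrant M G"
    and iota: "\<iota> \<in> hom M A Y" and g: "g \<in> hom M G Y"
  obtains S T g' G' where "is_homotopy_pullback M S" "in1 S = \<iota>" "in2 S = g"
    "is_homotopy_pushout M T" "is_whisker_map M T S g'" "cofibrant_fibrant M G'"
    "in1 T \<in> hom M A G'" "in2 T \<in> hom M G G'" "g' \<in> hom M G' Y" "g' \<cdot> in1 T = \<iota>" "g' \<cdot> in2 T = g"
    "\<And>Z J k \<rho> \<mu> K. cofibrant M Z \<Longrightarrow> is_cylinder M Z J \<Longrightarrow> inc0 J \<in> hom M Z k \<Longrightarrow>
       \<rho> \<in> hom M Z A \<Longrightarrow> \<mu> \<in> hom M Z G \<Longrightarrow> K \<in> hom M k Y \<Longrightarrow> K \<cdot> inc0 J = \<iota> \<cdot> \<rho> \<Longrightarrow> K \<cdot> inc1 J = g \<cdot> \<mu> \<Longrightarrow>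
       \<exists>l \<in> hom M k G'. l \<cdot> inc0 J = in1 T \<cdot> \<rho> \<and> l \<cdot> inc1 J = in2 T \<cdot> \<mu> \<and> g' \<cdot> l = K"
proof -
  note cf = cofibrant_fibrantD
  obtain E i0 p where ip: "i0 \<in> hom M A E" "p \<in> hom M E Y" "\<iota> = p \<cdot> i0" "i0 \<in> Cof M \<inter> We M" "p \<in> Fib M"
    using factor_tCof_Fib[OF iota] by blast
  then have i0: "i0 \<in> Cof M" "i0 \<in> We M" by auto
  have E: "fibrant M E" using fibrant_total[OF ip(2,5) cf(2)[OF Y]] .
  have EO: "E \<in> Ob M" "A \<in> Ob M" using hom_Ob[OF ip(1)] by auto
  \<comment> \<open>A retraction \<open>r\<close> of \<open>i0\<close> turns the projection \<open>P \<rightarrow> E\<close> into the first side of \<open>S\<close>;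
    the price is the homotopy \<open>L\<close>.\<close>
  obtain r where r: "r \<in> hom M E A" "r \<cdot> i0 = Id M A"
    using fibrant_extend[OF cf(2)[OF A] ip(1) i0 id_in_hom[OF EO(2)]] by blast
  obtain x y where pb: "is_pullback M x y p g" using ex_pullback[OF ip(2) g] by blast
  obtain P where xy: "x \<in> hom M P E" "y \<in> hom M P G" "p \<cdot> x = g \<cdot> y" using pullback_hom[OF pb ip(2) g] by blast
  have P: "fibrant M P" by (rule pullback_fibrant[OF pb ip(2,5) g cf(2)[OF G] xy(1)])
  obtain F q where q: "q \<in> hom M F P" "q \<in> Fib M" "q \<in> We M" and F: "cofibrant M F"
    using cofibrant_replacement[OF fibrant_Ob[OF P]] by blast
  have FF: "cofibrant_fibrant M F" using F fibrant_total[OF q(1,2) P] by (simp add: cofibrant_fibrant_def)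
  have xq: "x \<cdot> q \<in> hom M F E" and yq: "y \<cdot> q \<in> hom M F G" using xy q by (auto intro: comp_in_hom)
  define o1 where "o1 = r \<cdot> (x \<cdot> q)"
  have o1: "o1 \<in> hom M F A" unfolding o1_def using xq r by (auto intro: comp_in_hom)
  have "homotopic M (i0 \<cdot> r) (Id M E)"
    by (rule homotopic_if_agree_on_tCof[OF ip(1) i0 comp_in_hom[OF r(1) ip(1)] id_in_hom[OF EO(1)] _ E])
      (use ip(1) r EO in \<open>simp add: hom_simps\<close>)
  from homotopic_precomp[OF this comp_in_hom[OF r(1) ip(1)] E xq]
  have h: "homotopic M (i0 \<cdot> o1) (x \<cdot> q)" using ip(1) r(1) xq by (simp add: o1_def hom_simps comp_id_left)
  obtain I L i where I: "is_cylinder M F I" "inc0 I \<in> hom M F i" "inc1 I \<in> hom M F i"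
    "prj I \<in> hom M i F" "prj I \<in> We M" "prj I \<cdot> inc0 I = Id M F" "prj I \<cdot> inc1 I = Id M F"
    "L \<in> hom M i E" "L \<cdot> inc0 I = i0 \<cdot> o1" "L \<cdot> inc1 I = x \<cdot> q" "x \<cdot> q \<in> hom M F E"
    by (rule homotopicE[OF h comp_in_hom[OF o1 ip(1)]])
  define S where "S = \<lparr>out1 = o1, out2 = y \<cdot> q, in1 = \<iota>, in2 = g, cyl = I, htpy = p \<cdot> L\<rparr>"
  have pL: "p \<cdot> L \<in> hom M i Y" using ip I by (auto intro: comp_in_hom)
  have pL0: "(p \<cdot> L) \<cdot> inc0 I = \<iota> \<cdot> o1" "(p \<cdot> L) \<cdot> inc1 I = g \<cdot> (y \<cdot> q)"
    using I(2,3,8-10) ip(1-3) o1 g xy(1,2) q(1) comp_cong_left[OF xy(3,1) ip(2) xy(2) g q(1)]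
    by (simp_all add: hom_simps)
  have Sq: "homotopy_commutative_square M S"
    by (rule homotopy_commutative_squareI[OF FF A G Y, where i = i])
      (use o1 yq iota g I(1,2) pL pL0 in \<open>simp_all add: S_def\<close>)
  have "i0 \<in> hom M (Dom M (in1 S)) E" "p \<in> hom M E (Cod M (in1 S))" "L \<in> hom M (Cod M (inc0 (cyl S))) E"
    "q \<in> hom M (Dom M (out1 S)) (Dom M x)"
    using ip(1,2) iota I(2,8) q(1) o1 xy(1) by (auto simp: S_def hom_simps)
  moreover have "in1 S = p \<cdot> i0" "L \<cdot> inc0 (cyl S) = i0 \<cdot> out1 S" "p \<cdot> L = htpy S" "is_pullback M x y p (in2 S)"
    "x \<cdot> q = L \<cdot> inc1 (cyl S)" "y \<cdot> q = out2 S"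
    using ip(3) I(9,10) pb by (simp_all add: S_def)
  ultimately have hpb: "is_homotopy_pullback M S"
    unfolding is_homotopy_pullback_def using Sq ip(5) i0(2) q(3) by blast
  obtain a cc b where dmc: "is_double_mapping_cylinder M o1 (y \<cdot> q) I a cc b"
    by (rule ex_dmc[OF o1 yq I(2,3)])
  obtain D where D: "a \<in> hom M A D" "cc \<in> hom M i D" "b \<in> hom M G D"
    "a \<cdot> o1 = cc \<cdot> inc0 I" "b \<cdot> (y \<cdot> q) = cc \<cdot> inc1 I"
    by (rule dmc_hom[OF dmc o1 yq I(2)])
  have Dc: "cofibrant M D" by (rule dmc_cofibrant[OF dmc I(1) o1 yq D(1,3) cf(1)[OF A] cf(1)[OF G]])
  obtain \<kappa> where ka: "\<kappa> \<in> hom M D Y" "\<kappa> \<cdot> a = \<iota>" "\<kappa> \<cdot> cc = p \<cdot> L" "\<kappa> \<cdot> b = g"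
    by (rule dmc_universal[OF dmc o1 yq I(2,3) D(1) iota pL g pL0[symmetric]])
  obtain G' j g' where jg: "j \<in> hom M D G'" "g' \<in> hom M G' Y" "\<kappa> = g' \<cdot> j" "j \<in> Cof M \<inter> We M" "g' \<in> Fib M"
    using factor_tCof_Fib[OF ka(1)] by blast
  have GG: "cofibrant_fibrant M G'"
    using cofibrant_target[OF jg(1) _ Dc] fibrant_total[OF jg(2,5) cf(2)[OF Y]] jg(4)
    by (simp add: cofibrant_fibrant_def)
  define T where "T = \<lparr>out1 = o1, out2 = y \<cdot> q, in1 = j \<cdot> a, in2 = j \<cdot> b, cyl = I, htpy = j \<cdot> cc\<rparr>"
  have jh: "j \<cdot> a \<in> hom M A G'" "j \<cdot> b \<in> hom M G G'" "j \<cdot> cc \<in> hom M i G'"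
    using jg D by (auto intro: comp_in_hom)
  have j0: "(j \<cdot> cc) \<cdot> inc0 I = (j \<cdot> a) \<cdot> o1" "(j \<cdot> cc) \<cdot> inc1 I = (j \<cdot> b) \<cdot> (y \<cdot> q)"
    using D jg(1) I(2,3) o1 yq by (simp_all add: hom_simps)
  have Tq: "homotopy_commutative_square M T"
    by (rule homotopy_commutative_squareI[OF FF A G GG, where i = i])
      (use o1 yq jh j0 I(1,2) in \<open>simp_all add: T_def\<close>)
  have indT: "induced_on_dmc M a cc b T j" and indS: "induced_on_dmc M a cc b S \<kappa>"
    using jg(1) jh D(1) ka iota by (auto simp: induced_on_dmc_def T_def S_def hom_simps)
  have hpo: "is_homotopy_pushout M T"
    unfolding is_homotopy_pushout_def using Tq indT dmc jg(4) by (auto simp: T_def)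
  have "homotopic M (g' \<cdot> j) \<kappa>" using homotopic_refl[OF ka(1)] jg(3) by simp
  moreover have "g' \<in> hom M (Cod M (in1 T)) (Cod M (in1 S))"
    using jh(1) jg(2) iota by (simp add: T_def S_def hom_simps)
  moreover have "is_double_mapping_cylinder M (out1 T) (out2 T) (cyl T) a cc b"
    "out1 S = out1 T" "out2 S = out2 T" "cyl S = cyl T"
    using dmc by (simp_all add: S_def T_def)
  ultimately have wh: "is_whisker_map M T S g'"
    unfolding is_whisker_map_def using indT indS by blast
  have g'T: "g' \<cdot> (j \<cdot> a) = \<iota>" "g' \<cdot> (j \<cdot> b) = g" "g' \<cdot> (j \<cdot> cc) = p \<cdot> L"
    using comp_reduce[OF jg(3)[symmetric] jg(1,2)] D ka by auto
  have "\<exists>l \<in> hom M k G'. l \<cdot> inc0 J = (j \<cdot> a) \<cdot> \<rho> \<and> l \<cdot> inc1 J = (j \<cdot> b) \<cdot> \<mu> \<and> g' \<cdot> l = K"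
    if Z: "cofibrant M Z" and J: "is_cylinder M Z J" "inc0 J \<in> hom M Z k"
      and rm: "\<rho> \<in> hom M Z A" "\<mu> \<in> hom M Z G" and K: "K \<in> hom M k Y" "K \<cdot> inc0 J = \<iota> \<cdot> \<rho>" "K \<cdot> inc1 J = g \<cdot> \<mu>"
    for Z J k \<rho> \<mu> K
    by (rule lift_homotopy_to_stage[OF F Z ip(1) i0 ip(2,5) g pb xy(1) q I(1,2) o1 I(8-10) jg(2,5) jh(1) _ jh(2)
          jh(3) j0 g'T(3) J rm K(1) _ K(3)])
      (use g'T(1) ip(3) K(2) in simp_all)
  then show thesis
    by (intro that[OF hpb _ _ hpo wh GG _ _ jg(2)]) (use jh g'T in \<open>simp_all add: S_def T_def\<close>)
qed

section \<open>Chains of homotopy pushouts map to Ganea constructions\<close>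

text \<open>One step of the comparison: \<open>\<theta>\<close> is a map over \<open>Y\<close> up to homotopy from \<open>X\<close> to a Ganea stage \<open>G\<close>,
  and it extends to the homotopy pushout \<open>X'\<close> with values in the next stage \<open>G'\<close>. The last
  hypothesis is the lifting property of a stage provided by \<open>ex_fibrant_ganea_stage\<close>.\<close>

lemma extend_over_homotopy_pushout:
  assumes hp: "homotopy_pushout M \<rho> \<tau> h \<chi>" and rho: "\<rho> \<in> hom M z A" and tau: "\<tau> \<in> hom M z X"
    and ch: "\<chi> \<in> hom M X X'" and h: "h \<in> hom M A X'"
    and Y: "fibrant M Y" and G': "fibrant M G'" and iota: "\<iota> \<in> hom M A Y" and g: "g \<in> hom M G Y"
    and phi: "\<phi> \<in> hom M X' Y" "homotopic M (\<phi> \<cdot> h) \<iota>"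
    and la: "\<theta> \<in> hom M X G" "homotopic M (g \<cdot> \<theta>) (\<phi> \<cdot> \<chi>)"
    and al: "\<alpha> \<in> hom M A G'" and ga: "\<gamma> \<in> hom M G G'" and g': "g' \<in> hom M G' Y" "g' \<cdot> \<alpha> = \<iota>" "g' \<cdot> \<gamma> = g"
    and LIFT: "\<And>Z J k \<rho> \<mu> K. cofibrant M Z \<Longrightarrow> is_cylinder M Z J \<Longrightarrow> inc0 J \<in> hom M Z k \<Longrightarrow>
       \<rho> \<in> hom M Z A \<Longrightarrow> \<mu> \<in> hom M Z G \<Longrightarrow> K \<in> hom M k Y \<Longrightarrow> K \<cdot> inc0 J = \<iota> \<cdot> \<rho> \<Longrightarrow> K \<cdot> inc1 J = g \<cdot> \<mu> \<Longrightarrow>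
       \<exists>l \<in> hom M k G'. l \<cdot> inc0 J = \<alpha> \<cdot> \<rho> \<and> l \<cdot> inc1 J = \<gamma> \<cdot> \<mu> \<and> g' \<cdot> l = K"
  obtains \<theta>' where "\<theta>' \<in> hom M X' G'" "homotopic M (g' \<cdot> \<theta>') \<phi>" "homotopic M (\<theta>' \<cdot> h) \<alpha>"
proof -
  note cf = cofibrant_fibrantD
  obtain U where U: "out1 U = \<rho>" "out2 U = \<tau>" "in1 U = h" "in2 U = \<chi>" "is_homotopy_pushout M U"
    using hp unfolding homotopy_pushout_def by blast
  then obtain a c b w where sq: "homotopy_commutative_square M U"
    and dmc: "is_double_mapping_cylinder M \<rho> \<tau> (cyl U) a c b"
    and ind: "induced_on_dmc M a c b U w" and wW: "w \<in> We M"
    unfolding is_homotopy_pushout_def by auto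
  obtain z' A' X1 X'1 k where "cofibrant_fibrant M z'" "cofibrant_fibrant M A'" "cofibrant_fibrant M X1"
    "cofibrant_fibrant M X'1" "out1 U \<in> hom M z' A'" "out2 U \<in> hom M z' X1" "in1 U \<in> hom M A' X'1" "in2 U \<in> hom M X1 X'1"
    and J: "is_cylinder M z' (cyl U)" "inc0 (cyl U) \<in> hom M z' k" "inc1 (cyl U) \<in> hom M z' k"
    and "htpy U \<in> hom M k X'1"
    "htpy U \<cdot> inc0 (cyl U) = in1 U \<cdot> out1 U" "htpy U \<cdot> inc1 (cyl U) = in2 U \<cdot> out2 U"
    by (rule homotopy_commutative_squareE[OF sq])
  moreover from this have eq: "z' = z" "A' = A" "X1 = X" "X'1 = X'"
    using U rho tau ch by (auto simp: hom_def)
  ultimately have Ob: "cofibrant M z" "cofibrant M A" "cofibrant M X" "cofibrant M X'"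
    using cf by auto
  note J = J[unfolded eq(1)]
  obtain D where D: "a \<in> hom M A D" "c \<in> hom M k D" "b \<in> hom M X D"
    "a \<cdot> \<rho> = c \<cdot> inc0 (cyl U)" "b \<cdot> \<tau> = c \<cdot> inc1 (cyl U)"
    by (rule dmc_hom[OF dmc rho tau J(2)])
  have Dc: "cofibrant M D" by (rule dmc_cofibrant[OF dmc J(1) rho tau D(1,3) Ob(2,3)])
  have w: "w \<in> hom M D X'" "w \<cdot> a = h" "w \<cdot> b = \<chi>"
    using ind U D(1) h unfolding induced_on_dmc_def by (auto simp: hom_simps)
  have pw: "\<phi> \<cdot> w \<in> hom M D Y" using phi w by (auto intro: comp_in_hom)
  have pwa: "(\<phi> \<cdot> w) \<cdot> a = \<phi> \<cdot> h" "(\<phi> \<cdot> w) \<cdot> b = \<phi> \<cdot> \<chi>" using phi w D by (simp_all add: hom_simps)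
  have gl: "g \<cdot> \<theta> \<in> hom M X Y" using g la by (auto intro: comp_in_hom)
  \<comment> \<open>Deform \<open>\<phi>\<close> on the double mapping cylinder until it agrees strictly with \<open>\<iota>\<close>
    and \<open>g \<cdot> \<theta>\<close> on the ends.\<close>
  obtain \<psi> where ps: "\<psi> \<in> hom M D Y" "homotopic M \<psi> (\<phi> \<cdot> w)" "\<psi> \<cdot> a = \<iota>" "\<psi> \<cdot> b = g \<cdot> \<theta>"
    by (rule dmc_homotopy_extension[OF dmc J(1) rho tau D(1,3) Ob(2,3) Y pw, unfolded pwa,
          OF phi(2) homotopic_sym[OF la(2) gl Y]])
  have K: "(\<psi> \<cdot> c) \<cdot> inc0 (cyl U) = \<iota> \<cdot> \<rho>" "(\<psi> \<cdot> c) \<cdot> inc1 (cyl U) = g \<cdot> (\<theta> \<cdot> \<tau>)"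
    using comp_reduce[OF ps(3) D(1) ps(1) rho] comp_reduce[OF ps(4) D(3) ps(1) tau] D ps(1) J(2,3) g la(1) tau
    by (simp_all add: hom_simps)
  obtain l where l: "l \<in> hom M k G'" "l \<cdot> inc0 (cyl U) = \<alpha> \<cdot> \<rho>" "l \<cdot> inc1 (cyl U) = \<gamma> \<cdot> (\<theta> \<cdot> \<tau>)" "g' \<cdot> l = \<psi> \<cdot> c"
    using LIFT[OF Ob(1) J(1,2) rho comp_in_hom[OF tau la(1)] comp_in_hom[OF D(2) ps(1)] K] by blast
  have gal: "\<gamma> \<cdot> \<theta> \<in> hom M X G'" using ga la by (auto intro: comp_in_hom)
  have l1: "(\<gamma> \<cdot> \<theta>) \<cdot> \<tau> = l \<cdot> inc1 (cyl U)" using l ga la tau by (simp add: hom_simps)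
  obtain \<theta>1 where la1: "\<theta>1 \<in> hom M D G'" "\<theta>1 \<cdot> a = \<alpha>" "\<theta>1 \<cdot> c = l" "\<theta>1 \<cdot> b = \<gamma> \<cdot> \<theta>"
    by (rule dmc_universal[OF dmc rho tau J(2,3) D(1) al l(1) gal l(2)[symmetric] l1])
  have gla1: "g' \<cdot> \<theta>1 = \<psi>"
    by (rule dmc_joint_epi[OF dmc rho tau J(2,3) D(1) comp_in_hom[OF la1(1) g'(1)] ps(1)])
      (use la1 g' ps(1,3,4) D(1-3) l(4) comp_reduce[OF g'(3) ga g'(1) la(1)] in \<open>simp_all add: hom_simps\<close>)
  \<comment> \<open>Pass from the double mapping cylinder to the given homotopy pushout.\<close>
  obtain \<theta>' where la': "\<theta>' \<in> hom M X' G'" "homotopic M (\<theta>' \<cdot> w) \<theta>1"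
    by (rule extend_along_We[OF w(1) wW Ob(4) G' la1(1)])
  have lw: "\<theta>' \<cdot> w \<in> hom M D G'" and gl': "g' \<cdot> \<theta>' \<in> hom M X' Y" using la' w g' by (auto intro: comp_in_hom)
  have "homotopic M (g' \<cdot> (\<theta>' \<cdot> w)) \<psi>"
    using homotopic_postcomp[OF la'(2) lw g'(1)] gla1 by simp
  from homotopic_trans[OF this ps(2) comp_in_hom[OF lw g'(1)] Dc Y]
  have "homotopic M ((g' \<cdot> \<theta>') \<cdot> w) (\<phi> \<cdot> w)" using g'(1) la'(1) w(1) by (simp add: hom_simps)
  then have "homotopic M (g' \<cdot> \<theta>') \<phi>"
    by (rule homotopic_cancel_We_right[OF w(1) wW Dc Ob(4) Y gl' phi(1)])
  moreover have "homotopic M (\<theta>' \<cdot> h) \<alpha>"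
    using homotopic_precomp[OF la'(2) lw G' D(1)] la1(2) w la'(1) D(1) by (simp add: hom_simps)
  ultimately show thesis using that la'(1) by blast
qed

text \<open>The map \<open>\<phi>\<close> is general in the induction because the map to \<open>Y\<close> on an earlier \<open>X\<^sub>i\<close> is the
  composite of \<open>\<phi>\<close> with the maps of the chain. The Ganea construction is built along with the
  comparison maps and may depend on \<open>\<phi>\<close>.\<close>

lemma pushcat_chain_maps_to_ganea:
  assumes A: "cofibrant_fibrant M A" and Y: "cofibrant_fibrant M Y" and iota: "\<iota> \<in> hom M A Y"
    and X: "\<And>i. i \<le> n \<Longrightarrow> cofibrant_fibrant M (X i) \<and> j i \<in> hom M A (X i)"
    and j0: "has_homotopy_inverse M (j 0)"
    and chain: "\<And>i. i < n \<Longrightarrow> \<exists>z. \<exists>\<rho> \<in> hom M z A. \<exists>\<tau> \<in> hom M z (X i). \<exists>\<chi> \<in> hom M (X i) (X (Suc i)).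
        homotopy_pushout M \<rho> \<tau> (j (Suc i)) \<chi> \<and> homotopic M (\<chi> \<cdot> j i) (j (Suc i))"
    and phi: "\<phi> \<in> hom M (X n) Y" "homotopic M (\<phi> \<cdot> j n) \<iota>"
  shows "\<exists>g \<alpha> \<theta> G. ganea M \<iota> n g \<alpha> \<and> cofibrant_fibrant M G \<and> g \<in> hom M G Y \<and> \<theta> \<in> hom M (X n) G \<and>
    homotopic M (g \<cdot> \<theta>) \<phi> \<and> homotopic M (\<theta> \<cdot> j n) \<alpha>"
  using X chain phi
proof (induction n arbitrary: \<phi>)
  case 0
  note cf = cofibrant_fibrantD
  have X0: "cofibrant_fibrant M (X 0)" and j: "j 0 \<in> hom M A (X 0)" using 0(1) by auto
  obtain r where r: "r \<in> hom M (X 0) A" "homotopic M (r \<cdot> j 0) (Id M A)" "homotopic M (j 0 \<cdot> r) (Id M (X 0))"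
    using j0 j unfolding has_homotopy_inverse_def by (auto simp: hom_simps)
  have "homotopic M (\<iota> \<cdot> r) (\<phi> \<cdot> j 0 \<cdot> r)"
    using homotopic_sym[OF homotopic_precomp[OF 0(4) comp_in_hom[OF j 0(3)] cf(2)[OF Y] r(1)]
        comp_in_hom[OF r(1) comp_in_hom[OF j 0(3)]] cf(2)[OF Y]] r(1) j 0(3)
    by (simp add: hom_simps)
  moreover have "homotopic M (\<phi> \<cdot> (j 0 \<cdot> r)) \<phi>"
    using homotopic_postcomp[OF r(3) comp_in_hom[OF r(1) j] 0(3)] comp_id_right[OF 0(3)] by simp
  ultimately have "homotopic M (\<iota> \<cdot> r) \<phi>"
    using homotopic_trans[OF _ _ comp_in_hom[OF r(1) iota] cf(1)[OF X0] cf(2)[OF Y]] by blast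
  moreover have "ganea M \<iota> 0 \<iota> (Id M A)" using ganea_0[of M \<iota>] iota by (simp add: hom_simps)
  ultimately show ?case using A iota r by blast
next
  case (Suc n)
  note cf = cofibrant_fibrantD
  have Xn: "cofibrant_fibrant M (X n)" "j n \<in> hom M A (X n)" "cofibrant_fibrant M (X (Suc n))" "j (Suc n) \<in> hom M A (X (Suc n))"
    using Suc.prems(1) by auto
  obtain z \<rho> \<tau> \<chi> where C: "\<rho> \<in> hom M z A" "\<tau> \<in> hom M z (X n)" "\<chi> \<in> hom M (X n) (X (Suc n))"
    "homotopy_pushout M \<rho> \<tau> (j (Suc n)) \<chi>" "homotopic M (\<chi> \<cdot> j n) (j (Suc n))"
    using Suc.prems(2)[of n] by blast
  have pc: "\<phi> \<cdot> \<chi> \<in> hom M (X n) Y" using C Suc.prems(3) by (auto intro: comp_in_hom)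
  have "homotopic M (\<phi> \<cdot> (\<chi> \<cdot> j n)) (\<phi> \<cdot> j (Suc n))"
    by (rule homotopic_postcomp[OF C(5) comp_in_hom[OF Xn(2) C(3)] Suc.prems(3)])
  then have "homotopic M (\<phi> \<cdot> (\<chi> \<cdot> j n)) \<iota>"
    using homotopic_trans[OF _ Suc.prems(4) comp_in_hom[OF comp_in_hom[OF Xn(2) C(3)] Suc.prems(3)]
        cf(1)[OF A] cf(2)[OF Y]] by blast
  then have pcj: "homotopic M ((\<phi> \<cdot> \<chi>) \<cdot> j n) \<iota>" using C(3) Xn(2) Suc.prems(3) by (simp add: hom_simps)
  have "\<exists>g \<alpha> \<theta> G. ganea M \<iota> n g \<alpha> \<and> cofibrant_fibrant M G \<and> g \<in> hom M G Y \<and> \<theta> \<in> hom M (X n) G \<and>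
    homotopic M (g \<cdot> \<theta>) (\<phi> \<cdot> \<chi>) \<and> homotopic M (\<theta> \<cdot> j n) \<alpha>"
    by (rule Suc.IH[OF _ _ pc pcj]) (use Suc.prems(1,2) in auto)
  then obtain g \<alpha> \<theta> G where g: "ganea M \<iota> n g \<alpha>" "cofibrant_fibrant M G" "g \<in> hom M G Y" "\<theta> \<in> hom M (X n) G"
    "homotopic M (g \<cdot> \<theta>) (\<phi> \<cdot> \<chi>)" by blast
  obtain S T g' G' where st: "is_homotopy_pullback M S" "in1 S = \<iota>" "in2 S = g"
    "is_homotopy_pushout M T" "is_whisker_map M T S g'" "cofibrant_fibrant M G'"
    "in1 T \<in> hom M A G'" "in2 T \<in> hom M G G'" "g' \<in> hom M G' Y" "g' \<cdot> in1 T = \<iota>" "g' \<cdot> in2 T = g"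
    and L: "\<And>Z J k \<rho> \<mu> K. cofibrant M Z \<Longrightarrow> is_cylinder M Z J \<Longrightarrow> inc0 J \<in> hom M Z k \<Longrightarrow>
       \<rho> \<in> hom M Z A \<Longrightarrow> \<mu> \<in> hom M Z G \<Longrightarrow> K \<in> hom M k Y \<Longrightarrow> K \<cdot> inc0 J = \<iota> \<cdot> \<rho> \<Longrightarrow> K \<cdot> inc1 J = g \<cdot> \<mu> \<Longrightarrow>
       \<exists>l \<in> hom M k G'. l \<cdot> inc0 J = in1 T \<cdot> \<rho> \<and> l \<cdot> inc1 J = in2 T \<cdot> \<mu> \<and> g' \<cdot> l = K"
    by (rule ex_fibrant_ganea_stage[OF A Y g(2) iota g(3)]) (assumption | rule)+
  obtain \<theta>' where "\<theta>' \<in> hom M (X (Suc n)) G'" "homotopic M (g' \<cdot> \<theta>') \<phi>" "homotopic M (\<theta>' \<cdot> j (Suc n)) (in1 T)"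
    by (rule extend_over_homotopy_pushout[OF C(4,1,2,3) Xn(4) cf(2)[OF Y] cf(2)[OF st(6)] iota g(3)
          Suc.prems(3,4) g(4,5) st(7-11) L])
  moreover have "ganea M \<iota> (Suc n) g' (in1 T)" by (rule ganea_Suc[OF g(1) st(1-5)])
  ultimately show ?case using st(6,9) by blast
qed

section \<open>Ganea constructions are strong chains\<close>

text \<open>The homotopy is lifted to the fibration \<open>p\<close> that replaces \<open>in1 S\<close>; its end and \<open>v\<close> form a map to the
  strict pullback, and this map lifts along the comparison \<open>w\<close> up to homotopy. The first
  component is only controlled after composing with the weak equivalence \<open>i\<close>, which is cancelled.\<close>

lemma whisker_into_homotopy_pullback:
  assumes hpb: "is_homotopy_pullback M S" and S: "in1 S \<in> hom M A Y" "in2 S \<in> hom M G Y"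
    and Z: "cofibrant M Z" and u: "u \<in> hom M Z A" and v: "v \<in> hom M Z G"
    and h: "homotopic M (in1 S \<cdot> u) (in2 S \<cdot> v)"
  obtains \<sigma> where "\<sigma> \<in> hom M Z (Dom M (out1 S))" "homotopic M (out1 S \<cdot> \<sigma>) u" "homotopic M (out2 S \<cdot> \<sigma>) v"
proof -
  note cf = cofibrant_fibrantD
  obtain e i p L x y w where E: "i \<in> hom M (Dom M (in1 S)) e" "p \<in> hom M e (Cod M (in1 S))"
    "L \<in> hom M (Cod M (inc0 (cyl S))) e"
    "in1 S = p \<cdot> i" "i \<in> We M" "p \<in> Fib M"
    "L \<cdot> inc0 (cyl S) = i \<cdot> out1 S" "p \<cdot> L = htpy S" "is_pullback M x y p (in2 S)"
    "w \<in> hom M (Dom M (out1 S)) (Dom M x)"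
    "x \<cdot> w = L \<cdot> inc1 (cyl S)" "y \<cdot> w = out2 S" "w \<in> We M"
    and sq: "homotopy_commutative_square M S"
    using hpb unfolding is_homotopy_pullback_def by blast
  obtain F A' G' Y' k where Q: "cofibrant_fibrant M F" "cofibrant_fibrant M A'" "cofibrant_fibrant M G'"
    "cofibrant_fibrant M Y'" "out1 S \<in> hom M F A'" "out2 S \<in> hom M F G'" "in1 S \<in> hom M A' Y'" "in2 S \<in> hom M G' Y'"
    "is_cylinder M F (cyl S)" "inc0 (cyl S) \<in> hom M F k" "inc1 (cyl S) \<in> hom M F k" "htpy S \<in> hom M k Y'"
    "htpy S \<cdot> inc0 (cyl S) = in1 S \<cdot> out1 S" "htpy S \<cdot> inc1 (cyl S) = in2 S \<cdot> out2 S"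
    by (rule homotopy_commutative_squareE[OF sq])
  have eq: "A' = A" "Y' = Y" "G' = G" using Q(7,8) S by (auto simp: hom_def)
  note Q = Q[unfolded eq]
  have c: "Dom M (in1 S) = A" "Cod M (in1 S) = Y" "Cod M (inc0 (cyl S)) = k" "Dom M (out1 S) = F"
    using Q by (auto simp: hom_simps)
  have i: "i \<in> hom M A e" and p: "p \<in> hom M e Y" and L: "L \<in> hom M k e" using E(1-3) c by auto
  obtain P where xy: "x \<in> hom M P e" "y \<in> hom M P G" "p \<cdot> x = in2 S \<cdot> y"
    using pullback_hom[OF E(9) p S(2)] by blast
  have w: "w \<in> hom M F P" using E(10) c xy by (simp add: hom_simps)
  have e: "fibrant M e" using fibrant_total[OF p E(6) cf(2)[OF Q(4)]] .
  have P: "fibrant M P" by (rule pullback_fibrant[OF E(9) p E(6) S(2) cf(2)[OF Q(3)] xy(1)])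
  have iu: "i \<cdot> u \<in> hom M Z e" using i u by (auto intro: comp_in_hom)
  obtain J H k' where J: "is_cylinder M Z J" "inc0 J \<in> hom M Z k'" "inc1 J \<in> hom M Z k'"
    "prj J \<in> hom M k' Z" "prj J \<in> We M" "prj J \<cdot> inc0 J = Id M Z" "prj J \<cdot> inc1 J = Id M Z"
    "H \<in> hom M k' Y" "H \<cdot> inc0 J = in1 S \<cdot> u" "H \<cdot> inc1 J = in2 S \<cdot> v" "in2 S \<cdot> v \<in> hom M Z Y"
    by (rule homotopicE[OF h comp_in_hom[OF u S(1)]])
  have pu: "p \<cdot> (i \<cdot> u) = H \<cdot> inc0 J" using J(9) E(4) i p u by (simp add: hom_simps)
  obtain K where K: "K \<in> hom M k' e" "K \<cdot> inc0 J = i \<cdot> u" "p \<cdot> K = H"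
    using lift[OF J(2) p iu J(8) pu] cylinder_inclusion_Cof[OF J(1) Z] cylinder_inclusion_We[OF J(1)] E(6)
    by blast
  have K1: "K \<cdot> inc1 J \<in> hom M Z e" using K J by (auto intro: comp_in_hom)
  have pK: "p \<cdot> (K \<cdot> inc1 J) = in2 S \<cdot> v" using comp_reduce[OF K(3,1) p J(3)] J by simp
  obtain m where m: "m \<in> hom M Z P" "x \<cdot> m = K \<cdot> inc1 J" "y \<cdot> m = v"
    by (rule pullback_universal[OF E(9) xy(1) p S(2) K1 v pK])
  obtain \<sigma> where s: "\<sigma> \<in> hom M Z F" "homotopic M (w \<cdot> \<sigma>) m"
    by (rule lift_along_We[OF w E(13) cf(2)[OF Q(1)] P Z m(1)])
  have ws: "w \<cdot> \<sigma> \<in> hom M Z P" using w s by (auto intro: comp_in_hom)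
  have "homotopic M (out2 S \<cdot> \<sigma>) v"
    using homotopic_postcomp[OF s(2) ws xy(2)] comp_reduce[OF E(12) w xy(2) s(1)] m(3) by simp
  moreover have "homotopic M (out1 S \<cdot> \<sigma>) u"
  proof (rule homotopic_cancel_We_left[OF i E(5) cf(2)[OF Q(2)] comp_in_hom[OF s(1) Q(5)] u])
    have os: "i \<cdot> (out1 S \<cdot> \<sigma>) \<in> hom M Z e" using i Q(5) s by (auto intro!: comp_in_hom)
    have "homotopic M (L \<cdot> inc0 (cyl S)) (L \<cdot> inc1 (cyl S))"
      by (rule homotopicI[OF Q(9,10) L refl refl])
    from homotopic_precomp[OF this comp_in_hom[OF Q(10) L] e s(1)]
    have 1: "homotopic M (i \<cdot> (out1 S \<cdot> \<sigma>)) (x \<cdot> (w \<cdot> \<sigma>))"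
      unfolding comp_reduce[OF E(7)[symmetric] Q(5) i s(1)] comp_reduce[OF E(11) w xy(1) s(1)] .
    have 2: "homotopic M (x \<cdot> (w \<cdot> \<sigma>)) (K \<cdot> inc1 J)"
      using homotopic_postcomp[OF s(2) ws xy(1)] m(2) by simp
    have "homotopic M (K \<cdot> inc0 J) (K \<cdot> inc1 J)" by (rule homotopicI[OF J(1,2) K(1) refl refl])
    then have 3: "homotopic M (K \<cdot> inc1 J) (i \<cdot> u)" using homotopic_sym[OF _ iu e] K(2) by simp
    show "homotopic M (i \<cdot> (out1 S \<cdot> \<sigma>)) (i \<cdot> u)"
      using homotopic_trans[OF homotopic_trans[OF 1 2 os Z e] 3 os Z e] .
  qed
  ultimately show thesis using that s(1) c by simp
qed

lemma whisker_map_in1: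
  assumes T: "homotopy_commutative_square M T" and S: "homotopy_commutative_square M S"
    and wh: "is_whisker_map M T S e"
  shows "homotopic M (e \<cdot> in1 T) (in1 S)"
proof -
  obtain z a b d i where sq: "cofibrant_fibrant M z" "cofibrant_fibrant M a" "cofibrant_fibrant M b"
    "cofibrant_fibrant M d" "out1 T \<in> hom M z a" "out2 T \<in> hom M z b" "in1 T \<in> hom M a d" "in2 T \<in> hom M b d"
    "is_cylinder M z (cyl T)" "inc0 (cyl T) \<in> hom M z i" "inc1 (cyl T) \<in> hom M z i" "htpy T \<in> hom M i d"
    "htpy T \<cdot> inc0 (cyl T) = in1 T \<cdot> out1 T" "htpy T \<cdot> inc1 (cyl T) = in2 T \<cdot> out2 T"
    by (rule homotopy_commutative_squareE[OF T])
  obtain a' d' where S1: "in1 S \<in> hom M a' d'" and d': "cofibrant_fibrant M d'"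
    using S unfolding homotopy_commutative_square_def by blast
  obtain j c k w x where e: "e \<in> hom M (Cod M (in1 T)) (Cod M (in1 S))"
    and dmc: "is_double_mapping_cylinder M (out1 T) (out2 T) (cyl T) j c k"
    and ind: "induced_on_dmc M j c k T w" "induced_on_dmc M j c k S x" and h: "homotopic M (e \<cdot> w) x"
    using wh unfolding is_whisker_map_def by blast
  obtain D where D: "j \<in> hom M a D" by (rule dmc_hom[OF dmc sq(5,6,10)])
  have w: "w \<in> hom M D d" "w \<cdot> j = in1 T" and x: "x \<cdot> j = in1 S" and e: "e \<in> hom M d d'"
    using ind e D S1 sq(7) unfolding induced_on_dmc_def by (auto simp: hom_simps)
  have "homotopic M ((e \<cdot> w) \<cdot> j) (x \<cdot> j)"
    by (rule homotopic_precomp[OF h comp_in_hom[OF w(1) e] cofibrant_fibrantD(2)[OF d'] D])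
  then show ?thesis using w x e D by (simp add: hom_simps)
qed

text \<open>In the inductive step, the whisker map \<open>\<sigma>\<close> of \<open>Id\<close> and \<open>\<alpha>\<close> is the section required by \<open>Relcat\<close>. It also
  gives the homotopy \<open>\<gamma> \<cdot> \<alpha> \<simeq> \<gamma> \<cdot> \<beta> \<cdot> \<sigma> \<simeq> \<alpha>' \<cdot> \<eta> \<cdot> \<sigma> \<simeq> \<alpha>'\<close> required by \<open>Pushcat\<close>, where \<open>\<eta>\<close>, \<open>\<beta>\<close>, \<open>\<alpha>'\<close>, \<open>\<gamma>\<close> are the
  maps of the square \<open>T\<close>.\<close>

lemma ganea_strong_chain:
  assumes A: "cofibrant_fibrant M A" and Y: "cofibrant_fibrant M Y" and iota: "\<iota> \<in> hom M A Y"
    and ganea: "ganea M \<iota> n g \<alpha>"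
  shows "\<exists>G. cofibrant_fibrant M G \<and> g \<in> hom M G Y \<and> \<alpha> \<in> hom M A G \<and> homotopic M (g \<cdot> \<alpha>) \<iota> \<and>
    (\<exists>X j. X n = G \<and> j n = \<alpha> \<and> j 0 = Id M A \<and> (\<forall>i\<le>n. cofibrant_fibrant M (X i) \<and> j i \<in> hom M A (X i)) \<and>
      (\<forall>i<n. \<exists>z. \<exists>\<rho> \<in> hom M z A. \<exists>\<tau> \<in> hom M z (X i). \<exists>\<chi> \<in> hom M (X i) (X (Suc i)).
        homotopy_pushout M \<rho> \<tau> (j (Suc i)) \<chi> \<and> homotopic M (\<chi> \<cdot> j i) (j (Suc i)) \<and>
        (\<exists>\<sigma> \<in> hom M A z. homotopic M (\<rho> \<cdot> \<sigma>) (Id M A) \<and> homotopic M (\<tau> \<cdot> \<sigma>) (j i))))"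
  using ganea
proof induction
  case ganea_0
  have "Dom M \<iota> = A" "Id M A \<in> hom M A A" using iota cofibrant_Ob cofibrant_fibrantD(1)[OF A] id_in_hom
    by (auto simp: hom_simps)
  moreover have "homotopic M (\<iota> \<cdot> Id M A) \<iota>" using homotopic_refl[OF iota] comp_id_right[OF iota] by simp
  ultimately show ?case
    using A iota by (intro exI[of _ A] conjI exI[of _ "\<lambda>_. A"] exI[of _ "\<lambda>_. Id M A"]) auto
next
  case (ganea_Suc n g \<alpha> S T g')
  note cf = cofibrant_fibrantD
  obtain G X j where G: "cofibrant_fibrant M G" "g \<in> hom M G Y" "\<alpha> \<in> hom M A G" "homotopic M (g \<cdot> \<alpha>) \<iota>"
    and X: "X n = G" "j n = \<alpha>" "j 0 = Id M A" "\<And>i. i \<le> n \<Longrightarrow> cofibrant_fibrant M (X i) \<and> j i \<in> hom M A (X i)"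
    and C: "\<And>i. i < n \<Longrightarrow> \<exists>z. \<exists>\<rho> \<in> hom M z A. \<exists>\<tau> \<in> hom M z (X i). \<exists>\<chi> \<in> hom M (X i) (X (Suc i)).
        homotopy_pushout M \<rho> \<tau> (j (Suc i)) \<chi> \<and> homotopic M (\<chi> \<cdot> j i) (j (Suc i)) \<and>
        (\<exists>\<sigma> \<in> hom M A z. homotopic M (\<rho> \<cdot> \<sigma>) (Id M A) \<and> homotopic M (\<tau> \<cdot> \<sigma>) (j i))"
    using ganea_Suc.IH by blast
  have S: "in1 S \<in> hom M A Y" "in2 S \<in> hom M G Y" using ganea_Suc.hyps iota G by auto
  have sqS: "homotopy_commutative_square M S" and sqT: "homotopy_commutative_square M T"
    using ganea_Suc.hyps unfolding is_homotopy_pullback_def is_homotopy_pushout_def by auto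
  have out: "out1 S = out1 T" "out2 S = out2 T" "g' \<in> hom M (Cod M (in1 T)) (Cod M (in1 S))"
    using ganea_Suc.hyps unfolding is_whisker_map_def by auto
  obtain z a b G' where T: "cofibrant_fibrant M z" "cofibrant_fibrant M G'" "out1 T \<in> hom M z a" "out2 T \<in> hom M z b"
    "in1 T \<in> hom M a G'" "in2 T \<in> hom M b G'"
    using sqT unfolding homotopy_commutative_square_def by blast
  obtain z2 a2 b2 d2 where S2: "out1 S \<in> hom M z2 a2" "out2 S \<in> hom M z2 b2" "in1 S \<in> hom M a2 d2" "in2 S \<in> hom M b2 d2"
    using sqS unfolding homotopy_commutative_square_def by blast
  have "a = A" "b = G" using T S S2 out by (auto simp: hom_def)
  note T = T[unfolded this]
  have g': "g' \<in> hom M G' Y" using out T S by (simp add: hom_simps)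
  have IdA: "Id M A \<in> hom M A A" using id_in_hom cofibrant_Ob cf(1)[OF A] by blast
  have "homotopic M (in1 S \<cdot> Id M A) (in2 S \<cdot> \<alpha>)"
    using homotopic_sym[OF G(4) comp_in_hom[OF G(3,2)] cf(2)[OF Y]] comp_id_right[OF S(1)] ganea_Suc.hyps by simp
  then obtain \<sigma> where s: "\<sigma> \<in> hom M A z" "homotopic M (out1 T \<cdot> \<sigma>) (Id M A)" "homotopic M (out2 T \<cdot> \<sigma>) \<alpha>"
    using whisker_into_homotopy_pullback[OF ganea_Suc.hyps(2) S cf(1)[OF A] IdA G(3)] out T by (auto simp: hom_simps)
  have o: "out1 T \<cdot> \<sigma> \<in> hom M A A" "out2 T \<cdot> \<sigma> \<in> hom M A G" using T s by (auto intro: comp_in_hom)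
  have t: "(in1 T \<cdot> out1 T) \<cdot> \<sigma> = in1 T \<cdot> (out1 T \<cdot> \<sigma>)" "(in2 T \<cdot> out2 T) \<cdot> \<sigma> = in2 T \<cdot> (out2 T \<cdot> \<sigma>)"
    using T s by (simp_all add: hom_simps)
  have 1: "homotopic M (in2 T \<cdot> \<alpha>) (in2 T \<cdot> (out2 T \<cdot> \<sigma>))"
    using homotopic_sym[OF homotopic_postcomp[OF s(3) o(2) T(6)] comp_in_hom[OF o(2) T(6)] cf(2)[OF T(2)]] .
  have 2: "homotopic M (in2 T \<cdot> (out2 T \<cdot> \<sigma>)) (in1 T \<cdot> (out1 T \<cdot> \<sigma>))"
    using homotopic_sym[OF homotopic_precomp[OF homotopy_commutative_square_homotopic[OF sqT]
        comp_in_hom[OF T(3,5)] cf(2)[OF T(2)] s(1)] _ cf(2)[OF T(2)]] comp_in_hom[OF o(1) T(5)] t by simp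
  have 3: "homotopic M (in1 T \<cdot> (out1 T \<cdot> \<sigma>)) (in1 T)"
    using homotopic_postcomp[OF s(2) o(1) T(5)] comp_id_right[OF T(5)] by simp
  have step: "homotopic M (in2 T \<cdot> \<alpha>) (in1 T)"
    using homotopic_trans[OF homotopic_trans[OF 1 2 _ cf(1)[OF A] cf(2)[OF T(2)]] 3 _ cf(1)[OF A] cf(2)[OF T(2)]]
      comp_in_hom[OF G(3) T(6)] by blast
  have po: "homotopy_pushout M (out1 T) (out2 T) (in1 T) (in2 T)"
    unfolding homotopy_pushout_def using ganea_Suc.hyps by blast
  define X' j' where "X' = X(Suc n := G')" and "j' = j(Suc n := in1 T)"
  have "\<exists>z. \<exists>\<rho> \<in> hom M z A. \<exists>\<tau> \<in> hom M z (X' i). \<exists>\<chi> \<in> hom M (X' i) (X' (Suc i)).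
        homotopy_pushout M \<rho> \<tau> (j' (Suc i)) \<chi> \<and> homotopic M (\<chi> \<cdot> j' i) (j' (Suc i)) \<and>
        (\<exists>\<sigma> \<in> hom M A z. homotopic M (\<rho> \<cdot> \<sigma>) (Id M A) \<and> homotopic M (\<tau> \<cdot> \<sigma>) (j' i))"
    if "i < Suc n" for i
  proof (cases "i = n")
    case True
    then have e: "X' i = G" "X' (Suc i) = G'" "j' i = \<alpha>" "j' (Suc i) = in1 T"
      by (simp_all add: X'_def j'_def X)
    show ?thesis unfolding e using T(3,4,6) po step s by blast
  next
    case False
    then have e: "X' i = X i" "X' (Suc i) = X (Suc i)" "j' i = j i" "j' (Suc i) = j (Suc i)" "i < n"
      using that by (simp_all add: X'_def j'_def)
    show ?thesis unfolding e(1-4) using C[OF e(5)] .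
  qed
  moreover have "cofibrant_fibrant M (X' i) \<and> j' i \<in> hom M A (X' i)" if "i \<le> Suc n" for i
    using that X(4)[of i] T(2,5) by (auto simp: X'_def j'_def le_Suc_eq)
  moreover have "X' (Suc n) = G'" "j' (Suc n) = in1 T" "j' 0 = Id M A" by (simp_all add: X'_def j'_def X)
  moreover have "homotopic M (g' \<cdot> in1 T) \<iota>"
    using whisker_map_in1[OF sqT sqS ganea_Suc.hyps(6)] ganea_Suc.hyps by simp
  ultimately show ?case using T(2,5) g' by blast
qed

section \<open>Domination and the invariants\<close>

lemma Pushcat_le_Relcat: "Pushcat M \<iota> \<le> Relcat M \<iota>"
  unfolding Pushcat_def Relcat_def
proof (rule Inf_superset_mono, rule Collect_mono, rule impI, elim exE conjE, goal_cases)
  case (1 _ n X j)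
  then show ?case by (intro exI[of _ n] exI[of _ X] exI[of _ j] conjI; (assumption | meson))
qed

lemma Relcat_ganea_le:
  assumes A: "cofibrant_fibrant M A" and Y: "cofibrant_fibrant M Y" and iota: "\<iota> \<in> hom M A Y"
    and ganea: "ganea M \<iota> n g \<alpha>"
  shows "Relcat M \<alpha> \<le> enat n"
proof -
  have AO: "A \<in> Ob M" using iota hom_Ob by blast
  obtain G X j where G: "\<alpha> \<in> hom M A G"
    and X: "X n = G" "j n = \<alpha>" "j 0 = Id M A" "\<forall>i\<le>n. cofibrant_fibrant M (X i) \<and> j i \<in> hom M A (X i)"
    and C: "\<forall>i<n. \<exists>z. \<exists>\<rho> \<in> hom M z A. \<exists>\<tau> \<in> hom M z (X i). \<exists>\<chi> \<in> hom M (X i) (X (Suc i)).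
        homotopy_pushout M \<rho> \<tau> (j (Suc i)) \<chi> \<and> homotopic M (\<chi> \<cdot> j i) (j (Suc i)) \<and>
        (\<exists>\<sigma> \<in> hom M A z. homotopic M (\<rho> \<cdot> \<sigma>) (Id M A) \<and> homotopic M (\<tau> \<cdot> \<sigma>) (j i))"
    using ganea_strong_chain[OF A Y iota ganea] by blast
  have e: "Dom M \<alpha> = A" "Cod M \<alpha> = G" using G by (auto simp: hom_simps)
  have "has_homotopy_inverse M (j 0)"
    unfolding has_homotopy_inverse_def X(3)
    using homotopic_refl[OF id_in_hom[OF AO]] id_in_hom[OF AO] AO
    by (intro bexI[of _ "Id M A"]) auto
  moreover have "homotopic M (j n) \<alpha>" using homotopic_refl[OF G] X by simp
  ultimately show ?thesis
    unfolding Relcat_def Inf_enat_le_iff e using X(1,4) C by blast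
qed

lemma Pushcat_le_imp_map_to_ganea:
  assumes A: "cofibrant_fibrant M A" and Y: "cofibrant_fibrant M Y" and iota: "\<iota> \<in> hom M A Y"
    and iX: "\<iota>X \<in> hom M A X" and le: "Pushcat M \<iota>X \<le> enat n"
    and phi: "\<phi> \<in> hom M X Y" "homotopic M (\<phi> \<cdot> \<iota>X) \<iota>"
  obtains m g \<alpha> \<theta> G where "m \<le> n" "ganea M \<iota> m g \<alpha>" "cofibrant_fibrant M G" "g \<in> hom M G Y" "\<theta> \<in> hom M X G"
    "homotopic M (g \<cdot> \<theta>) \<phi>" "homotopic M (\<theta> \<cdot> \<iota>X) \<alpha>"
proof -
  note cf = cofibrant_fibrantD
  have e: "Dom M \<iota>X = A" "Cod M \<iota>X = X" using iX by (auto simp: hom_simps)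
  obtain m Xs j where m: "m \<le> n" "Xs m = X"
    and X: "\<And>i. i \<le> m \<Longrightarrow> cofibrant_fibrant M (Xs i) \<and> j i \<in> hom M A (Xs i)"
    and j0: "has_homotopy_inverse M (j 0)"
    and C: "\<And>i. i < m \<Longrightarrow> \<exists>z. \<exists>\<rho> \<in> hom M z A. \<exists>\<tau> \<in> hom M z (Xs i). \<exists>\<chi> \<in> hom M (Xs i) (Xs (Suc i)).
        homotopy_pushout M \<rho> \<tau> (j (Suc i)) \<chi> \<and> homotopic M (\<chi> \<cdot> j i) (j (Suc i))"
    and jm: "homotopic M (j m) \<iota>X"
    using le unfolding Pushcat_def Inf_enat_le_iff e by blast
  have jmX: "j m \<in> hom M A X" using X[of m] m by simp
  have "homotopic M (\<phi> \<cdot> j m) (\<phi> \<cdot> \<iota>X)" by (rule homotopic_postcomp[OF jm jmX phi(1)])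
  from homotopic_trans[OF this phi(2) comp_in_hom[OF jmX phi(1)] cf(1)[OF A] cf(2)[OF Y]]
  have h: "homotopic M (\<phi> \<cdot> j m) \<iota>" .
  obtain g \<alpha> \<theta> G where G: "ganea M \<iota> m g \<alpha>" "cofibrant_fibrant M G" "g \<in> hom M G Y" "\<theta> \<in> hom M X G"
    "homotopic M (g \<cdot> \<theta>) \<phi>" "homotopic M (\<theta> \<cdot> j m) \<alpha>"
    using pushcat_chain_maps_to_ganea[OF A Y iota X j0 C _ h] phi(1) m(2) by auto
  have "homotopic M (\<theta> \<cdot> \<iota>X) (\<theta> \<cdot> j m)"
    using homotopic_sym[OF homotopic_postcomp[OF jm jmX G(4)] comp_in_hom[OF jmX G(4)] cf(2)[OF G(2)]] .
  from homotopic_trans[OF this G(6) comp_in_hom[OF iX G(4)] cf(1)[OF A] cf(2)[OF G(2)]]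
  show thesis using that m(1) G by blast
qed

context
  fixes A Y \<iota>
  assumes A: "cofibrant_fibrant M A" and Y: "cofibrant_fibrant M Y" and iota: "\<iota> \<in> hom M A Y"
begin

lemma secat_le_imp_simply_dominated:
  assumes "secat M \<iota> \<le> enat n"
  shows "\<exists>X \<iota>X. cofibrant_fibrant M X \<and> \<iota>X \<in> hom M A X \<and> simply_dominated M \<iota> \<iota>X \<and> Relcat M \<iota>X \<le> enat n"
proof -
  obtain m g \<alpha> \<sigma> where m: "m \<le> n" "ganea M \<iota> m g \<alpha>" "\<sigma> \<in> hom M (Cod M g) (Dom M g)"
    "homotopic M (g \<cdot> \<sigma>) (Id M (Cod M g))"
    using assms unfolding secat_def Inf_enat_le_iff by blast
  obtain G where G: "cofibrant_fibrant M G" "g \<in> hom M G Y" "\<alpha> \<in> hom M A G" "homotopic M (g \<cdot> \<alpha>) \<iota>"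
    using ganea_strong_chain[OF A Y iota m(2)] by blast
  have "simply_dominated M \<iota> \<alpha>"
    unfolding simply_dominated_def using G m(3,4) iota by (auto simp: hom_simps)
  moreover have "Relcat M \<alpha> \<le> enat n"
    using Relcat_ganea_le[OF A Y iota m(2)] m(1) by (meson enat_ord_simps(1) order_trans)
  ultimately show ?thesis using G by blast
qed

lemma relcat_le_imp_relatively_dominated:
  assumes "relcat M \<iota> \<le> enat n"
  shows "\<exists>X \<iota>X. cofibrant_fibrant M X \<and> \<iota>X \<in> hom M A X \<and> relatively_dominated M \<iota> \<iota>X \<and> Relcat M \<iota>X \<le> enat n"
proof -
  obtain m g \<alpha> \<sigma> where m: "m \<le> n" "ganea M \<iota> m g \<alpha>" "\<sigma> \<in> hom M (Cod M g) (Dom M g)"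
    "homotopic M (g \<cdot> \<sigma>) (Id M (Cod M g))" "homotopic M (\<sigma> \<cdot> \<iota>) \<alpha>"
    using assms unfolding relcat_def Inf_enat_le_iff by blast
  obtain G where G: "cofibrant_fibrant M G" "g \<in> hom M G Y" "\<alpha> \<in> hom M A G" "homotopic M (g \<cdot> \<alpha>) \<iota>"
    using ganea_strong_chain[OF A Y iota m(2)] by blast
  have "relatively_dominated M \<iota> \<alpha>"
    unfolding relatively_dominated_def using G m(3-5) iota by (auto simp: hom_simps)
  moreover have "Relcat M \<alpha> \<le> enat n"
    using Relcat_ganea_le[OF A Y iota m(2)] m(1) by (meson enat_ord_simps(1) order_trans)
  ultimately show ?thesis using G by blast
qed

lemma homotopy_section_from_domination:
  assumes iX: "\<iota>X \<in> hom M A X" and le: "Pushcat M \<iota>X \<le> enat n"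
    and phi: "\<phi> \<in> hom M X Y" "homotopic M (\<phi> \<cdot> \<iota>X) \<iota>"
    and s: "\<sigma> \<in> hom M Y X" "homotopic M (\<phi> \<cdot> \<sigma>) (Id M Y)"
  obtains m g \<alpha> \<tau> G where "m \<le> n" "ganea M \<iota> m g \<alpha>" "g \<in> hom M G Y" "\<tau> \<in> hom M Y G"
    "homotopic M (g \<cdot> \<tau>) (Id M Y)" "homotopic M (\<sigma> \<cdot> \<iota>) \<iota>X \<Longrightarrow> homotopic M (\<tau> \<cdot> \<iota>) \<alpha>"
proof -
  note cf = cofibrant_fibrantD
  obtain m g \<alpha> \<theta> G where G: "m \<le> n" "ganea M \<iota> m g \<alpha>" "cofibrant_fibrant M G" "g \<in> hom M G Y" "\<theta> \<in> hom M X G"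
    "homotopic M (g \<cdot> \<theta>) \<phi>" "homotopic M (\<theta> \<cdot> \<iota>X) \<alpha>"
    by (rule Pushcat_le_imp_map_to_ganea[OF A Y iota iX le phi])
  have t: "\<theta> \<cdot> \<sigma> \<in> hom M Y G" using G s by (auto intro: comp_in_hom)
  have "homotopic M (g \<cdot> (\<theta> \<cdot> \<sigma>)) (\<phi> \<cdot> \<sigma>)"
    using homotopic_precomp[OF G(6) comp_in_hom[OF G(5,4)] cf(2)[OF Y] s(1)] G(4,5) s(1)
    by (simp add: hom_simps)
  from homotopic_trans[OF this s(2) comp_in_hom[OF t G(4)] cf(1)[OF Y] cf(2)[OF Y]]
  have sec: "homotopic M (g \<cdot> (\<theta> \<cdot> \<sigma>)) (Id M Y)" .
  have "homotopic M ((\<theta> \<cdot> \<sigma>) \<cdot> \<iota>) \<alpha>" if r: "homotopic M (\<sigma> \<cdot> \<iota>) \<iota>X"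
  proof -
    have "homotopic M ((\<theta> \<cdot> \<sigma>) \<cdot> \<iota>) (\<theta> \<cdot> \<iota>X)"
      using homotopic_postcomp[OF r comp_in_hom[OF iota s(1)] G(5)] G(5) s(1) iota by (simp add: hom_simps)
    from homotopic_trans[OF this G(7) comp_in_hom[OF iota t] cf(1)[OF A] cf(2)[OF G(3)]]
    show ?thesis .
  qed
  then show thesis using that G t sec by blast
qed

lemma simply_dominated_imp_secat_le:
  assumes iX: "\<iota>X \<in> hom M A X" and le: "Pushcat M \<iota>X \<le> enat n" and dom: "simply_dominated M \<iota> \<iota>X"
  shows "secat M \<iota> \<le> enat n"
proof -
  obtain \<phi> \<sigma> where phi: "\<phi> \<in> hom M X Y" "\<sigma> \<in> hom M Y X" "homotopic M (\<phi> \<cdot> \<iota>X) \<iota>" "homotopic M (\<phi> \<cdot> \<sigma>) (Id M Y)"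
    using dom iX iota unfolding simply_dominated_def by (auto simp: hom_simps)
  obtain m g \<alpha> \<tau> G where "m \<le> n" "ganea M \<iota> m g \<alpha>" "g \<in> hom M G Y" "\<tau> \<in> hom M Y G"
    "homotopic M (g \<cdot> \<tau>) (Id M Y)"
    using homotopy_section_from_domination[OF iX le phi(1,3,2,4)] by metis
  then show ?thesis unfolding secat_def Inf_enat_le_iff by (metis hom_simps(2,3))
qed

lemma relatively_dominated_imp_relcat_le:
  assumes iX: "\<iota>X \<in> hom M A X" and le: "Pushcat M \<iota>X \<le> enat n" and dom: "relatively_dominated M \<iota> \<iota>X"
  shows "relcat M \<iota> \<le> enat n"
proof -
  obtain \<phi> \<sigma> where phi: "\<phi> \<in> hom M X Y" "\<sigma> \<in> hom M Y X" "homotopic M (\<phi> \<cdot> \<iota>X) \<iota>" "homotopic M (\<phi> \<cdot> \<sigma>) (Id M Y)"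
    "homotopic M (\<sigma> \<cdot> \<iota>) \<iota>X"
    using dom iX iota unfolding relatively_dominated_def by (auto simp: hom_simps)
  obtain m g \<alpha> \<tau> G where "m \<le> n" "ganea M \<iota> m g \<alpha>" "g \<in> hom M G Y" "\<tau> \<in> hom M Y G"
    "homotopic M (g \<cdot> \<tau>) (Id M Y)" "homotopic M (\<tau> \<cdot> \<iota>) \<alpha>"
    using homotopy_section_from_domination[OF iX le phi(1,3,2,4)] phi(5) by metis
  then show ?thesis unfolding relcat_def Inf_enat_le_iff by (metis hom_simps(2,3))
qed

end

end

theorem proposition10:
  fixes M :: "('o, 'm) model_cat" and A Y :: 'o and \<iota>Y :: 'm and n :: nat
  assumes "closed_model_category M"
    and "cube_axiom M"
    and "cofibrant_fibrant M A"
    and "cofibrant_fibrant M Y"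
    and "\<iota>Y \<in> hom M A Y"
  shows
    "((secat M \<iota>Y \<le> enat n \<longleftrightarrow>
        (\<exists>X \<iota>X. cofibrant_fibrant M X \<and> \<iota>X \<in> hom M A X \<and>
           simply_dominated M \<iota>Y \<iota>X \<and> Pushcat M \<iota>X \<le> enat n)) \<and>
      (secat M \<iota>Y \<le> enat n \<longleftrightarrow>
        (\<exists>X' \<iota>X'. cofibrant_fibrant M X' \<and> \<iota>X' \<in> hom M A X' \<and>
           simply_dominated M \<iota>Y \<iota>X' \<and> Relcat M \<iota>X' \<le> enat n)))
     \<and>
     ((relcat M \<iota>Y \<le> enat n \<longleftrightarrow>
        (\<exists>X \<iota>X. cofibrant_fibrant M X \<and> \<iota>X \<in> hom M A X \<and>
           relatively_dominated M \<iota>Y \<iota>X \<and> Pushcat M \<iota>X \<le> enat n)) \<and>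
      (relcat M \<iota>Y \<le> enat n \<longleftrightarrow>
        (\<exists>X' \<iota>X'. cofibrant_fibrant M X' \<and> \<iota>X' \<in> hom M A X' \<and>
           relatively_dominated M \<iota>Y \<iota>X' \<and> Relcat M \<iota>X' \<le> enat n)))"
proof -
  interpret closed_model_category M by fact
  note AY = assms(3-5)
  have PR: "Relcat M \<iota>X \<le> enat n \<Longrightarrow> Pushcat M \<iota>X \<le> enat n" for \<iota>X
    using Pushcat_le_Relcat order_trans by blast
  show ?thesis
    using secat_le_imp_simply_dominated[OF AY] relcat_le_imp_relatively_dominated[OF AY]
      simply_dominated_imp_secat_le[OF AY] relatively_dominated_imp_relcat_le[OF AY] PR
    by meson
qed

end
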